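(* There is an algorithm which, given a block graph $G$, computes the isometric-path number $\mathrm{ip}(G)$ together with a family of exactly $\mathrm{ip}(G)$ isometric paths of $G$ covering all vertices of $G$, in time $O(|V(G)|+|E(G)|)$.
   Context: Graphs are finite, simple and nonempty, and are given to the algorithm by adjacency lists; running time is measured in the standard unit-cost RAM model. A block graph is a graph in which every block (maximal connected subgraph without a cut-vertex of its own) is a complete graph. A cut-vertex of a graph is a vertex whose removal results in a graph with more components than the original graph. An isometric path between two vertices of $G$ is a shortest path in $G$ joining them; the two vertices may coincide, so a single vertex is an isometric path (of length 0). The isometric-path number $\mathrm{ip}(G)$ is the minimum number of isometric paths of $G$ required to cover all vertices of $G$ (i.e. such that every vertex lies on at least one of the paths). *)

theory Defs
  imports "Graph_Theory.Graph_Theory"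
begin

section \<open>Block graphs and isometric paths\<close>

text \<open>
  A finite simple undirected graph is a finite symmetric digraph without loops and parallel arcs
  (locale \<^locale>\<open>graph\<close>). For such a digraph \<^const>\<open>pre_digraph.sccs\<close> is the set of connected
  components.
\<close>

definition cut_vertex :: "('a,'b) pre_digraph \<Rightarrow> 'a \<Rightarrow> bool" where
  "cut_vertex G v \<longleftrightarrow> v \<in> verts G \<and>
     card (pre_digraph.sccs G) < card (pre_digraph.sccs (pre_digraph.del_vert G v))"

text \<open>
  \<^const>\<open>subgraph\<close> alone would admit non-symmetric arc sets, hence the conjunct \<^term>\<open>graph H\<close>.
  The predicate \<^const>\<open>connected\<close> excludes the empty graph.
\<close>

definition block :: "('a,'b) pre_digraph \<Rightarrow> ('a,'b) pre_digraph \<Rightarrow> bool" where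
  "block G B \<longleftrightarrow>
     pre_digraph.max_subgraph G (\<lambda>H. graph H \<and> connected H \<and> (\<forall>v. \<not> cut_vertex H v)) B"

definition block_graph :: "('a,'b) pre_digraph \<Rightarrow> bool" where
  "block_graph G \<longleftrightarrow> graph G \<and> verts G \<noteq> {} \<and>
     (\<forall>B. block G B \<longrightarrow> complete_digraph (card (verts B)) B)"

text \<open>Paths are given by their lists of vertices; \<^term>\<open>[v]\<close> is a path of length 0.\<close>

definition isometric_path :: "('a,'b) pre_digraph \<Rightarrow> 'a list \<Rightarrow> bool" where
  "isometric_path G p \<longleftrightarrow> vpath p G \<and>
     (\<forall>q. vpath q G \<and> hd q = hd p \<and> last q = last p \<longrightarrow> vwalk_length p \<le> vwalk_length q)"

definition isometric_path_cover :: "('a,'b) pre_digraph \<Rightarrow> 'a list list \<Rightarrow> bool" where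
  "isometric_path_cover G ps \<longleftrightarrow>
     (\<forall>p\<in>set ps. isometric_path G p) \<and> (\<forall>v\<in>verts G. \<exists>p\<in>set ps. v \<in> set p)"

definition ip :: "('a,'b) pre_digraph \<Rightarrow> nat" where
  "ip G = (LEAST k. \<exists>ps. isometric_path_cover G ps \<and> length ps = k)"

text \<open>Each undirected edge is represented by two opposite arcs but counted once.\<close>

definition num_edges :: "('a,'b) pre_digraph \<Rightarrow> nat" where
  "num_edges G = card {{u, v} |u v. (u, v) \<in> arcs_ends G}"


section \<open>Unit-cost random access machine\<close>

text \<open>
  The machine of Cook and Reckhow: no multiplication, a read-only input tape and a write-only
  output tape. Registers hold natural numbers, so that every register content is an address, and
  \<open>Sub\<close> is truncated subtraction. A run ends when the program counter leaves the program.
\<close>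

datatype instr =
    Const nat nat    \<comment> \<open>\<open>Const i c\<close>:  \<open>X\<^sub>i := c\<close>\<close>
  | Add nat nat nat  \<comment> \<open>\<open>Add i j k\<close>:  \<open>X\<^sub>i := X\<^sub>j + X\<^sub>k\<close>\<close>
  | Sub nat nat nat  \<comment> \<open>\<open>Sub i j k\<close>:  \<open>X\<^sub>i := X\<^sub>j - X\<^sub>k\<close>\<close>
  | Load nat nat     \<comment> \<open>\<open>Load i j\<close>:  \<open>X\<^sub>i := X\<^sub>a\<close> where \<open>a = X\<^sub>j\<close>\<close>
  | Store nat nat    \<comment> \<open>\<open>Store i j\<close>:  \<open>X\<^sub>a := X\<^sub>j\<close> where \<open>a = X\<^sub>i\<close>\<close>
  | JumpPos nat nat  \<comment> \<open>\<open>JumpPos i l\<close>:  go to instruction \<open>l\<close> if \<open>X\<^sub>i > 0\<close>\<close>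
  | Read nat         \<comment> \<open>next input number, or 0 if the input is exhausted\<close>
  | Print nat

record ram_state =
  pc :: nat
  mem :: "nat \<Rightarrow> nat"
  inp :: "nat list"
  out :: "nat list"

fun ram_instr :: "instr \<Rightarrow> ram_state \<Rightarrow> ram_state" where
  "ram_instr (Const i c) s = s\<lparr>pc := pc s + 1, mem := (mem s)(i := c)\<rparr>"
| "ram_instr (Add i j k) s = s\<lparr>pc := pc s + 1, mem := (mem s)(i := mem s j + mem s k)\<rparr>"
| "ram_instr (Sub i j k) s = s\<lparr>pc := pc s + 1, mem := (mem s)(i := mem s j - mem s k)\<rparr>"
| "ram_instr (Load i j) s = s\<lparr>pc := pc s + 1, mem := (mem s)(i := mem s (mem s j))\<rparr>"
| "ram_instr (Store i j) s = s\<lparr>pc := pc s + 1, mem := (mem s)(mem s i := mem s j)\<rparr>"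
| "ram_instr (JumpPos i l) s = s\<lparr>pc := (if mem s i > 0 then l else pc s + 1)\<rparr>"
| "ram_instr (Read i) s =
     s\<lparr>pc := pc s + 1, mem := (mem s)(i := (case inp s of [] \<Rightarrow> 0 | x # _ \<Rightarrow> x)), inp := tl (inp s)\<rparr>"
| "ram_instr (Print i) s = s\<lparr>pc := pc s + 1, out := out s @ [mem s i]\<rparr>"

definition ram_step :: "instr list \<Rightarrow> ram_state \<Rightarrow> ram_state" where
  "ram_step P s = (if pc s < length P then ram_instr (P ! pc s) s else s)"

definition ram_init :: "nat list \<Rightarrow> ram_state" where
  "ram_init xs = \<lparr>pc = 0, mem = (\<lambda>_. 0), inp = xs, out = []\<rparr>"

text \<open>On input \<open>xs\<close>, the program halts after at most \<open>t\<close> steps, having printed \<open>ys\<close>.\<close>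

definition ram_computes :: "instr list \<Rightarrow> nat list \<Rightarrow> nat list \<Rightarrow> nat \<Rightarrow> bool" where
  "ram_computes P xs ys t \<longleftrightarrow>
     (let s = (ram_step P ^^ t) (ram_init xs) in length P \<le> pc s \<and> out s = ys)"


section \<open>Input and output format\<close>

text \<open>The vertices are numbered from 0, and the neighbours of a vertex come in any order.\<close>

definition adjacency_lists :: "nat pair_pre_digraph \<Rightarrow> nat list list \<Rightarrow> bool" where
  "adjacency_lists G L \<longleftrightarrow> pverts G = {..<length L} \<and>
     (\<forall>v<length L. distinct (L ! v) \<and> set (L ! v) = {w. (v, w) \<in> parcs G})"

definition encode_lists :: "nat list list \<Rightarrow> nat list" where
  "encode_lists xss = length xss # concat (map (\<lambda>xs. length xs # xs) xss)"

end

(*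
  In a block graph, inner vertices of an isometric path are cut-vertices, so every simplicial vertex
  is an end of some path of a cover, and a component with s simplicial vertices needs at least
  ceil(s/2) paths. This number is attained. Breadth-first search yields the rooted tree of vertices
  and blocks; the tree is processed bottom-up, and every node passes one or two open paths, each
  starting at a leaf, to its parent: as soon as a node receives three or more, two that come from
  different children are joined. Every vertex thus lies on some path, each tree edge is used at most
  twice, so the total length of the paths is linear, and parity determines how many open paths
  reach the root. Since a path of the tree without repetitions is isometric in the graph, it suffices
  to store the pairs of ends and to print the paths by climbing to the lowest common ancestor.
*)
theory Submission
  imports Defs
begin

section \<open>Graphs and blocks\<close>

text \<open>Completeness of blocks enters through one fact: two neighbours of a vertex
  \<open>v\<close> that are joined by a path avoiding \<open>v\<close> are adjacent. It replaces the
  usual computation of low points. In the search order, the first scanned neighbour of a vertex is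
  its gate, through which its block was entered, and the second one (or the vertex itself) is the
  first vertex found in that block. Vertices get odd numbers \<open>i\<close>, and
  \<open>i - 1\<close> stands for the block whose first vertex is \<open>i\<close>. So one array
  holds the tree, parents have smaller numbers, running down the numbers is a bottom-up sweep, and 0
  is free as a sentinel. The delicate point of optimality is the root of a component: it is
  simplicial when it has at most one child block. If two open paths then arrive from the same child,
  joining them might miss the root, so two paths ending at the root are emitted, and the root itself
  accounts for the extra one. The algorithm is written in a small while language with a clock; one
  tick compiles to a bounded number of machine steps.\<close>

definition induced :: "'a pair_pre_digraph \<Rightarrow> 'a set \<Rightarrow> 'a pair_pre_digraph" where
  "induced G S = \<lparr>pverts = S, parcs = {(a, b) \<in> parcs G. a \<in> S \<and> b \<in> S}\<rparr>"

definition conn_on :: "'a rel \<Rightarrow> 'a set \<Rightarrow> bool" where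
  "conn_on E S \<longleftrightarrow> (\<forall>u\<in>S. \<forall>v\<in>S. (u, v) \<in> {(a, b) \<in> E. a \<in> S \<and> b \<in> S}\<^sup>*)"

lemma graph_with_proj:
  assumes "graph (with_proj G)"
  shows "finite (pverts G)" "finite (parcs G)" "\<And>u v. (u, v) \<in> parcs G \<Longrightarrow> (v, u) \<in> parcs G"
    "\<And>u v. (u, v) \<in> parcs G \<Longrightarrow> u \<noteq> v \<and> u \<in> pverts G \<and> v \<in> pverts G"
proof -
  interpret graph "with_proj G" by fact
  show "finite (pverts G)" "finite (parcs G)"
    using finite_verts finite_arcs by auto
  show "(v, u) \<in> parcs G" if "(u, v) \<in> parcs G" for u v
    using that sym_arcs by (auto simp: symmetric_def dest: symD)
  show "u \<noteq> v \<and> u \<in> pverts G \<and> v \<in> pverts G" if "(u, v) \<in> parcs G" for u v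
    using that no_loops[of "(u, v)"] tail_in_verts[of "(u, v)"] head_in_verts[of "(u, v)"] by auto
qed

lemma graph_induced:
  assumes "graph (with_proj G)" "S \<subseteq> pverts G"
  shows "graph (with_proj (induced G S))"
proof -
  note g = graph_with_proj[OF assms(1)]
  have "pair_graph (induced G S)"
  proof unfold_locales
    show "finite (pverts (induced G S))" using g(1) assms(2) by (auto simp: induced_def intro: finite_subset)
    show "finite (parcs (induced G S))"
      by (rule finite_subset[OF _ g(2)]) (auto simp: induced_def)
    show "symmetric (with_proj (induced G S))"
      using g(3) by (auto simp: symmetric_def induced_def intro!: symI)
  qed (use g(4) in \<open>auto simp: induced_def\<close>)
  then interpret pair_graph "induced G S" .
  show ?thesis by unfold_locales
qed

lemma strongly_connected_induced:
  assumes "S \<noteq> {}" "conn_on (parcs G) S"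
  shows "strongly_connected (with_proj (induced G S))"
proof
  show "verts (with_proj (induced G S)) \<noteq> {}" using assms by (simp add: induced_def)
  fix u v assume "u \<in> verts (with_proj (induced G S))" "v \<in> verts (with_proj (induced G S))"
  then have u: "u \<in> S" "v \<in> S" by (auto simp: induced_def)
  then have "(u, v) \<in> {(a, b) \<in> parcs G. a \<in> S \<and> b \<in> S}\<^sup>*"
    using assms(2) by (auto simp: conn_on_def)
  then have "(u, v) \<in> rtrancl_on S {(a, b) \<in> parcs G. a \<in> S \<and> b \<in> S}"
  proof induction
    case base
    then show ?case using u by simp
  next
    case (step y z)
    then show ?case by (auto intro: rtrancl_on_into_rtrancl_on)
  qed
  then show "u \<rightarrow>\<^sup>*\<^bsub>with_proj (induced G S)\<^esub> v"
    by (simp add: reachable_def induced_def)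
qed

text \<open>\<open>cut_vertex\<close> compares numbers of components; with this count, a connected
  set that stays connected after a deletion has no cut vertex there.\<close>

lemma card_sccs_induced:
  assumes "graph (with_proj G)" "S \<subseteq> pverts G" "conn_on (parcs G) S"
  shows "card (pre_digraph.sccs (with_proj (induced G S))) = (if S = {} then 0 else 1)"
proof -
  interpret graph "with_proj (induced G S)" using graph_induced assms by blast
  show ?thesis
  proof (cases "S = {}")
    case True
    have "H \<notin> sccs" for H
    proof
      assume "H \<in> sccs"
      then have "verts H \<noteq> {}" "verts H \<subseteq> verts (with_proj (induced G S))"
        using subgraph_imp_subverts induced_imp_subgraph
        by (fast elim: in_sccsE dest: strongly_connected_def[THEN meta_eq_to_obj_eq, THEN iffD1])+
      then show False using True by (simp add: induced_def)
    qed
    then have "sccs = {}" by blast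
    then show ?thesis using True by simp
  next
    case False
    then show ?thesis using strongly_connected_induced[OF False assms(3)] strongly_connected_eq_iff by auto
  qed
qed

lemma del_vert_induced:
  "pre_digraph.del_vert (with_proj (induced G S)) v = with_proj (induced G (S - {v}))"
  by (auto simp: pre_digraph.del_vert_def induced_def with_proj_def)

text \<open>Among the connected subgraphs without cut vertex that contain \<open>H\<close>, one with
  the largest total of vertices and arcs is maximal for inclusion, because a subgraph with the same
  total is equal. The total for \<open>G\<close> bounds all of them.\<close>

lemma ex_block_supgraph:
  assumes "graph G" "subgraph H G" "graph H" "connected H" "\<forall>v. \<not> cut_vertex H v"
  shows "\<exists>B. block G B \<and> subgraph H B"
proof -
  interpret G: graph G by fact
  define P where "P H' \<longleftrightarrow> subgraph H' G \<and> subgraph H H' \<and> graph H' \<and> connected H' \<and> (\<forall>v. \<not> cut_vertex H' v)" for H'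
  define m where "m H' = card (verts H') + card (arcs H')" for H' :: "('a, 'b) pre_digraph"
  have sub_le: "m H1 \<le> m H2 \<and> (m H1 = m H2 \<longrightarrow> H1 = H2)" if "subgraph H1 H2" "subgraph H2 G" for H1 H2
  proof -
    have f: "finite (verts H2)" "finite (arcs H2)"
      using that(2) G.finite_verts G.finite_arcs unfolding subgraph_def by (blast intro: finite_subset)+
    have s: "verts H1 \<subseteq> verts H2" "arcs H1 \<subseteq> arcs H2" "tail H1 = tail H2" "head H1 = head H2"
      using that(1) by (auto simp: subgraph_def compatible_def)
    have c: "card (verts H1) \<le> card (verts H2)" "card (arcs H1) \<le> card (arcs H2)"
      using f s by (auto intro: card_mono)
    have "H1 = H2" if "m H1 = m H2"
    proof -
      have "card (verts H1) = card (verts H2)" "card (arcs H1) = card (arcs H2)"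
        using that c by (auto simp: m_def)
      then have "verts H1 = verts H2" "arcs H1 = arcs H2"
        using f s by (simp_all add: card_subset_eq)
      then show ?thesis using s by (auto intro: pre_digraph.equality)
    qed
    then show ?thesis using c by (auto simp: m_def)
  qed
  have wfH: "wf_digraph H" using assms(2) by (auto simp: subgraph_def)
  have PH: "P H" using assms wf_digraph.subgraph_refl[OF wfH] by (auto simp: P_def)
  have bound: "\<forall>H'. P H' \<longrightarrow> m H' \<le> m G"
    using sub_le G.subgraph_refl by (auto simp: P_def)
  obtain B where B: "P B" "\<forall>H'. P H' \<longrightarrow> m H' \<le> m B"
    using ex_has_greatest_nat[of P H m "Suc (m G)"] PH bound by (auto simp: less_Suc_eq_le)
  have "block G B"
    unfolding block_def G.max_subgraph_def
  proof (intro conjI allI impI notI)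
    fix H' assume a: "H' \<noteq> B \<and> subgraph B H'" "subgraph H' G \<and> graph H' \<and> connected H' \<and> (\<forall>v. \<not> cut_vertex H' v)"
    then have "P H'" using B(1) subgraph_trans by (auto simp: P_def)
    then have "m H' \<le> m B" using B by auto
    then show False using sub_le[of B H'] a by auto
  qed (use B in \<open>auto simp: P_def\<close>)
  then show ?thesis using B by (auto simp: P_def)
qed

text \<open>A vertex set that stays connected after the deletion of any one of its vertices lies in a block.\<close>

lemma block_graph_clique:
  assumes bg: "block_graph (with_proj G)" and C: "C \<subseteq> pverts G"
    and conn: "\<And>x. conn_on (parcs G) (C - {x})" "conn_on (parcs G) C"
    and uv: "u \<in> C" "v \<in> C" "u \<noteq> v"
  shows "(u, v) \<in> parcs G"
proof -
  let ?H = "with_proj (induced G C)"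
  have g: "graph (with_proj G)" using bg by (simp add: block_graph_def)
  interpret graph "with_proj G" by fact
  interpret H: graph ?H using graph_induced[OF g C] .
  have sub: "subgraph ?H (with_proj G)"
    using C H.wf_digraph_axioms wf_digraph_axioms
    by (intro subgraphI) (auto simp: induced_def compatible_def)
  have scc: "card H.sccs = 1"
    using card_sccs_induced[OF g C conn(2)] uv by auto
  have "\<not> cut_vertex ?H x" for x
  proof -
    have "card (pre_digraph.sccs (with_proj (induced G (C - {x})))) \<le> 1"
      using card_sccs_induced[OF g subset_trans[OF Diff_subset C] conn(1)[of x]] by simp
    then show ?thesis using scc by (auto simp: cut_vertex_def del_vert_induced)
  qed
  moreover have "connected ?H"
  proof -
    have "strongly_connected ?H" using strongly_connected_induced[OF _ conn(2)] uv by auto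
    then show ?thesis
      by (intro H.connectedI) (auto simp: strongly_connected_def intro: H.reachable_mk_symmetricI)
  qed
  ultimately obtain B where B: "block (with_proj G) B" "subgraph ?H B"
    using ex_block_supgraph[OF g sub H.graph_axioms] by blast
  then have cB: "complete_digraph (card (verts B)) B" using bg by (auto simp: block_graph_def)
  have vB: "u \<in> verts B" "v \<in> verts B"
    using B(2) uv by (auto simp: subgraph_def induced_def)
  have "(u, v) \<in> arcs_ends B"
    using cB vB uv by (auto simp: complete_digraph_def)
  moreover have "arcs_ends B \<subseteq> arcs_ends (with_proj G)"
    using B(1) by (intro arcs_ends_mono) (auto simp: block_def max_subgraph_def)
  ultimately show ?thesis by auto
qed


section \<open>Connected vertex sets and cycles in block graphs\<close>

lemma conn_on_Un:
  assumes "conn_on E S" "conn_on E T" "S \<inter> T \<noteq> {}"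
  shows "conn_on E (S \<union> T)"
proof -
  let ?R = "\<lambda>S. {(x, y) \<in> E. x \<in> S \<and> y \<in> S}"
  have 1: "(?R S)\<^sup>* \<subseteq> (?R (S \<union> T))\<^sup>*"
    by (rule rtrancl_mono) auto
  have 2: "(?R T)\<^sup>* \<subseteq> (?R (S \<union> T))\<^sup>*"
    by (rule rtrancl_mono) auto
  obtain x where x: "x \<in> S" "x \<in> T" using assms(3) by auto
  have S: "\<And>a b. a \<in> S \<Longrightarrow> b \<in> S \<Longrightarrow> (a, b) \<in> (?R S)\<^sup>*"
    and T: "\<And>a b. a \<in> T \<Longrightarrow> b \<in> T \<Longrightarrow> (a, b) \<in> (?R T)\<^sup>*"
    using assms(1,2) by (simp_all add: conn_on_def)
  have 3: "(u, x) \<in> (?R (S \<union> T))\<^sup>*" "(x, u) \<in> (?R (S \<union> T))\<^sup>*" if "u \<in> S \<union> T" for u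
    using that subsetD[OF 1 S[OF _ x(1)]] subsetD[OF 2 T[OF _ x(2)]]
      subsetD[OF 1 S[OF x(1)]] subsetD[OF 2 T[OF x(2)]] by (elim UnE; simp)+
  show ?thesis
    unfolding conn_on_def
  proof (intro ballI)
    fix u v assume "u \<in> S \<union> T" "v \<in> S \<union> T"
    then show "(u, v) \<in> (?R (S \<union> T))\<^sup>*" using rtrancl_trans[OF 3(1) 3(2)] by simp
  qed
qed

lemma conn_on_path:
  assumes "successively (\<lambda>a b. (a, b) \<in> E) p" "sym E"
  shows "conn_on E (set p)"
  using assms(1)
proof (induction p)
  case Nil
  then show ?case by (simp add: conn_on_def)
next
  case (Cons a p)
  show ?case
  proof (cases p)
    case Nil
    then show ?thesis by (simp add: conn_on_def)
  next
    case (Cons b p')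
    then have e: "(a, b) \<in> E" "(b, a) \<in> E" and c: "conn_on E (set p)"
      using Cons.prems Cons.IH assms(2) by (auto dest: symD)
    have "conn_on E {a, b}"
      using e unfolding conn_on_def by (blast intro: r_into_rtrancl)
    then have "conn_on E ({a, b} \<union> set p)"
      using c Cons by (intro conn_on_Un) auto
    then show ?thesis using Cons by (simp add: insert_commute)
  qed
qed

text \<open>When the vertex to be prepended already occurs, everything before its occurrence is
  dropped instead. Distinctness is what later turns the path into a cycle.\<close>

lemma rtrancl_distinct_path:
  assumes "(a, b) \<in> {(x, y) \<in> E. x \<in> W \<and> y \<in> W}\<^sup>*" "a \<in> W"
  shows "\<exists>p. p \<noteq> [] \<and> hd p = a \<and> last p = b \<and> distinct p \<and> set p \<subseteq> W \<and> successively (\<lambda>a b. (a, b) \<in> E) p"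
  using assms
proof (induction rule: converse_rtrancl_induct)
  case base
  then show ?case by (intro exI[of _ "[b]"]) auto
next
  case (step a c)
  then obtain p where p: "p \<noteq> []" "hd p = c" "last p = b" "distinct p" "set p \<subseteq> W"
    "successively (\<lambda>a b. (a, b) \<in> E) p" by auto
  show ?case
  proof (cases "a \<in> set p")
    case True
    then obtain p1 p2 where "p = p1 @ a # p2" by (auto simp: in_set_conv_decomp)
    then show ?thesis using p by (intro exI[of _ "a # p2"]) (auto simp: successively_append_iff)
  next
    case False
    then show ?thesis using p step by (intro exI[of _ "a # p"]) (auto simp: successively_Cons)
  qed
qed

text \<open>A path from \<open>a\<close> to \<open>b\<close> avoiding \<open>v\<close>, closed up
  through \<open>v\<close>, is a cycle. A cycle stays connected when any one vertex is deleted, so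
  it lies in one block, which is complete.\<close>

lemma block_graph_neighbours_adj:
  assumes bg: "block_graph (with_proj G)"
    and e: "(v, a) \<in> parcs G" "(v, b) \<in> parcs G" "a \<noteq> b"
    and path: "(a, b) \<in> {(x, y) \<in> parcs G. x \<in> W \<and> y \<in> W}\<^sup>*" "a \<in> W" "v \<notin> W"
  shows "(a, b) \<in> parcs G"
proof -
  have g: "graph (with_proj G)" using bg by (simp add: block_graph_def)
  note g = graph_with_proj[OF g]
  have sym: "sym (parcs G)" using g(3) by (auto intro: symI)
  obtain p where p: "p \<noteq> []" "hd p = a" "last p = b" "distinct p" "set p \<subseteq> W"
    "successively (\<lambda>a b. (a, b) \<in> parcs G) p"
    using rtrancl_distinct_path[OF path(1,2)] by auto
  have vp: "v \<notin> set p" using p path by auto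
  have ab: "a \<in> set p" "b \<in> set p" using p by auto
  define C where "C = insert v (set p)"
  have C0: "conn_on (parcs G) C"
  proof -
    have "conn_on (parcs G) (set (v # p))"
      using p e sym by (intro conn_on_path) (auto simp: successively_Cons)
    then show ?thesis by (simp add: C_def)
  qed
  have Cx: "conn_on (parcs G) (C - {x})" for x
  proof (cases "x \<in> set p")
    case True
    \<comment> \<open>Without \<open>x\<close> the cycle is a path that runs from behind
      \<open>x\<close> over \<open>v\<close> to the place before \<open>x\<close>; it is assembled
      from two halves that share \<open>v\<close>.\<close>
    then obtain p1 p2 where pp: "p = p1 @ x # p2" by (auto simp: in_set_conv_decomp)
    have 1: "conn_on (parcs G) (set (v # p1))"
      using p e sym pp by (intro conn_on_path) (auto simp: successively_Cons successively_append_iff)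
    have 2: "conn_on (parcs G) (set (p2 @ [v]))"
      using p e sym pp g(3) by (intro conn_on_path) (auto simp: successively_Cons successively_append_iff)
    have "conn_on (parcs G) (set (v # p1) \<union> set (p2 @ [v]))"
      by (rule conn_on_Un[OF 1 2]) auto
    moreover have "set (v # p1) \<union> set (p2 @ [v]) = C - {x}"
      using pp p vp by (auto simp: C_def)
    ultimately show ?thesis by simp
  next
    case False
    show ?thesis
    proof (cases "x = v")
      case True
      then have "C - {x} = set p" using vp by (auto simp: C_def)
      then show ?thesis using conn_on_path[OF p(6) sym] by simp
    next
      case False
      then have "C - {x} = C" using \<open>x \<notin> set p\<close> by (auto simp: C_def)
      then show ?thesis using C0 by simp
    qed
  qed
  have CV: "C \<subseteq> pverts G"
  proof -
    have "y \<in> pverts G" if "y \<in> set p" for y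
    proof (cases "y = a")
      case False
      have "(a, y) \<in> {(x, y) \<in> parcs G. x \<in> set p \<and> y \<in> set p}\<^sup>*"
        using conn_on_path[OF p(6) sym] that ab by (auto simp: conn_on_def)
      then show ?thesis using False g(4) by (auto elim: rtranclE)
    qed (use e g(4) in auto)
    then show ?thesis using e g(4) by (auto simp: C_def)
  qed
  show ?thesis
    using block_graph_clique[OF bg CV Cx C0] e ab by (auto simp: C_def)
qed

section \<open>Trees given by parent functions\<close>

text \<open>Climbing always from the larger number, two nodes meet at their lowest common ancestor.\<close>

function climb :: "(nat \<Rightarrow> nat) \<Rightarrow> nat \<Rightarrow> nat \<Rightarrow> nat list" where
  "climb par a b = (if a = b then [a]
    else if b < a then (if par a < a then a # climb par (par a) b else [])
    else if par b < b then climb par a (par b) @ [b] else [])"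
  by auto
termination by (relation "measure (\<lambda>(par, a, b). a + b)") auto

text \<open>The ancestor directly below 0, which will name the component of \<open>x\<close>. The
  test \<open>par x < x\<close> makes the recursion terminate for arbitrary \<open>par\<close>, as
  does the value \<open>[]\<close> in \<open>climb\<close>.\<close>

function root_of :: "(nat \<Rightarrow> nat) \<Rightarrow> nat \<Rightarrow> nat" where
  "root_of par x = (if par x < x \<and> par x \<noteq> 0 then root_of par (par x) else x)"
  by auto
termination by (relation "measure (\<lambda>(par, x). x)") auto

declare climb.simps[simp del] root_of.simps[simp del]

text \<open>In a \<open>parent_tree\<close> the sentinel 0 lies above every node and has only itself
  as an ancestor. It acts as a common root, so tree distances make sense between different
  components too.\<close>

inductive anc :: "(nat \<Rightarrow> nat) \<Rightarrow> nat \<Rightarrow> nat \<Rightarrow> bool" for par where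
  anc_refl: "anc par x x"
| anc_step: "anc par (par x) y \<Longrightarrow> 0 < x \<Longrightarrow> anc par x y"

definition tdist :: "(nat \<Rightarrow> nat) \<Rightarrow> nat \<Rightarrow> nat \<Rightarrow> nat" where
  "tdist par a b = length (climb par a b) - 1"

text \<open>The adjacency of the graph read off from the tree: two vertices hang in the same block,
  or one of them is the parent of the block in which the other one hangs.\<close>

definition tadj :: "(nat \<Rightarrow> nat) \<Rightarrow> nat \<Rightarrow> nat \<Rightarrow> bool" where
  "tadj par x y \<longleftrightarrow> x \<noteq> y \<and> (par x = par y \<or> par (par x) = y \<or> par (par y) = x)"

locale parent_tree =
  fixes par :: "nat \<Rightarrow> nat"
  assumes par_zero[simp]: "par 0 = 0"
    and par_less: "\<And>x. 0 < x \<Longrightarrow> par x < x"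
begin

lemma climb_same[simp]: "climb par a a = [a]"
  using climb.simps[of par a a] by simp

lemma climb_gt: "b < a \<Longrightarrow> climb par a b = a # climb par (par a) b"
  by (subst climb.simps) (simp add: par_less)

lemma climb_lt: "a < b \<Longrightarrow> climb par a b = climb par a (par b) @ [b]"
  by (subst climb.simps) (simp add: par_less)

lemma climb_induct[case_names same gt lt]:
  assumes "\<And>a. P a a" "\<And>a b. b < a \<Longrightarrow> P (par a) b \<Longrightarrow> P a b" "\<And>a b. a < b \<Longrightarrow> P a (par b) \<Longrightarrow> P a b"
  shows "P a b"
proof (induction "a + b" arbitrary: a b rule: less_induct)
  case less
  show ?case
  proof (cases a b rule: linorder_cases)
    case 1: less
    have "P a (par b)" using 1 par_less[of b] by (intro less) simp
    then show ?thesis using 1 assms(3) by blast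
  next
    case equal
    then show ?thesis using assms(1) by blast
  next
    case 3: greater
    have "P (par a) b" using 3 par_less[of a] by (intro less) simp
    then show ?thesis using 3 assms(2) by blast
  qed
qed

lemma climb_ends: "climb par a b \<noteq> [] \<and> hd (climb par a b) = a \<and> last (climb par a b) = b"
  by (induction a b rule: climb_induct) (auto simp: climb_gt climb_lt)

lemma climb_neq_Nil[simp]: "climb par a b \<noteq> []"
  and hd_climb[simp]: "hd (climb par a b) = a"
  and last_climb[simp]: "last (climb par a b) = b"
  using climb_ends by auto

lemma length_climb: "length (climb par a b) = Suc (tdist par a b)"
  using climb_neq_Nil[of a b] by (simp add: tdist_def del: climb_neq_Nil)

lemma tdist_same[simp]: "tdist par a a = 0"
  by (simp add: tdist_def)

lemma tdist_gt: "b < a \<Longrightarrow> tdist par a b = Suc (tdist par (par a) b)"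
  using length_climb[of a b] length_climb[of "par a" b] by (simp add: climb_gt)

lemma tdist_lt: "a < b \<Longrightarrow> tdist par a b = Suc (tdist par a (par b))"
  using length_climb[of a b] length_climb[of a "par b"] by (simp add: climb_lt)

lemma set_climb_le: "z \<in> set (climb par a b) \<Longrightarrow> z \<le> max a b"
proof (induction a b rule: climb_induct)
  case (gt a b)
  then have "z = a \<or> z \<le> max (par a) b" by (auto simp: climb_gt)
  then show ?case using gt.hyps par_less[of a] by auto
next
  case (lt a b)
  then have "z = b \<or> z \<le> max a (par b)" by (auto simp: climb_lt)
  then show ?case using lt.hyps par_less[of b] by auto
qed simp

text \<open>The larger end is left for good: all nodes visited later have smaller numbers, by
  \<open>set_climb_le\<close>.\<close>

lemma distinct_climb: "distinct (climb par a b)"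
proof (induction a b rule: climb_induct)
  case (gt a b)
  have "a \<notin> set (climb par (par a) b)"
    using gt.hyps par_less[of a] set_climb_le[of a "par a" b] by auto
  then show ?case using gt by (simp add: climb_gt)
next
  case (lt a b)
  have "b \<notin> set (climb par a (par b))"
    using lt.hyps par_less[of b] set_climb_le[of b a "par b"] by auto
  then show ?case using lt by (simp add: climb_lt)
qed simp

lemma climb_successively: "successively (\<lambda>x y. par x = y \<or> par y = x) (climb par a b)"
  by (induction a b rule: climb_induct) (auto simp: climb_gt climb_lt successively_append_iff successively_Cons)

section \<open>Ancestors and lowest common ancestors\<close>

lemma anc_le: "anc par z y \<Longrightarrow> y \<le> z"
proof (induction rule: anc.induct)
  case (anc_step x y)
  then show ?case using par_less[of x] by auto
qed simp

lemma anc_trans: "anc par x y \<Longrightarrow> anc par y z \<Longrightarrow> anc par x z"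
proof (induction rule: anc.induct)
  case (anc_step x y)
  then show ?case using anc.anc_step by blast
qed

lemma anc_par: assumes "anc par x y" "0 < y" shows "anc par x (par y)"
  using anc_trans[OF assms(1) anc_step[OF anc_refl assms(2)]] .

lemma anc_parD: assumes "anc par x y" "y < x" shows "anc par (par x) y"
  using assms(1) by cases (use assms(2) in auto)

lemma anc_iff: "y < x \<Longrightarrow> anc par x z \<longleftrightarrow> z = x \<or> anc par (par x) z"
  using anc.cases[of par x z] anc_step[of par x z] anc_refl[of par x] by (metis gr_zeroI not_less_zero)

text \<open>On the way up from \<open>z\<close> the numbers decrease, so of two ancestors the
  smaller one is reached through the larger one.\<close>

lemma anc_linear: "anc par z b \<Longrightarrow> anc par z a \<Longrightarrow> a < b \<Longrightarrow> anc par b a"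
proof (induction rule: anc.induct)
  case (anc_step z b)
  then have "a < z" using anc_le[of "par z" b] par_less[of z] by auto
  then show ?case using anc_step anc_parD by blast
qed

text \<open>Of two siblings with a common descendant the smaller would lie above the larger, hence
  be an ancestor of the common parent, although the parent has a smaller number.\<close>

lemma siblings_disjoint:
  assumes "anc par z c1" "anc par z c2" "par c1 = par c2" "0 < c1" "0 < c2"
  shows "c1 = c2"
proof -
  have "\<not> c < d" if "anc par z c" "anc par z d" "par c = par d" "0 < c" for c d
  proof
    assume "c < d"
    then have "anc par d c" using anc_linear that by blast
    then have "anc par (par d) c" using anc_parD \<open>c < d\<close> by blast
    then have "c \<le> par c" using anc_le that(3) by simp
    then show False using par_less[OF that(4)] by simp
  qed
  note * = this
  show ?thesis using *[OF assms(1,2,3,4)] *[OF assms(2,1) assms(3)[symmetric] assms(5)] by simp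
qed

text \<open>Common ancestors form a chain ordered by number, so the lowest one is the one with the
  largest number.\<close>

definition lca :: "nat \<Rightarrow> nat \<Rightarrow> nat \<Rightarrow> bool" where
  "lca a b y \<longleftrightarrow> anc par a y \<and> anc par b y \<and> (\<forall>z. anc par a z \<and> anc par b z \<longrightarrow> z \<le> y)"

lemma lca_anc: "anc par a y \<Longrightarrow> lca a y y"
  unfolding lca_def by (intro conjI allI impI) (simp_all add: anc_refl anc_le)

lemma lca_siblings:
  assumes "anc par a c1" "anc par b c2" "par c1 = y" "par c2 = y" "c1 \<noteq> c2" "0 < c1" "0 < c2"
  shows "lca a b y"
  unfolding lca_def
proof (intro conjI allI impI)
  show "anc par a y" "anc par b y"
    using anc_par[OF assms(1,6)] anc_par[OF assms(2,7)] assms(3,4) by simp_all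
  fix z assume z: "anc par a z \<and> anc par b z"
  show "z \<le> y"
  proof (rule ccontr)
    assume *: "\<not> z \<le> y"
    have 1: "anc par z c" if "anc par x z" "anc par x c" "par c = y" "0 < c" for x c
    proof (cases "z < c")
      case True
      have "anc par c z" using anc_linear[OF that(2,1) True] .
      then have "anc par y z" using anc_parD[OF _ True] that(3) by simp
      then have "z \<le> y" by (rule anc_le)
      then show ?thesis using * by simp
    next
      case False
      then show ?thesis using anc_linear[OF that(1,2)] anc_refl[of par z] by (cases "z = c") simp_all
    qed
    have "anc par z c1" "anc par z c2"
      using 1[of a c1] 1[of b c2] z assms by simp_all
    then show False using siblings_disjoint[of z c1 c2] assms by simp
  qed
qed

text \<open>If the ends differ, the larger one lies strictly below the meeting point. One step of
  the climb therefore keeps the lowest common ancestor and removes one node from one branch.\<close>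

lemma climb_lca:
  assumes "lca a b y"
  shows "set (climb par a b) = {z. (anc par a z \<or> anc par b z) \<and> anc par z y}
    \<and> tdist par a b = tdist par a y + tdist par b y"
  using assms
proof (induction a b rule: climb_induct)
  case (same a)
  then have "y \<le> a" "a \<le> y" using anc_le[of a y] anc_refl[of par a] by (simp_all add: lca_def)
  then have "y = a" by simp
  moreover have "z = a" if "anc par a z" "anc par z a" for z
    using anc_le[OF that(1)] anc_le[OF that(2)] by simp
  then have "{z. (anc par a z \<or> anc par a z) \<and> anc par z a} = {a}"
    using anc_refl[of par a] by blast
  ultimately show ?case by simp
next
  case (gt a b)
  have y: "anc par a y" "anc par b y" and max: "\<And>z. anc par a z \<Longrightarrow> anc par b z \<Longrightarrow> z \<le> y"
    using gt.prems unfolding lca_def by simp_all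
  have "y < a" using gt.hyps anc_le[OF y(2)] by simp
  note a = anc_iff[OF this]
  have "lca (par a) b y"
    unfolding lca_def using y max anc_parD[OF y(1) \<open>y < a\<close>] a by blast
  note IH = gt.IH[OF this]
  have "set (climb par a b) = insert a {z. (anc par (par a) z \<or> anc par b z) \<and> anc par z y}"
    using IH gt.hyps by (simp add: climb_gt)
  also have "\<dots> = {z. (anc par a z \<or> anc par b z) \<and> anc par z y}"
    using a y by blast
  finally show ?case using IH gt.hyps \<open>y < a\<close> by (simp add: tdist_gt)
next
  case (lt a b)
  have y: "anc par a y" "anc par b y" and max: "\<And>z. anc par a z \<Longrightarrow> anc par b z \<Longrightarrow> z \<le> y"
    using lt.prems unfolding lca_def by simp_all
  have "y < b" using lt.hyps anc_le[OF y(1)] by simp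
  note b = anc_iff[OF this]
  have "lca a (par b) y"
    unfolding lca_def using y max anc_parD[OF y(2) \<open>y < b\<close>] b by blast
  note IH = lt.IH[OF this]
  have "set (climb par a b) = insert b {z. (anc par a z \<or> anc par (par b) z) \<and> anc par z y}"
    using IH lt.hyps by (simp add: climb_lt)
  also have "\<dots> = {z. (anc par a z \<or> anc par b z) \<and> anc par z y}"
    using b y by blast
  finally show ?case using IH lt.hyps \<open>y < b\<close> by (simp add: tdist_lt tdist_gt)
qed

lemma tdist_par: "anc par a x \<Longrightarrow> 0 < x \<Longrightarrow> tdist par a (par x) = Suc (tdist par a x)"
proof (induction rule: anc.induct)
  case (anc_refl x)
  then show ?case using par_less by (simp add: tdist_gt)
next
  case (anc_step z x)
  then have "x < z" using anc_le[of "par z" x] par_less[of z] by auto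
  then show ?case using anc_step par_less[of x] by (simp add: tdist_gt)
qed

text \<open>If \<open>x < b\<close>, then \<open>par x < b\<close> too, and both climbs first
  replace \<open>b\<close> by its parent, which leads to the induction hypothesis. Otherwise a
  single step of the climb decides.\<close>

lemma tdist_Lipschitz: "0 < x \<Longrightarrow> tdist par x b \<le> Suc (tdist par (par x) b) \<and> tdist par (par x) b \<le> Suc (tdist par x b)"
proof (induction "x + b" arbitrary: x b rule: less_induct)
  case less
  have p: "par x < x" using par_less less.prems by auto
  show ?case
  proof (cases x b rule: linorder_cases)
    case less': less
    have "par b < b" using less' par_less[of b] by auto
    then have "tdist par x (par b) \<le> Suc (tdist par (par x) (par b)) \<and> tdist par (par x) (par b) \<le> Suc (tdist par x (par b))"
      using less.hyps[of x "par b"] less.prems by auto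
    then show ?thesis using less' p by (simp add: tdist_lt)
  next
    case equal
    then show ?thesis using p by (simp add: tdist_lt)
  next
    case greater
    then show ?thesis by (simp add: tdist_gt)
  qed
qed

text \<open>Adjacent vertices are joined by two tree edges, each of which changes the distance by at
  most one. This is the half of isometry that bounds all competing walks from below.\<close>

lemma tdist_tadj:
  assumes "tadj par x y" "0 < x" "0 < y" "0 < par x" "0 < par y"
  shows "tdist par x b \<le> 2 + tdist par y b"
  using assms tdist_Lipschitz[of x b] tdist_Lipschitz[of y b] tdist_Lipschitz[of "par x" b] tdist_Lipschitz[of "par y" b]
  by (auto simp: tadj_def)

section \<open>Top nodes below 0 as names of components\<close>

lemma root_of_par: "par x \<noteq> 0 \<Longrightarrow> root_of par (par x) = root_of par x"
  using par_less[of x] root_of.simps[of par x] by (cases "x = 0") simp_all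

lemma root_of_top: "par x = 0 \<Longrightarrow> root_of par x = x"
  using root_of.simps[of par x] by simp

lemma root_of_le: "root_of par x \<le> x"
proof (induction x rule: less_induct)
  case (less x)
  show ?case
  proof (cases "par x < x \<and> par x \<noteq> 0")
    case True
    then show ?thesis using root_of.simps[of par x] less[of "par x"] by simp
  next
    case False
    show ?thesis by (subst root_of.simps, subst if_not_P[OF False], simp)
  qed
qed

lemma root_of_props: "0 < x \<Longrightarrow> 0 < root_of par x \<and> par (root_of par x) = 0 \<and> anc par x (root_of par x)"
proof (induction x rule: less_induct)
  case (less x)
  show ?case
  proof (cases "par x = 0")
    case True
    then show ?thesis using root_of_top less.prems anc_refl by simp
  next
    case False
    then show ?thesis using less.IH[of "par x"] par_less[of x] less.prems root_of_par[OF False] anc_step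
      by auto
  qed
qed

lemma root_of_anc: "anc par x y \<Longrightarrow> 0 < y \<Longrightarrow> root_of par x = root_of par y"
proof (induction rule: anc.induct)
  case (anc_step x y)
  then have "par x \<noteq> 0" using anc_le[of "par x" y] by auto
  then show ?case using anc_step root_of_par by auto
qed simp

text \<open>An end is moved up only while it is not a top node: a larger end that is a top node
  would be the common top node, which is at most the smaller end.\<close>

lemma zero_notin_climb: "0 < a \<Longrightarrow> 0 < b \<Longrightarrow> root_of par a = root_of par b \<Longrightarrow> 0 \<notin> set (climb par a b)"
proof (induction a b rule: climb_induct)
  case (gt a b)
  have "par a \<noteq> 0" using gt.hyps gt.prems root_of_top[of a] root_of_le[of b] by (cases "par a = 0") auto
  then show ?case using gt root_of_par by (auto simp: climb_gt)
next
  case (lt a b)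
  have "par b \<noteq> 0" using lt.hyps lt.prems root_of_top[of b] root_of_le[of a] by (cases "par b = 0") auto
  then show ?case using lt root_of_par by (auto simp: climb_lt)
qed simp

end

text \<open>Odd numbers stand for the vertices of a block graph and even numbers for its blocks.\<close>

locale block_tree = parent_tree +
  assumes par_odd: "\<And>x. odd x \<Longrightarrow> even (par x)"
    and par_even: "\<And>x. even x \<Longrightarrow> par x = 0 \<or> odd (par x)"
begin

text \<open>Two consecutive tree edges lead from a vertex over a block to a different vertex, which
  makes one edge of the graph. The induction removes such a pair of nodes.\<close>

lemma alternating_path:
  assumes "successively (\<lambda>x y. par x = y \<or> par y = x) xs" "distinct xs" "0 \<notin> set xs"
    "xs \<noteq> []" "odd (hd xs)" "odd (last xs)"
  shows "successively (tadj par) (filter odd xs) \<and> length xs + 1 = 2 * length (filter odd xs) \<and>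
    hd (filter odd xs) = hd xs \<and> last (filter odd xs) = last xs"
  using assms
proof (induction "length xs" arbitrary: xs rule: less_induct)
  case less
  obtain x xs' where xs: "xs = x # xs'" using less.prems by (cases xs) auto
  show ?case
  proof (cases xs')
    case Nil
    then show ?thesis using xs less.prems by auto
  next
    case (Cons e ys)
    have x: "odd x" and xe: "par x = e \<or> par e = x" using less.prems(1,5) xs Cons by simp_all
    have e: "even e" using xe par_odd[OF x] par_odd[of e] x by metis
    then obtain y zs where ys: "ys = y # zs" using less.prems(6) xs Cons by (cases ys) simp_all
    have ey: "par e = y \<or> par y = e" and nz: "e \<noteq> 0" "y \<noteq> 0" and xy: "x \<noteq> y"
      using less.prems(1,2,3) xs Cons ys by simp_all
    have y: "odd y" using ey nz e par_even[OF e] par_even[of y] by metis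
    have "tadj par x y" using xe ey xy unfolding tadj_def by metis
    moreover have "successively (tadj par) (filter odd (y # zs)) \<and> length (y # zs) + 1 = 2 * length (filter odd (y # zs)) \<and>
       hd (filter odd (y # zs)) = hd (y # zs) \<and> last (filter odd (y # zs)) = last (y # zs)"
    proof (rule less.hyps)
      show "length (y # zs) < length xs" using xs Cons ys by simp
      show "successively (\<lambda>x y. par x = y \<or> par y = x) (y # zs)" "distinct (y # zs)" "0 \<notin> set (y # zs)"
        "odd (hd (y # zs))" "odd (last (y # zs))"
        using less.prems xs Cons ys y by simp_all
    qed simp
    ultimately show ?thesis using xs Cons ys y e x by simp
  qed
qed

lemma climb_path:
  assumes "odd a" "odd b" "root_of par a = root_of par b"
  shows "successively (tadj par) (filter odd (climb par a b))"
    "tdist par a b + 2 = 2 * length (filter odd (climb par a b))"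
    "hd (filter odd (climb par a b)) = a" "last (filter odd (climb par a b)) = b"
proof -
  have "0 < a" "0 < b" using assms(1,2) by (auto intro: odd_pos)
  then have "0 \<notin> set (climb par a b)" by (intro zero_notin_climb assms(3))
  note * = alternating_path[OF climb_successively distinct_climb this climb_neq_Nil, unfolded hd_climb last_climb,
      OF assms(1,2), unfolded length_climb]
  show "successively (tadj par) (filter odd (climb par a b))"
    "tdist par a b + 2 = 2 * length (filter odd (climb par a b))"
    "hd (filter odd (climb par a b)) = a" "last (filter odd (climb par a b)) = b"
    using * by simp_all
qed

end

section \<open>Covers by isometric paths\<close>

definition simplicial :: "'a rel \<Rightarrow> 'a \<Rightarrow> bool" where
  "simplicial E v \<longleftrightarrow> (\<forall>a b. (v, a) \<in> E \<and> (v, b) \<in> E \<and> a \<noteq> b \<longrightarrow> (a, b) \<in> E)"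

lemma vwalk_arcs_subset: "set (vwalk_arcs p) \<subseteq> A \<longleftrightarrow> successively (\<lambda>a b. (a, b) \<in> A) p"
  by (induction p rule: vwalk_arcs.induct) auto

lemma vpath_iff: "vpath p (with_proj G) \<longleftrightarrow>
    p \<noteq> [] \<and> set p \<subseteq> pverts G \<and> distinct p \<and> successively (\<lambda>a b. (a, b) \<in> parcs G) p"
  by (auto simp: vpath_def vwalk_def vwalk_arcs_subset)

text \<open>An inner simplicial vertex could be bypassed by the edge between its two neighbours on
  the path.\<close>

lemma isometric_path_simplicial_end:
  assumes "isometric_path (with_proj G) p" "sym (parcs G)" "v \<in> set p" "simplicial (parcs G) v"
  shows "v = hd p \<or> v = last p"
proof (rule ccontr)
  assume c: "\<not> ?thesis"
  have p: "p \<noteq> []" "set p \<subseteq> pverts G" "distinct p" "successively (\<lambda>a b. (a, b) \<in> parcs G) p"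
    using assms(1) by (simp_all add: isometric_path_def vpath_iff)
  have shortest: "length p - 1 \<le> length q - 1"
    if "q \<noteq> []" "set q \<subseteq> pverts G" "distinct q" "successively (\<lambda>a b. (a, b) \<in> parcs G) q"
      "hd q = hd p" "last q = last p" for q
    using assms(1) that by (simp add: isometric_path_def vpath_iff)
  obtain p1 p2 where pp: "p = p1 @ v # p2" using assms(3) by (auto simp: in_set_conv_decomp)
  have ne: "p1 \<noteq> []" "p2 \<noteq> []" using c pp by (cases p1; cases p2; simp)+
  have s: "successively (\<lambda>a b. (a, b) \<in> parcs G) p1" "successively (\<lambda>a b. (a, b) \<in> parcs G) p2"
    "(last p1, v) \<in> parcs G" "(v, hd p2) \<in> parcs G"
    using p(4) ne by (simp_all add: pp successively_append_iff successively_Cons)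
  have "last p1 \<in> set p1" "hd p2 \<in> set p2" using ne by simp_all
  moreover have "set p1 \<inter> set p2 = {}" using p(3) pp by auto
  ultimately have "last p1 \<noteq> hd p2" by auto
  then have "(last p1, hd p2) \<in> parcs G"
    using assms(2,4) s(3,4) unfolding simplicial_def by (meson symD)
  then have "length p - 1 \<le> length (p1 @ p2) - 1"
    using p ne s by (intro shortest) (auto simp: pp successively_append_iff)
  then show False using ne by (cases p1) (simp_all add: pp)
qed

lemma length_filter_partition:
  assumes "finite C" "\<And>x. x \<in> set xs \<Longrightarrow> f x \<in> C"
  shows "length xs = (\<Sum>c\<in>C. length (filter (\<lambda>x. f x = c) xs))"
  using assms(2)
proof (induction xs)
  case (Cons x xs)
  have "(\<Sum>c\<in>C. length (filter (\<lambda>x. f x = c) (x # xs))) =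
      (\<Sum>c\<in>C. (if f x = c then 1 else 0) + length (filter (\<lambda>x. f x = c) xs))"
    by (intro sum.cong) simp_all
  also have "\<dots> = 1 + (\<Sum>c\<in>C. length (filter (\<lambda>x. f x = c) xs))"
    using assms(1) Cons.prems by (simp add: sum.distrib)
  finally show ?case using Cons by simp
qed simp

text \<open>A path meets the simplicial vertices of its component only in its two ends.\<close>

lemma isometric_cover_lower_bound:
  assumes cover: "isometric_path_cover (with_proj G) ps" and sym: "sym (parcs G)"
    and cid: "\<And>u v. (u, v) \<in> parcs G \<Longrightarrow> cid u = cid v"
    and C: "finite C" "cid ` pverts G \<subseteq> C" and fin: "finite (pverts G)"
    and k: "\<And>c. c \<in> C \<Longrightarrow> 2 * k c \<le> card {v \<in> pverts G. cid v = c \<and> simplicial (parcs G) v} + 1"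
  shows "(\<Sum>c\<in>C. k c) \<le> length ps"
proof -
  define P where "P c = filter (\<lambda>p. cid (hd p) = c) ps" for c
  have iso: "\<And>p. p \<in> set ps \<Longrightarrow> isometric_path (with_proj G) p"
    and cov: "\<And>v. v \<in> pverts G \<Longrightarrow> \<exists>p\<in>set ps. v \<in> set p"
    using cover by (simp_all add: isometric_path_cover_def)
  have path_comp: "cid v = cid (hd p)"
    if "successively (\<lambda>a b. (a, b) \<in> parcs G) p" "v \<in> set p" for p v
    using that
  proof (induction p)
    case (Cons a p)
    then show ?case using cid by (cases p) auto
  qed simp
  have "k c \<le> length (P c)" if c: "c \<in> C" for c
  proof -
    let ?S = "{v \<in> pverts G. cid v = c \<and> simplicial (parcs G) v}"
    have "?S \<subseteq> hd ` set (P c) \<union> last ` set (P c)"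
    proof
      fix v assume v: "v \<in> ?S"
      then obtain p where p: "p \<in> set ps" "v \<in> set p" using cov by blast
      have "v = hd p \<or> v = last p"
        using isometric_path_simplicial_end[OF iso[OF p(1)] sym p(2)] v by simp
      moreover have "cid v = cid (hd p)"
        using path_comp[OF _ p(2)] iso[OF p(1)] by (simp add: isometric_path_def vpath_iff)
      then have "p \<in> set (P c)" using p(1) v by (simp add: P_def)
      ultimately show "v \<in> hd ` set (P c) \<union> last ` set (P c)" by blast
    qed
    then have "card ?S \<le> card (hd ` set (P c) \<union> last ` set (P c))"
      by (intro card_mono) simp_all
    also have "\<dots> \<le> card (hd ` set (P c)) + card (last ` set (P c))" by (rule card_Un_le)
    also have "\<dots> \<le> length (P c) + length (P c)"
      by (intro add_mono order_trans[OF card_image_le card_length]) simp_all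
    \<comment> \<open>Here \<open>2 * k c \<le> card ?S + 1 \<le> 2 * length (P c) + 1\<close>, and
      parity removes the 1.\<close>
    finally show ?thesis using k[OF c] by simp
  qed
  then have "(\<Sum>c\<in>C. k c) \<le> (\<Sum>c\<in>C. length (P c))" by (rule sum_mono)
  also have "\<dots> = length ps"
    unfolding P_def
  proof (rule length_filter_partition[symmetric, OF C(1)])
    fix p assume "p \<in> set ps"
    from iso[OF this] have "p \<noteq> []" "set p \<subseteq> pverts G" by (simp_all add: isometric_path_def vpath_iff)
    then have "hd p \<in> pverts G" using hd_in_set by blast
    then show "cid (hd p) \<in> C" using C(2) by blast
  qed
  finally show ?thesis .
qed

text \<open>\<open>X\<close> is the set of the numbers of the vertices. The root \<open>x\<close> of
  a component hangs below an auxiliary block \<open>x - 1\<close>, whose parent is 0 and which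
  contains no other vertex as a child. So every vertex has a parent block, and
  \<open>root_of\<close> names the component by the number of its auxiliary block.\<close>

locale block_tree_on = block_tree +
  fixes X :: "nat set"
  assumes finite_X: "finite X"
    and X_odd: "x \<in> X \<Longrightarrow> odd x"
    and X_par: "x \<in> X \<Longrightarrow> par x \<noteq> 0"
    and X_closed: "x \<in> X \<Longrightarrow> par (par x) = 0 \<or> par (par x) \<in> X"
    and X_root: "x \<in> X \<Longrightarrow> par (par x) = 0 \<Longrightarrow> x = Suc (par x)"
    and X_root_only: "x \<in> X \<Longrightarrow> z \<in> X \<Longrightarrow> par (par x) = 0 \<Longrightarrow> par z = par x \<Longrightarrow> z = x"
begin

lemma X_pos: "x \<in> X \<Longrightarrow> 0 < x"
  using X_odd by (auto intro: odd_pos)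

lemma set_climb_anc: "z \<in> set (climb par a b) \<Longrightarrow> anc par a z \<or> anc par b z"
proof (induction a b rule: climb_induct)
  case (same a)
  then show ?case by (simp add: anc_refl)
next
  case (gt a b)
  then have "z = a \<or> anc par (par a) z \<or> anc par b z" by (simp add: climb_gt) blast
  then show ?case using anc_refl anc_step[of par a z] gt.hyps by blast
next
  case (lt a b)
  then have "z = b \<or> anc par a z \<or> anc par (par b) z" by (simp add: climb_lt) blast
  then show ?case using anc_refl anc_step[of par b z] lt.hyps by blast
qed

lemma anc_odd_X:
  assumes "anc par x z" "odd z" "x \<in> X"
  shows "z \<in> X"
proof -
  \<comment> \<open>Even nodes on the way up are carried along by the property that their parent is
    0 or in \<open>X\<close>.\<close>
  have "odd z \<longrightarrow> (x \<in> X \<or> even x \<and> (par x = 0 \<or> par x \<in> X)) \<longrightarrow> z \<in> X"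
    using assms(1)
  proof (induction rule: anc.induct)
    case (anc_step x y)
    show ?case
    proof (intro impI)
      assume y: "odd y" and x: "x \<in> X \<or> even x \<and> (par x = 0 \<or> par x \<in> X)"
      have "par x \<in> X \<or> even (par x) \<and> (par (par x) = 0 \<or> par (par x) \<in> X)"
      proof (cases "x \<in> X")
        case True
        then show ?thesis using X_closed par_odd X_odd by blast
      next
        case False
        then show ?thesis using x by (cases "par x = 0") simp_all
      qed
      then show "y \<in> X" using anc_step y by blast
    qed
  qed simp
  then show ?thesis using assms by blast
qed

lemma climb_X:
  assumes "a \<in> X" "b \<in> X" "z \<in> set (climb par a b)" "odd z"
  shows "z \<in> X"
  using set_climb_anc[OF assms(3)] anc_odd_X assms by blast

end

locale block_tree_graph = block_tree_on +
  fixes G :: "nat pair_pre_digraph" and num vt :: "nat \<Rightarrow> nat"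
  assumes num_X: "num ` pverts G = X"
    and vt_num: "v \<in> pverts G \<Longrightarrow> vt (num v) = v"
    and finite_pverts: "finite (pverts G)"
    and parcs_iff: "(u, v) \<in> parcs G \<longleftrightarrow> u \<in> pverts G \<and> v \<in> pverts G \<and> tadj par (num u) (num v)"
begin

definition gpath :: "nat \<Rightarrow> nat \<Rightarrow> nat list" where
  "gpath a b = map vt (filter odd (climb par a b))"

lemma vt_X: "x \<in> X \<Longrightarrow> vt x \<in> pverts G \<and> num (vt x) = x"
  using num_X vt_num by auto

lemma num_in_X: "v \<in> pverts G \<Longrightarrow> num v \<in> X"
  using num_X by blast

lemma sym_parcs: "sym (parcs G)"
  by (rule symI) (simp add: parcs_iff tadj_def eq_commute disj_commute disj_left_commute)

lemma tadj_vt: "x \<in> X \<Longrightarrow> y \<in> X \<Longrightarrow> tadj par x y \<Longrightarrow> (vt x, vt y) \<in> parcs G"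
  using vt_X by (simp add: parcs_iff)

text \<open>Every edge of the walk lowers the tree distance to \<open>b\<close> by at most two, so a
  walk to the vertex numbered \<open>b\<close> has at least half of that distance as its
  length.\<close>

lemma tdist_walk:
  assumes "successively (\<lambda>a b. (a, b) \<in> parcs G) q" "q \<noteq> []"
  shows "tdist par (num (hd q)) b \<le> 2 * (length q - 1) + tdist par (num (last q)) b"
  using assms
proof (induction q rule: vwalk_arcs.induct)
  case (3 x y q)
  have e: "(x, y) \<in> parcs G" using 3 by simp
  then have n: "num x \<in> X" "num y \<in> X" "tadj par (num x) (num y)"
    using num_in_X by (simp_all add: parcs_iff)
  have "tdist par (num x) b \<le> 2 + tdist par (num y) b"
    using tdist_tadj[OF n(3)] n(1,2) X_pos X_par by simp
  then show ?case using 3 by simp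
qed simp_all

text \<open>The tree path alternates between vertices and blocks, so the graph path has exactly half
  its length, and \<open>tdist_walk\<close> shows that nothing shorter exists.\<close>

lemma isometric_gpath:
  assumes "a \<in> X" "b \<in> X" "root_of par a = root_of par b"
  shows "isometric_path (with_proj G) (gpath a b)"
    and "2 * length (gpath a b) = tdist par a b + 2"
    and "z \<in> X \<Longrightarrow> z \<in> set (climb par a b) \<Longrightarrow> vt z \<in> set (gpath a b)"
proof -
  note c = climb_path[OF X_odd[OF assms(1)] X_odd[OF assms(2)] assms(3)]
  let ?f = "filter odd (climb par a b)"
  have fX: "set ?f \<subseteq> X" using climb_X[OF assms(1,2)] by (intro subsetI) simp
  show len: "2 * length (gpath a b) = tdist par a b + 2"
    using c(2) by (simp add: gpath_def)
  show "vt z \<in> set (gpath a b)" if "z \<in> X" "z \<in> set (climb par a b)"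
    unfolding gpath_def set_map set_filter using that X_odd[OF that(1)] by (intro imageI) simp
  have ne: "?f \<noteq> []" using c(2) by (intro notI) simp
  have inj: "inj_on vt X" by (rule inj_on_inverseI[of _ num]) (use vt_X in blast)
  have "distinct (gpath a b)"
    using distinct_climb[of a b] inj_on_subset[OF inj fX] by (simp add: gpath_def distinct_map)
  moreover have "set (gpath a b) \<subseteq> pverts G"
    unfolding gpath_def set_map using fX vt_X by blast
  moreover have "successively (\<lambda>a b. (a, b) \<in> parcs G) (gpath a b)"
    unfolding gpath_def successively_map
    by (rule successively_mono[OF c(1)]) (use fX tadj_vt in blast)
  moreover have "gpath a b \<noteq> []" using ne by (simp add: gpath_def)
  ultimately have vp: "vpath (gpath a b) (with_proj G)" by (simp add: vpath_iff)
  have ends: "hd (gpath a b) = vt a" "last (gpath a b) = vt b"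
    unfolding gpath_def using c(3,4) ne by (simp_all add: hd_map last_map)
  show "isometric_path (with_proj G) (gpath a b)"
    unfolding isometric_path_def
  proof (intro conjI allI impI vp)
    fix q assume q: "vpath q (with_proj G) \<and> hd q = hd (gpath a b) \<and> last q = last (gpath a b)"
    then have "tdist par a b \<le> 2 * (length q - 1)"
      using tdist_walk[of q b] ends vt_X[OF assms(1)] vt_X[OF assms(2)] by (simp add: vpath_iff)
    then show "vwalk_length (gpath a b) \<le> vwalk_length q" using len by simp
  qed
qed

lemma root_of_adj: "(u, v) \<in> parcs G \<Longrightarrow> root_of par (num u) = root_of par (num v)"
proof -
  assume "(u, v) \<in> parcs G"
  then have n: "num u \<in> X" "num v \<in> X" "tadj par (num u) (num v)"
    using num_in_X by (simp_all add: parcs_iff)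
  have r: "root_of par (par x) = root_of par x" "par (par x) = y \<Longrightarrow> y \<in> X \<Longrightarrow> root_of par y = root_of par x"
    if "x \<in> X" for x y
    using root_of_par[OF X_par[OF that]] root_of_par[of "par x"] X_pos[of y] by auto
  show ?thesis using n(3) r(1)[OF n(1)] r(1)[OF n(2)] r(2)[OF n(1) _ n(2)] r(2)[OF n(2) _ n(1)]
    unfolding tadj_def by metis
qed

end

section \<open>Greedy pairing of the leaves\<close>

context block_tree_on
begin

text \<open>The array \<open>par\<close> also has an entry below a vertex number whose vertex is not
  the first one of a block; such an even number is no node of the tree. The auxiliary block above a
  root is excluded as well, by \<open>par x \<noteq> 0\<close>.\<close>

definition real_node :: "nat \<Rightarrow> bool" where
  "real_node x \<longleftrightarrow> x \<in> X \<or> x \<in> par ` X \<and> par x \<noteq> 0"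

definition leaf :: "nat \<Rightarrow> bool" where
  "leaf x \<longleftrightarrow> (\<forall>z. real_node z \<longrightarrow> par z \<noteq> x)"

text \<open>The tree condition that makes a vertex simplicial: it is a leaf, or it is a root,
  recognised by \<open>par (par x) = 0\<close>, with at most one child block.\<close>

definition simple :: "nat \<Rightarrow> bool" where
  "simple x \<longleftrightarrow> (\<forall>z1 z2. real_node z1 \<and> real_node z2 \<and> par z1 = x \<and> par z2 = x \<longrightarrow> z1 = z2) \<and>
     (par (par x) \<noteq> 0 \<longrightarrow> leaf x)"

text \<open>An open path that starts at leaf \<open>l\<close> and waits in a slot of node
  \<open>y\<close> has weight \<open>g l y\<close>; an empty slot is \<open>l = 0\<close>. With
  \<open>below c\<close> the weights count the open ends in a component, with
  \<open>tdist par\<close> they measure lengths.\<close>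

definition wt :: "(nat \<Rightarrow> nat \<Rightarrow> nat) \<Rightarrow> nat \<Rightarrow> nat \<Rightarrow> nat" where
  "wt g l y = (if l = 0 then 0 else g l y)"

definition pending :: "(nat \<Rightarrow> nat \<Rightarrow> nat) \<Rightarrow> (nat \<Rightarrow> nat) \<Rightarrow> (nat \<Rightarrow> nat) \<Rightarrow> nat \<Rightarrow> nat" where
  "pending g A B k = (\<Sum>y\<in>{1..<k}. wt g (A y) y + wt g (B y) y)"

definition below :: "nat \<Rightarrow> nat \<Rightarrow> nat \<Rightarrow> nat" where
  "below c l y = (if root_of par y = c then 1 else 0)"

definition ends_in :: "nat \<Rightarrow> (nat \<times> nat) list \<Rightarrow> nat" where
  "ends_in c es = length (filter (\<lambda>e. root_of par (fst e) = c) es)"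

definition leaves :: "nat \<Rightarrow> nat \<Rightarrow> nat set" where
  "leaves c k = {l \<in> X. k \<le> l \<and> leaf l \<and> root_of par l = c}"

definition simples :: "nat \<Rightarrow> nat set" where
  "simples c = {l \<in> X. simple l \<and> root_of par l = c}"

definition covered :: "(nat \<times> nat) list \<Rightarrow> nat \<Rightarrow> bool" where
  "covered es z \<longleftrightarrow> (\<exists>e\<in>set es. z \<in> set (climb par (fst e) (snd e)))"

text \<open>The open path that runs from leaf \<open>l\<close> up to \<open>y\<close> contains the
  node \<open>z\<close>.\<close>

definition through :: "nat \<Rightarrow> nat \<Rightarrow> nat \<Rightarrow> bool" where
  "through l z y \<longleftrightarrow> l \<noteq> 0 \<and> anc par l z \<and> anc par z y"

text \<open>The real children of \<open>y\<close> that the downward sweep has already merged into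
  it, \<open>j\<close> being the least number that is done.\<close>

definition child_of :: "nat \<Rightarrow> nat \<Rightarrow> nat \<Rightarrow> bool" where
  "child_of j c y \<longleftrightarrow> j \<le> c \<and> real_node c \<and> par c = y"

text \<open>Guarantees that the tree path from \<open>p\<close> to \<open>q\<close> turns at
  \<open>y\<close>, so that it covers both branches up to \<open>y\<close>.\<close>

definition split_at :: "nat \<Rightarrow> nat \<Rightarrow> nat \<Rightarrow> bool" where
  "split_at y p q \<longleftrightarrow> (\<exists>c1 c2. c1 \<noteq> c2 \<and> 0 < c1 \<and> 0 < c2 \<and> par c1 = y \<and> par c2 = y \<and> anc par p c1 \<and> anc par q c2)"

lemma wt_0[simp]: "wt g 0 y = 0"
  by (simp add: wt_def)

lemma real_par: "real_node x \<Longrightarrow> par x \<noteq> 0"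
  using X_par by (auto simp: real_node_def)

lemma real_pos: "real_node x \<Longrightarrow> 0 < x"
  using real_par[of x] by (cases "x = 0") simp_all

lemma real_par_cases:
  assumes "real_node x"
  shows "real_node (par x) \<or> x \<in> X \<and> par (par x) = 0"
proof (cases "x \<in> X")
  case True
  then have "par x \<in> par ` X" by (rule imageI)
  then show ?thesis using True by (cases "par (par x) = 0") (simp_all add: real_node_def)
next
  case False
  then obtain z where z: "z \<in> X" "x = par z" "par x \<noteq> 0" using assms by (auto simp: real_node_def)
  then have "par x \<in> X" using X_closed[OF z(1)] by simp
  then show ?thesis by (simp add: real_node_def)
qed

lemma real_even: "real_node x \<Longrightarrow> x \<notin> X \<Longrightarrow> par (par x) \<noteq> 0"
proof -
  assume x: "real_node x" "x \<notin> X"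
  then obtain z where z: "z \<in> X" "x = par z" "par x \<noteq> 0" by (auto simp: real_node_def)
  then have "par x \<in> X" using X_closed[OF z(1)] by simp
  then show ?thesis by (rule X_par)
qed

lemma pending_Suc: "0 < k \<Longrightarrow> pending g A B (Suc k) = pending g A B k + wt g (A k) k + wt g (B k) k"
  by (simp add: pending_def)

text \<open>In additive form, since subtraction on \<open>nat\<close> is truncated.\<close>

lemma pending_update:
  assumes "0 < y" "y < k"
  shows "pending g (A(y := p)) (B(y := q)) k + wt g (A y) y + wt g (B y) y
    = pending g A B k + wt g p y + wt g q y"
proof -
  have *: "(\<Sum>z\<in>{1..<k}. f z) = f y + (\<Sum>z\<in>{1..<k} - {y}. f z)" for f :: "nat \<Rightarrow> nat"
    using assms by (intro sum.remove) simp_all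
  have "(\<Sum>z\<in>{1..<k} - {y}. wt g ((A(y := p)) z) z + wt g ((B(y := q)) z) z) =
      (\<Sum>z\<in>{1..<k} - {y}. wt g (A z) z + wt g (B z) z)"
    by (intro sum.cong) simp_all
  then show ?thesis
    unfolding pending_def *[of "\<lambda>z. wt g ((A(y := p)) z) z + wt g ((B(y := q)) z) z"]
      *[of "\<lambda>z. wt g (A z) z + wt g (B z) z"] by simp
qed

lemma ends_in_append: "ends_in c (es @ es') = ends_in c es + ends_in c es'"
  by (simp add: ends_in_def)

lemma covered_append: "covered (es @ es') z \<longleftrightarrow> covered es z \<or> covered es' z"
  by (auto simp: covered_def)

lemma leaves_skip: "k \<notin> X \<or> \<not> leaf k \<Longrightarrow> leaves c k = leaves c (Suc k)"
  unfolding leaves_def by (rule Collect_cong) (metis Suc_leD le_antisym not_less_eq_eq)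

lemma finite_leaves: "finite (leaves c k)" and finite_simples: "finite (simples c)"
  unfolding leaves_def simples_def using finite_X by simp_all

lemma card_leaves_le: "card (leaves c k) \<le> card (simples c)"
  by (rule card_mono[OF finite_simples]) (auto simp: leaves_def simples_def simple_def leaf_def)

lemma leaves_leaf:
  assumes "k \<in> X" "leaf k"
  shows "card (leaves c k) = card (leaves c (Suc k)) + (if root_of par k = c then 1 else 0)"
proof (cases "root_of par k = c")
  case True
  then have "leaves c k = insert k (leaves c (Suc k))"
    using assms unfolding leaves_def by (auto simp: le_eq_less_or_eq Suc_le_eq)
  moreover have "k \<notin> leaves c (Suc k)" by (simp add: leaves_def)
  ultimately show ?thesis using finite_leaves True by simp
next
  case False
  then have "leaves c k = leaves c (Suc k)"
    unfolding leaves_def by (auto simp: le_eq_less_or_eq Suc_le_eq)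
  then show ?thesis using False by simp
qed

lemma child_of_mono: "child_of (Suc j) c y \<Longrightarrow> child_of j c y"
  by (simp add: child_of_def)

lemma child_of_real: "child_of j c y \<Longrightarrow> par y \<noteq> 0 \<Longrightarrow> real_node y"
  using real_par_cases[of c] by (auto simp: child_of_def)

end

text \<open>
  The nodes from \<open>k\<close> on have been visited and those from \<open>j\<close> on have been merged into their
  parents; \<open>a\<close> and \<open>b\<close> are the open path ends at \<open>k\<close> when \<open>j = k + 1\<close>. Open ends in a slot are
  0 or leaves, \<open>M y\<close> records that at least two children were merged into \<open>y\<close>.
\<close>

locale greedy_inv = block_tree_on par X for par X +
  fixes N k j a b :: nat and A B M :: "nat \<Rightarrow> nat" and es :: "(nat \<times> nat) list"
  assumes A0_B0: "\<And>y. y < k \<Longrightarrow> A y = 0 \<Longrightarrow> B y = 0"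
    and A0_M0: "\<And>y. y < k \<Longrightarrow> A y = 0 \<Longrightarrow> M y = 0"
    and top_slot: "\<And>y. y < k \<Longrightarrow> par y = 0 \<Longrightarrow> A y = 0"
    and A_slot: "\<And>y. y < k \<Longrightarrow> A y \<noteq> 0 \<Longrightarrow> A y \<in> X \<and> (\<exists>c. child_of j c y \<and> anc par (A y) c)"
    and B_slot: "\<And>y. y < k \<Longrightarrow> B y \<noteq> 0 \<Longrightarrow> B y \<in> X \<and> (\<exists>c. child_of j c y \<and> anc par (B y) c)"
    and A0_child: "\<And>y c. y < k \<Longrightarrow> par y \<noteq> 0 \<Longrightarrow> A y = 0 \<Longrightarrow> \<not> child_of j c y"
    and M_split: "\<And>y. y < k \<Longrightarrow> M y \<noteq> 0 \<Longrightarrow> B y \<noteq> 0 \<Longrightarrow> split_at y (A y) (B y)"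
    and M0_child: "\<And>y c1 c2. M y = 0 \<Longrightarrow> child_of j c1 y \<Longrightarrow> child_of j c2 y \<Longrightarrow> c1 = c2"
    and emitted_X: "\<And>e. e \<in> set es \<Longrightarrow> fst e \<in> X \<and> snd e \<in> X \<and> root_of par (fst e) = root_of par (snd e)"
    and cover: "\<And>z. z \<in> X \<Longrightarrow> k \<le> z \<Longrightarrow> covered es z \<or> (\<exists>y<k. 0 < y \<and> (through (A y) z y \<or> through (B y) z y)) \<or>
        through a z k \<or> through b z k"
    and count_open: "\<And>c. Suc c < k \<or> Suc c = k \<and> a \<noteq> 0 \<Longrightarrow>
       card (leaves c k) = 2 * ends_in c es + pending (below c) A B k + wt (below c) a k + wt (below c) b k"
    and count_done: "\<And>c. \<not> (Suc c < k \<or> Suc c = k \<and> a \<noteq> 0) \<Longrightarrow> 2 * ends_in c es \<le> card (simples c) + 1"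
    and total_length: "sum_list (map (\<lambda>e. tdist par (fst e) (snd e)) es) + pending (tdist par) A B k + wt (tdist par) a k + wt (tdist par) b k
       \<le> 2 * (Suc N - j)"

text \<open>In the counting clauses \<open>Suc c\<close> is the root vertex of the component named
  \<open>c\<close>, which is open until the sweep has closed that vertex. While it is open, the
  leaves seen are as many as the ends of emitted pairs and of waiting paths; afterwards only the
  bound by the simple vertices is kept. In \<open>total_length\<close>, each number from
  \<open>j\<close> to \<open>N\<close> contributes 2 to the budget, for at most two uses of the edge
  to the parent.\<close>

abbreviation (in block_tree_on) "Inv \<equiv> greedy_inv par X"

lemmas (in block_tree_on) invI = greedy_inv.intro[OF block_tree_on_axioms greedy_inv_axioms.intro]

section \<open>Taking up the open paths at one node\<close>

context block_tree_on
begin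

lemma leaf_simple: "leaf x \<Longrightarrow> simple x"
  unfolding leaf_def simple_def by blast

lemma not_leaf: "child_of j c y \<Longrightarrow> \<not> leaf y"
  by (auto simp: child_of_def leaf_def)

lemma child_of_SucD: "child_of k c y \<Longrightarrow> c = k \<and> y = par k \<or> child_of (Suc k) c y"
  by (cases "c = k") (auto simp: child_of_def)

lemma child_anc: "child_of j c y \<Longrightarrow> anc par l c \<Longrightarrow> anc par l y"
  using anc_par[of l c] real_pos[of c] by (auto simp: child_of_def)

lemma real_child_greater: "real_node z \<Longrightarrow> par z = k \<Longrightarrow> child_of (Suc k) z k"
  using par_less[of z] real_pos[of z] by (simp add: child_of_def)

lemma through_par:
  assumes "through l z k" "0 < k" shows "through l z (par k)"
  using assms anc_par[of k k] anc_par[of z k] by (simp add: through_def)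

text \<open>Node \<open>k\<close> has received paths from its children. Its slot is taken over as
  \<open>a\<close> and \<open>b\<close>, and its weight moves from \<open>pending\<close> into the
  separate terms. Coverage of \<open>k\<close> itself is new: it is the upper end of the path from
  \<open>A k\<close>.\<close>

lemma inv_hold_slot:
  assumes "Inv N (Suc k) (Suc k) 0 0 A B M es" and A: "A k \<noteq> 0" and "0 < k"
  shows "Inv N k (Suc k) (A k) (B k) A B M es"
    and "real_node k" "A k \<in> X" "anc par (A k) k" "B k \<noteq> 0 \<Longrightarrow> B k \<in> X \<and> anc par (B k) k"
    "\<not> leaf k" "M k \<noteq> 0 \<Longrightarrow> B k \<noteq> 0 \<Longrightarrow> split_at k (A k) (B k)"
proof -
  interpret I: greedy_inv par X N "Suc k" "Suc k" 0 0 A B M es by fact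
  have pk: "par k \<noteq> 0" using I.top_slot[of k] A by auto
  obtain c where c: "child_of (Suc k) c k" "anc par (A k) c" using I.A_slot[of k] A by auto
  show "real_node k" using child_of_real[OF c(1) pk] .
  show AX: "A k \<in> X" using I.A_slot[of k] A by simp
  show Ak: "anc par (A k) k" using child_anc c by blast
  show "B k \<in> X \<and> anc par (B k) k" if "B k \<noteq> 0"
    using I.B_slot[of k] that child_anc by auto
  show nl: "\<not> leaf k" using not_leaf c by blast
  show "split_at k (A k) (B k)" if "M k \<noteq> 0" "B k \<noteq> 0" using I.M_split[of k] that by simp
  show "Inv N k (Suc k) (A k) (B k) A B M es"
  proof (rule invI)
    fix z assume z: "z \<in> X" "k \<le> z"
    show "covered es z \<or> (\<exists>y<k. 0 < y \<and> (through (A y) z y \<or> through (B y) z y)) \<or> through (A k) z k \<or> through (B k) z k"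
    proof (cases "z = k")
      case True
      then show ?thesis using Ak A anc_refl by (simp add: through_def)
    next
      case False
      then have "Suc k \<le> z" using z by simp
      from I.cover[OF z(1) this] show ?thesis
        by (auto simp: through_def less_Suc_eq)
    qed
  next
    fix c assume "Suc c < k \<or> Suc c = k \<and> A k \<noteq> 0"
    then have "Suc c < Suc k \<or> Suc c = Suc k \<and> (0::nat) \<noteq> 0" by auto
    from I.count_open[OF this] show "card (leaves c k) = 2 * ends_in c es + pending (below c) A B k + wt (below c) (A k) k + wt (below c) (B k) k"
      using leaves_skip[of k c] nl pending_Suc[OF \<open>0 < k\<close>] by simp
  next
    fix c assume "\<not> (Suc c < k \<or> Suc c = k \<and> A k \<noteq> 0)"
    then have "\<not> (Suc c < Suc k \<or> Suc c = Suc k \<and> (0::nat) \<noteq> 0)" using A by auto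
    from I.count_done[OF this] show "2 * ends_in c es \<le> card (simples c) + 1" .
  next
    show "(\<Sum>e\<leftarrow>es. tdist par (fst e) (snd e)) + pending (tdist par) A B k + wt (tdist par) (A k) k + wt (tdist par) (B k) k \<le> 2 * (Suc N - Suc k)"
      using I.total_length pending_Suc[OF \<open>0 < k\<close>] by simp
  qed ((rule I.A0_B0[OF less_SucI] I.A0_M0[OF less_SucI] I.top_slot[OF less_SucI] I.A_slot[OF less_SucI]
      I.B_slot[OF less_SucI] I.A0_child[OF less_SucI] I.M_split[OF less_SucI] I.M0_child I.emitted_X; assumption)+)
qed

text \<open>A vertex with an empty slot has no real child, so it opens a path of length 0, and both
  sides of the leaf count of its component grow by one.\<close>

lemma inv_hold_leaf:
  assumes "Inv N (Suc k) (Suc k) 0 0 A B M es" and A: "A k = 0" and k: "k \<in> X"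
  shows "Inv N k (Suc k) k 0 A B M es"
proof -
  interpret I: greedy_inv par X N "Suc k" "Suc k" 0 0 A B M es by fact
  have k0: "0 < k" "par k \<noteq> 0" using X_pos X_par k by auto
  have B: "B k = 0" using I.A0_B0[of k] A by simp
  have lf: "leaf k"
    unfolding leaf_def using I.A0_child[of k] A k0(2) real_child_greater by blast
  have P: "pending g A B (Suc k) = pending g A B k" for g
    using pending_Suc[OF k0(1), of g A B] A B by simp
  show ?thesis
  proof (rule invI)
    fix z assume z: "z \<in> X" "k \<le> z"
    show "covered es z \<or> (\<exists>y<k. 0 < y \<and> (through (A y) z y \<or> through (B y) z y)) \<or> through k z k \<or> through 0 z k"
    proof (cases "z = k")
      case True
      then show ?thesis using k0 anc_refl by (simp add: through_def)
    next
      case False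
      then have "Suc k \<le> z" using z by simp
      from I.cover[OF z(1) this] show ?thesis
        using A B by (auto simp: through_def less_Suc_eq)
    qed
  next
    fix c assume "Suc c < k \<or> Suc c = k \<and> k \<noteq> 0"
    then have "Suc c < Suc k \<or> Suc c = Suc k \<and> (0::nat) \<noteq> 0" by auto
    from I.count_open[OF this] show "card (leaves c k) = 2 * ends_in c es + pending (below c) A B k + wt (below c) k k + wt (below c) 0 k"
      using leaves_leaf[OF k lf, of c] P k0 by (simp add: wt_def below_def)
  next
    fix c assume "\<not> (Suc c < k \<or> Suc c = k \<and> k \<noteq> 0)"
    then have "\<not> (Suc c < Suc k \<or> Suc c = Suc k \<and> (0::nat) \<noteq> 0)" using k0 by auto
    from I.count_done[OF this] show "2 * ends_in c es \<le> card (simples c) + 1" .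
  next
    show "(\<Sum>e\<leftarrow>es. tdist par (fst e) (snd e)) + pending (tdist par) A B k + wt (tdist par) k k + wt (tdist par) 0 k \<le> 2 * (Suc N - Suc k)"
      using I.total_length P k0 by (simp add: wt_def)
  qed ((rule I.A0_B0[OF less_SucI] I.A0_M0[OF less_SucI] I.top_slot[OF less_SucI] I.A_slot[OF less_SucI]
      I.B_slot[OF less_SucI] I.A0_child[OF less_SucI] I.M_split[OF less_SucI] I.M0_child I.emitted_X; assumption)+)
qed

text \<open>A number outside \<open>X\<close> with an empty slot is no real node, because a real
  block would have received a path from a vertex in it.\<close>

lemma inv_skip:
  assumes "Inv N (Suc k) (Suc k) 0 0 A B M es" and A: "A k = 0" and k: "k \<notin> X" "0 < k"
  shows "Inv N k k 0 0 A B M es"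
proof -
  interpret I: greedy_inv par X N "Suc k" "Suc k" 0 0 A B M es by fact
  have B: "B k = 0" using I.A0_B0[of k] A by simp
  have nr: "\<not> real_node k"
  proof
    assume "real_node k"
    then obtain z where z: "z \<in> X" "k = par z" "par k \<noteq> 0" using k by (auto simp: real_node_def)
    then have "child_of (Suc k) z k" by (intro real_child_greater) (simp_all add: real_node_def)
    then show False using I.A0_child[of k z] A z(3) by simp
  qed
  have ch: "child_of k c y \<longleftrightarrow> child_of (Suc k) c y" for c y
    using nr by (auto simp: child_of_def Suc_le_eq le_less)
  have P: "pending g A B (Suc k) = pending g A B k" for g
    using pending_Suc[OF k(2), of g A B] A B by simp
  have L: "leaves c k = leaves c (Suc k)" for c using leaves_skip k by blast
  show ?thesis
  proof (rule invI, unfold ch)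
    fix z assume z: "z \<in> X" "k \<le> z"
    then have "Suc k \<le> z" using k by (cases "z = k") simp_all
    from I.cover[OF z(1) this] show "covered es z \<or> (\<exists>y<k. 0 < y \<and> (through (A y) z y \<or> through (B y) z y)) \<or> through 0 z k \<or> through 0 z k"
        using A B by (auto simp: through_def less_Suc_eq)
  next
    fix c assume "Suc c < k \<or> Suc c = k \<and> (0::nat) \<noteq> 0"
    then have "Suc c < Suc k \<or> Suc c = Suc k \<and> (0::nat) \<noteq> 0" by auto
    from I.count_open[OF this] show "card (leaves c k) = 2 * ends_in c es + pending (below c) A B k + wt (below c) 0 k + wt (below c) 0 k"
      using L P by simp
  next
    fix c assume c: "\<not> (Suc c < k \<or> Suc c = k \<and> (0::nat) \<noteq> 0)"
    show "2 * ends_in c es \<le> card (simples c) + 1"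
    \<comment> \<open>For \<open>Suc c = k\<close> the name \<open>c\<close> leaves the open range,
      and its equation is weakened to the bound by simple vertices.\<close>
    proof (cases "Suc c = k")
      case True
      then show ?thesis using I.count_open[of c] card_leaves_le[of c "Suc k"] by simp
    next
      case False
      then show ?thesis using c I.count_done[of c] by simp
    qed
  next
    show "(\<Sum>e\<leftarrow>es. tdist par (fst e) (snd e)) + pending (tdist par) A B k + wt (tdist par) 0 k + wt (tdist par) 0 k \<le> 2 * (Suc N - k)"
      using I.total_length P by simp
  qed ((rule I.A0_B0[OF less_SucI] I.A0_M0[OF less_SucI] I.top_slot[OF less_SucI] I.A_slot[OF less_SucI]
      I.B_slot[OF less_SucI] I.A0_child[OF less_SucI] I.M_split[OF less_SucI] I.M0_child I.emitted_X; assumption)+)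
qed

end

section \<open>Passing open paths to the parent, and closing a component\<close>

context block_tree_on
begin

lemma split_atI:
  assumes "child_of (Suc k) c y" "anc par l c" "anc par h k" "0 < k" "par k = y"
  shows "split_at y l h" "split_at y h l"
proof -
  have c: "c \<noteq> k" "0 < c" "par c = y" using assms(1) by (auto simp: child_of_def)
  show "split_at y l h"
    unfolding split_at_def using assms c by (intro exI[of _ c] exI[of _ k]) simp
  show "split_at y h l"
    unfolding split_at_def using assms c by (intro exI[of _ k] exI[of _ c]) simp
qed

lemma split_at_lca: "split_at y p q \<Longrightarrow> lca p q y"
  unfolding split_at_def using lca_siblings by blast

lemma through_climb:
  assumes "lca p q y" "through l z y" "l = p \<or> l = q"
  shows "z \<in> set (climb par p q)"
  using assms climb_lca[OF assms(1)] by (auto simp: through_def)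

text \<open>Treats all ways of moving the paths at \<open>k\<close> into the slot of the parent
  \<open>y\<close> at once: \<open>p\<close> and \<open>q\<close> remain open and \<open>em\<close>
  is emitted. The assumption \<open>sum\<close>, for every weight \<open>f\<close> with
  \<open>f 0 = 0\<close>, expresses that no open end is lost or doubled. It is applied to an
  indicator function for coverage, to \<open>below c\<close> for the count and to
  \<open>tdist par\<close> for the length.\<close>

lemma inv_merge:
  assumes inv: "Inv N k (Suc k) a b A B M es" and k: "real_node k" "k \<le> N" and y: "y = par k" "par y \<noteq> 0"
    and a: "a \<in> X" "anc par a k" and b: "b \<noteq> 0 \<Longrightarrow> b \<in> X \<and> anc par b k"
    and em: "em = [] \<or> em = [(A y, a)] \<and> A y \<noteq> 0"
    and sum: "\<And>f :: nat \<Rightarrow> nat. f 0 = 0 \<Longrightarrow>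
      f p + f q + (if em = [] then 0 else f (A y) + f a) = f (A y) + f (B y) + f a + f b"
    and p: "p \<noteq> 0" "p \<in> {A y, B y, a, b}" "q \<in> {0, A y, B y, a, b}"
    and split: "A y \<noteq> 0 \<Longrightarrow> q \<noteq> 0 \<Longrightarrow> p \<in> {A y, B y} \<and> q \<in> {a, b} \<or> p \<in> {a, b} \<and> q \<in> {A y, B y}"
    and M': "M' = (if A y = 0 then M else M(y := 1))"
  shows "Inv N k k 0 0 (A(y := p)) (B(y := q)) M' (es @ em)"
proof -
  let ?A' = "A(y := p)" and ?B' = "B(y := q)"
  interpret I: greedy_inv par X N k "Suc k" a b A B M es by fact
  have k0: "0 < k" using real_pos k by simp
  have yk: "y < k" using par_less[OF k0] y by simp
  have y0: "0 < y" using y(2) by (cases "y = 0") simp_all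
  have a0: "a \<noteq> 0" using X_pos[OF a(1)] by simp
  have kk: "child_of k k y" using k y by (simp add: child_of_def)
  have ay: "anc par a y" using anc_par[OF a(2) k0] y by simp
  have new: "l \<in> X \<and> anc par l k" if "l = a \<or> l = b" "l \<noteq> 0" for l
    using that a b by blast
  have old: "l \<in> X \<and> (\<exists>c. child_of (Suc k) c y \<and> anc par l c)" if "l = A y \<or> l = B y" "l \<noteq> 0" for l
    using that I.A_slot[OF yk] I.B_slot[OF yk] by blast
  have any: "l \<in> X \<and> (\<exists>c. child_of k c y \<and> anc par l c)" if "l = A y \<or> l = B y \<or> l = a \<or> l = b" "l \<noteq> 0" for l
    using that new[of l] old[of l] kk child_of_mono by blast
  \<comment> \<open>\<open>A y\<close> came from a child of \<open>y\<close> other than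
    \<open>k\<close>, so the emitted path turns at \<open>y\<close>.\<close>
  have em_lca: "lca (A y) a y" if "em \<noteq> []"
  proof -
    have "A y \<noteq> 0" using that em by auto
    then obtain c where "child_of (Suc k) c y" "anc par (A y) c" using old[of "A y"] by blast
    then show ?thesis using split_at_lca split_atI(1) a(2) k0 y by blast
  qed
  have root_y: "root_of par k = root_of par y"
    using root_of_par[of k] y y0 by simp
  have root_l: "root_of par l = root_of par y" if l: "l = A y \<or> l = B y \<or> l = a \<or> l = b" "l \<noteq> 0" for l
  proof -
    obtain c where c: "child_of k c y" "anc par l c" using any[OF l] by blast
    have "anc par l y" using child_anc[OF c] .
    then show ?thesis using root_of_anc y0 by blast
  qed
  have em_in: "ends_in c em = (if em = [] then 0 else if root_of par y = c then 1 else 0)" for c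
    using em root_l[of "A y"] by (auto simp: ends_in_def)
  \<comment> \<open>A closed component has \<open>c \<ge> k - 1 \<ge> y\<close>, whereas the top
    node above \<open>y\<close> is smaller than \<open>y\<close>.\<close>
  have done_em: "ends_in c em = 0" if "\<not> Suc c < k" for c
  proof -
    have "root_of par y \<noteq> y" using root_of_props[OF y0] y(2) by auto
    then have "root_of par y < y" using root_of_le[of y] by simp
    then have "root_of par y \<noteq> c" using that yk by simp
    then show ?thesis by (simp add: em_in)
  qed
  show ?thesis
  proof (rule invI)
    fix z assume "z < k" "?A' z = 0"
    then show "?B' z = 0" using p(1) I.A0_B0 by (cases "z = y") simp_all
  next
    fix z assume "z < k" "?A' z = 0"
    then show "M' z = 0" using p(1) I.A0_M0 by (cases "z = y") (simp_all add: M')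
  next
    fix z assume "z < k" "par z = 0"
    then show "?A' z = 0" using y(2) I.top_slot by (cases "z = y") simp_all
  next
    fix z assume z: "z < k" "?A' z \<noteq> 0"
    show "?A' z \<in> X \<and> (\<exists>c. child_of k c z \<and> anc par (?A' z) c)"
    proof (cases "z = y")
      case True
      then show ?thesis using any[of p] p(1,2) by simp
    next
      case False
      then show ?thesis using I.A_slot[of z] z child_of_mono[of k] by auto
    qed
  next
    fix z assume z: "z < k" "?B' z \<noteq> 0"
    show "?B' z \<in> X \<and> (\<exists>c. child_of k c z \<and> anc par (?B' z) c)"
    proof (cases "z = y")
      case True
      then show ?thesis using any[of q] p(3) z by simp
    next
      case False
      then show ?thesis using I.B_slot[of z] z child_of_mono[of k] by auto
    qed
  next
    fix z c assume z: "z < k" "par z \<noteq> 0" "?A' z = 0"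
    then have zy: "z \<noteq> y" using p(1) by auto
    then have "\<not> child_of (Suc k) c z" using I.A0_child[of z c] z by simp
    then show "\<not> child_of k c z" using child_of_SucD[of k c z] zy y(1) by blast
  next
    fix z assume z: "z < k" "M' z \<noteq> 0" "?B' z \<noteq> 0"
    show "split_at z (?A' z) (?B' z)"
    proof (cases "z = y")
      case True
      have Ay: "A y \<noteq> 0"
      proof
        assume "A y = 0"
        then show False using I.A0_M0[OF yk] z(2) True by (simp add: M')
      qed
      have q0: "q \<noteq> 0" using z True by simp
      have s: "split_at y l h \<and> split_at y h l" if lh: "l \<in> {A y, B y}" "h \<in> {a, b}" "l \<noteq> 0" "h \<noteq> 0" for l h
      proof -
        obtain c where "child_of (Suc k) c y" "anc par l c" using old[of l] lh by blast
        then show ?thesis using split_atI[of k c y l h] new[of h] lh k0 y(1) by blast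
      qed
      show ?thesis using split[OF Ay q0] s[of p q] s[of q p] p(1) q0 True by auto
    next
      case False
      then show ?thesis using I.M_split[of z] z by (simp add: M' split: if_splits)
    qed
  next
    fix z c1 c2 assume z: "M' z = 0" and c: "child_of k c1 z" "child_of k c2 z"
    have Mz: "M z = 0" using z by (simp add: M' split: if_splits)
    show "c1 = c2"
    proof (cases "z = y")
      case True
      then have Ay: "A y = 0" using z by (auto simp: M' split: if_splits)
      have "\<not> child_of (Suc k) c y" for c using I.A0_child[OF yk y(2) Ay] .
      then show ?thesis using c child_of_SucD True by blast
    next
      case False
      then have "child_of (Suc k) c1 z" "child_of (Suc k) c2 z"
        using c child_of_SucD y(1) by blast+
      then show ?thesis using I.M0_child[OF Mz] by blast
    qed
  next
    fix e assume "e \<in> set (es @ em)"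
    then have "e \<in> set es \<or> e = (A y, a) \<and> A y \<noteq> 0" using em by auto
    then show "fst e \<in> X \<and> snd e \<in> X \<and> root_of par (fst e) = root_of par (snd e)"
      using I.emitted_X[of e] any[of "A y"] root_l[of "A y"] root_l[of a] a(1) a0 by auto
  next
    fix z assume z: "z \<in> X" "k \<le> z"
    have keep: "covered em z \<or> through p z y \<or> through q z y"
      if t: "through l z y" and l: "l \<in> {A y, B y, a, b}" for l
    proof -
      \<comment> \<open>With the indicator of \<open>l\<close> as weight, \<open>sum\<close> tells
        where the open end \<open>l\<close> went.\<close>
      define f where "f x = (if x = l then 1 else 0 :: nat)" for x
      have l0: "l \<noteq> 0" using t by (simp add: through_def)
      then have "f (A y) + f (B y) + f a + f b \<noteq> 0" using l by (auto simp: f_def)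
      then have "f p + f q + (if em = [] then 0 else f (A y) + f a) \<noteq> 0"
        using sum[of f] l0 by (simp add: f_def)
      then have c: "l = p \<or> l = q \<or> em \<noteq> [] \<and> (l = A y \<or> l = a)"
        by (auto simp: f_def split: if_splits)
      have "covered em z" if "em \<noteq> []" "l = A y \<or> l = a"
      proof -
        have "z \<in> set (climb par (A y) a)" using through_climb[OF em_lca[OF that(1)] t that(2)] .
        then show ?thesis using em that(1) by (simp add: covered_def)
      qed
      then show ?thesis using c t by blast
    qed
    have "covered (es @ em) z \<or> (\<exists>y'<k. 0 < y' \<and> (through (?A' y') z y' \<or> through (?B' y') z y'))"
      if "covered es z \<or> covered em z \<or> through p z y \<or> through q z y \<or> (\<exists>y'<k. y' \<noteq> y \<and> 0 < y' \<and> (through (A y') z y' \<or> through (B y') z y'))"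
    proof -
      have "\<exists>y'<k. 0 < y' \<and> (through (?A' y') z y' \<or> through (?B' y') z y')"
        if "through p z y \<or> through q z y"
        using that yk y0 by (intro exI[of _ y]) simp
      moreover have "\<exists>y'<k. 0 < y' \<and> (through (?A' y') z y' \<or> through (?B' y') z y')"
        if "y' < k" "y' \<noteq> y" "0 < y'" "through (A y') z y' \<or> through (B y') z y'" for y'
        using that by (intro exI[of _ y']) simp
      ultimately show ?thesis using that unfolding covered_append by blast
    qed
    moreover have "covered em z \<or> through p z y \<or> through q z y" if "through a z k \<or> through b z k"
      using that through_par[of _ z k] k0 y(1) keep[of a] keep[of b] by blast
    ultimately show "covered (es @ em) z \<or> (\<exists>y'<k. 0 < y' \<and> (through (?A' y') z y' \<or> through (?B' y') z y')) \<or>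
       through 0 z k \<or> through 0 z k"
      using I.cover[OF z] keep[of "A y"] keep[of "B y"] by blast
  next
    fix c assume "Suc c < k \<or> Suc c = k \<and> (0::nat) \<noteq> 0"
    then have "Suc c < k" by simp
    then have I: "card (leaves c k) = 2 * ends_in c es + pending (below c) A B k + wt (below c) a k + wt (below c) b k"
      using I.count_open[of c] by simp
    define f where "f l = wt (below c) l y" for l
    have f: "f l = (if l = 0 then 0 else if root_of par y = c then 1 else 0)" for l
      by (simp add: f_def wt_def below_def)
    have "wt (below c) l k = f l" for l by (simp add: f wt_def below_def root_y)
    moreover have "2 * ends_in c em = (if em = [] then 0 else f (A y) + f a)"
      using em a0 by (auto simp: em_in f)
    moreover have "f p + f q + (if em = [] then 0 else f (A y) + f a) = f (A y) + f (B y) + f a + f b"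
      by (rule sum) (simp add: f)
    ultimately show "card (leaves c k) = 2 * ends_in c (es @ em) + pending (below c) ?A' ?B' k + wt (below c) 0 k + wt (below c) 0 k"
      using I pending_update[OF y0 yk, of "below c" A p B q, folded f_def] unfolding ends_in_append by simp
  next
    fix c assume c: "\<not> (Suc c < k \<or> Suc c = k \<and> (0::nat) \<noteq> 0)"
    have "2 * ends_in c es \<le> card (simples c) + 1"
    proof (cases "Suc c = k")
      case True
      then show ?thesis using I.count_open[of c] card_leaves_le[of c k] a0 by simp
    next
      case False
      then show ?thesis using c I.count_done[of c] by simp
    qed
    then show "2 * ends_in c (es @ em) \<le> card (simples c) + 1"
      unfolding ends_in_append using done_em[of c] c by simp
  next
    define f where "f l = wt (tdist par) l y" for l
    \<comment> \<open>Passing from \<open>k\<close> to \<open>y\<close> costs one edge for each of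
      at most two open ends; this is the 2 by which the budget grows.\<close>
    have "f l \<le> wt (tdist par) l k + 1" if "l = a \<or> l = b" for l
      using new[of l] that tdist_par[of l k] k0 y(1) by (cases "l = 0") (simp_all add: f_def wt_def)
    from this[of a] this[of b] have "f a + f b \<le> wt (tdist par) a k + wt (tdist par) b k + 2" by simp
    moreover have "sum_list (map (\<lambda>e. tdist par (fst e) (snd e)) em) = (if em = [] then 0 else f (A y) + f a)"
      using em em_lca climb_lca[of "A y" a y] a0 by (auto simp: f_def wt_def)
    moreover have "f p + f q + (if em = [] then 0 else f (A y) + f a) = f (A y) + f (B y) + f a + f b"
      by (rule sum) (simp add: f_def)
    ultimately show "(\<Sum>e\<leftarrow>es @ em. tdist par (fst e) (snd e)) + pending (tdist par) ?A' ?B' k + wt (tdist par) 0 k + wt (tdist par) 0 k \<le> 2 * (Suc N - k)"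
      using I.total_length k(2) pending_update[OF y0 yk, of "tdist par" A p B q, folded f_def] by simp
  qed
qed

text \<open>The root \<open>k\<close> closes its component. A single open end is continued to
  \<open>k\<close>, which is the rounding up. Two ends from different children are joined through
  \<open>k\<close>. Two ends from the same child are both continued to \<open>k\<close>, since their
  tree path might not reach it; then \<open>k\<close> is simple without being a leaf, and this
  accounts for the additional path.\<close>

lemma inv_finish:
  assumes inv: "Inv N k (Suc k) a b A B M es" and k: "k \<in> X" "par (par k) = 0"
    and a: "a \<in> X" "anc par a k" and b: "b \<noteq> 0 \<Longrightarrow> b \<in> X \<and> anc par b k \<and> \<not> leaf k"
    and split: "M k \<noteq> 0 \<Longrightarrow> b \<noteq> 0 \<Longrightarrow> split_at k a b"
    and em: "em = (if b = 0 then [(a, k)] else if M k \<noteq> 0 then [(a, b)] else [(a, k), (b, k)])"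
  shows "Inv N k k 0 0 A B M (es @ em)"
proof -
  interpret I: greedy_inv par X N k "Suc k" a b A B M es by fact
  have k0: "0 < k" using X_pos k by simp
  have a0: "a \<noteq> 0" using X_pos[OF a(1)] by simp
  have kc: "k = Suc (par k)" using X_root k by simp
  have ch: "\<not> child_of k k y" if "par y \<noteq> 0" for y
    using that k by (auto simp: child_of_def)
  have rt: "root_of par l = par k" if "anc par l k" for l
    using root_of_anc[OF that k0] root_of_par[of k] root_of_top[of "par k"] k X_par[OF k(1)] by simp
  have em_X: "fst e \<in> X \<and> snd e \<in> X \<and> root_of par (fst e) = par k \<and> root_of par (snd e) = par k" if "e \<in> set em" for e
    using that a b k rt[of a] rt[of b] rt[OF anc_refl] by (auto simp: em split: if_splits)
  have em_in: "ends_in c em = (if par k = c then length em else 0)" for c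
    using em_X by (induction em) (auto simp: ends_in_def)
  show ?thesis
  proof (rule invI)
    fix z assume z: "z < k" "A z \<noteq> 0"
    then show "A z \<in> X \<and> (\<exists>c. child_of k c z \<and> anc par (A z) c)"
      using I.A_slot child_of_mono by blast
  next
    fix z assume z: "z < k" "B z \<noteq> 0"
    then show "B z \<in> X \<and> (\<exists>c. child_of k c z \<and> anc par (B z) c)"
      using I.B_slot child_of_mono by blast
  next
    fix z c assume z: "z < k" "par z \<noteq> 0" "A z = 0"
    then show "\<not> child_of k c z" using I.A0_child[of z c] child_of_SucD[of k c z] k(2) by auto
  next
    fix z c1 c2 assume z: "M z = 0" and c: "child_of k c1 z" "child_of k c2 z"
    show "c1 = c2"
    proof (cases "z = par k")
      case True
      have "c = k" if "child_of k c z" for c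
      proof -
        have c: "real_node c" "par c = par k" using that True by (auto simp: child_of_def)
        then have "c \<in> X" using real_even[of c] k(2) by auto
        then show ?thesis using X_root_only[OF k(1) _ k(2)] c by simp
      qed
      then show ?thesis using c by blast
    next
      case False
      then have "child_of (Suc k) c1 z" "child_of (Suc k) c2 z"
        using c child_of_SucD by blast+
      then show ?thesis using I.M0_child[OF z] by blast
    qed
  next
    fix e assume "e \<in> set (es @ em)"
    then show "fst e \<in> X \<and> snd e \<in> X \<and> root_of par (fst e) = root_of par (snd e)"
      using I.emitted_X[of e] em_X[of e] by auto
  next
    fix z assume z: "z \<in> X" "k \<le> z"
    have la: "lca a k k" using lca_anc a by blast
    have "covered em z" if "through a z k"
      using through_climb[OF la that] through_climb[OF split_at_lca[OF split] that]
      by (auto simp: em covered_def)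
    moreover have "covered em z" if t: "through b z k"
    proof -
      have b0: "b \<noteq> 0" using t by (simp add: through_def)
      then have lb: "lca b k k" using lca_anc b by blast
      show ?thesis
        using through_climb[OF lb t] through_climb[OF split_at_lca[OF split[OF _ b0]] t] b0
        by (auto simp: em covered_def)
    qed
    ultimately show "covered (es @ em) z \<or> (\<exists>y<k. 0 < y \<and> (through (A y) z y \<or> through (B y) z y)) \<or> through 0 z k \<or> through 0 z k"
      using I.cover[OF z] unfolding covered_append by blast
  next
    fix c assume "Suc c < k \<or> Suc c = k \<and> (0::nat) \<noteq> 0"
    then have c: "Suc c < k" by simp
    then have "par k \<noteq> c" using kc by simp
    then show "card (leaves c k) = 2 * ends_in c (es @ em) + pending (below c) A B k + wt (below c) 0 k + wt (below c) 0 k"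
      using I.count_open[of c] c rt[OF anc_refl] unfolding ends_in_append em_in
      by (simp add: wt_def below_def)
  next
    fix c assume c: "\<not> (Suc c < k \<or> Suc c = k \<and> (0::nat) \<noteq> 0)"
    show "2 * ends_in c (es @ em) \<le> card (simples c) + 1"
    proof (cases "Suc c = k")
      case False
      then have "par k \<noteq> c" using kc by simp
      then show ?thesis using I.count_done[of c] c False unfolding ends_in_append em_in by simp
    next
      case True
      then have pk: "par k = c" using kc by simp
      have "wt (below c) l k = (if l = 0 then 0 else 1)" for l
        using rt[OF anc_refl] pk by (simp add: wt_def below_def)
      then have L: "2 * ends_in c es + (if b = 0 then 1 else 2) \<le> card (leaves c k)"
        using I.count_open[of c] True a0 by simp
      show ?thesis
      proof (cases "b = 0 \<or> M k \<noteq> 0")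
        case t: True
        then show ?thesis using L card_leaves_le[of c k] pk unfolding ends_in_append em_in
          by (auto simp: em)
      next
        case f: False
        have "simple k"
          unfolding simple_def using I.M0_child[of k] f real_child_greater k(2) by blast
        then have "k \<in> simples c" using k rt[OF anc_refl] pk by (simp add: simples_def)
        moreover have "k \<notin> leaves c k" using b f by (simp add: leaves_def)
        moreover have "leaves c k \<subseteq> simples c" using leaf_simple by (auto simp: leaves_def simples_def)
        \<comment> \<open>Two paths are added for only two open leaf ends, so one simple vertex
          beyond the leaves is required.\<close>
        ultimately have "card (leaves c k) < card (simples c)"
          by (intro psubset_card_mono finite_simples) blast
        then show ?thesis using L f pk unfolding ends_in_append em_in by (simp add: em)
      qed
    qed
  next
    have "tdist par k k = 0" by simp
    have da: "tdist par a b = tdist par a k + tdist par b k" if "M k \<noteq> 0" "b \<noteq> 0"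
      using climb_lca[OF split_at_lca[OF split[OF that]]] by simp
    have "sum_list (map (\<lambda>e. tdist par (fst e) (snd e)) em) = wt (tdist par) a k + wt (tdist par) b k"
      using a0 da by (simp add: em wt_def)
    then show "(\<Sum>e\<leftarrow>es @ em. tdist par (fst e) (snd e)) + pending (tdist par) A B k + wt (tdist par) 0 k + wt (tdist par) 0 k \<le> 2 * (Suc N - k)"
      using I.total_length by simp
  qed ((rule I.A0_B0 I.A0_M0 I.top_slot I.M_split; assumption)+)
qed

lemma inv_init: 
  assumes "X \<subseteq> {..N}" 
  shows "Inv N (Suc N) (Suc N) 0 0 (\<lambda>_. 0) (\<lambda>_. 0) (\<lambda>_. 0) []"
proof -
  have nr: "\<not> child_of (Suc N) c y" for c y
  proof
    assume c: "child_of (Suc N) c y"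
    then have r: "real_node c" "N < c" by (auto simp: child_of_def)
    then have "c \<notin> X" using assms by auto
    then obtain z where z: "z \<in> X" "c = par z" using r by (auto simp: real_node_def)
    then have "c < z" using par_less[of z] X_pos by simp
    then show False using r z assms by auto
  qed
  have L: "leaves c (Suc N) = {}" for c using assms by (auto simp: leaves_def)
  show ?thesis
  proof (rule invI)
    fix z assume "z \<in> X" "Suc N \<le> z"
    then show "covered [] z \<or> (\<exists>y<Suc N. 0 < y \<and> (through 0 z y \<or> through 0 z y)) \<or> through 0 z (Suc N) \<or> through 0 z (Suc N)"
      using assms by auto
  qed (use nr L in \<open>simp_all add: ends_in_def pending_def\<close>)
qed

text \<open>The sweep may stop at 2: vertices have numbers from 2 on, the slot of 1 is empty, and
  every positive \<open>c\<close> is then closed.\<close>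

lemma inv_final:
  assumes "Inv N 2 2 0 0 A B M es"
  shows "\<And>z. z \<in> X \<Longrightarrow> covered es z"
    "\<And>c. 0 < c \<Longrightarrow> 2 * ends_in c es \<le> card (simples c) + 1"
    "\<And>e. e \<in> set es \<Longrightarrow> fst e \<in> X \<and> snd e \<in> X \<and> root_of par (fst e) = root_of par (snd e)"
    "(\<Sum>e\<leftarrow>es. tdist par (fst e) (snd e)) \<le> 2 * N"
proof -
  interpret I: greedy_inv par X N 2 2 0 0 A B M es by fact
  show "covered es z" if z: "z \<in> X" for z
  proof -
    have "par z < z" "par z \<noteq> 0" using par_less X_pos X_par z by auto
    then have "2 \<le> z" by simp
    moreover have "A 1 = 0" "B 1 = 0" using I.top_slot[of 1] I.A0_B0[of 1] par_less[of 1] by simp_all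
    ultimately show ?thesis using I.cover[OF z] by (auto simp: through_def less_2_cases_iff)
  qed
  show "2 * ends_in c es \<le> card (simples c) + 1" if "0 < c" for c
    using I.count_done[of c] that by simp
  show "\<And>e. e \<in> set es \<Longrightarrow> fst e \<in> X \<and> snd e \<in> X \<and> root_of par (fst e) = root_of par (snd e)"
    by (rule I.emitted_X)
  show "(\<Sum>e\<leftarrow>es. tdist par (fst e) (snd e)) \<le> 2 * N" using I.total_length by simp
qed

end

section \<open>Breadth-first search\<close>

locale bfs_graph =
  fixes G :: "nat pair_pre_digraph" and n :: nat
  assumes block_graph: "block_graph (with_proj G)" and verts: "pverts G = {..<n}"
begin

abbreviation "E \<equiv> parcs G"

lemma graph: "graph (with_proj G)"
  using block_graph by (simp add: block_graph_def)

lemma E_sym: "(u, v) \<in> E \<Longrightarrow> (v, u) \<in> E"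
  and E_neq: "(u, v) \<in> E \<Longrightarrow> u \<noteq> v"
  and E_verts: "(u, v) \<in> E \<Longrightarrow> u < n \<and> v < n"
  using graph_with_proj(3,4)[OF graph] verts by auto

text \<open>The path from \<open>a\<close> over \<open>d\<close> to \<open>c\<close> avoids
  \<open>b\<close>, and \<open>a\<close> and \<open>c\<close> are neighbours of
  \<open>b\<close>.\<close>

lemma four_cycle:
  assumes "(a, b) \<in> E" "(b, c) \<in> E" "(c, d) \<in> E" "(d, a) \<in> E" "a \<noteq> c" "b \<noteq> d"
  shows "(a, c) \<in> E"
proof (rule block_graph_neighbours_adj[OF block_graph])
  show "(b, a) \<in> E" "(b, c) \<in> E" "a \<noteq> c" using assms E_sym by simp_all
  let ?R = "{(x, y) \<in> E. x \<in> {a, d, c} \<and> y \<in> {a, d, c}}"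
  have "(a, d) \<in> ?R" "(d, c) \<in> ?R" using assms E_sym by simp_all
  then show "(a, c) \<in> ?R\<^sup>*" by (rule converse_rtrancl_into_rtrancl[OF _ r_into_rtrancl])
  show "a \<in> {a, d, c}" by simp
  show "b \<notin> {a, d, c}" using assms E_neq by auto
qed

text \<open>The numbers of the vertices whose scan has already met \<open>v\<close>. The vertex with
  number \<open>t\<close> is being scanned and has met exactly the vertices in
  \<open>S\<close>.\<close>

definition touchers :: "(nat \<Rightarrow> nat) \<Rightarrow> nat \<Rightarrow> nat set \<Rightarrow> nat \<Rightarrow> nat set" where
  "touchers num t S v = num ` {u. (u, v) \<in> E \<and> 0 < num u \<and> num u < t} \<union> (if v \<in> S then {t} else {})"

end

text \<open>
  The vertices are numbered 3, 5, 7, ... in the order of their discovery; the vertices with number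
  less than \<open>t\<close> have been scanned, and the neighbours in \<open>S\<close> of the vertex with number \<open>t\<close>.
  The entry \<open>par (i - 1)\<close> is the number of the first scanned neighbour of the vertex \<open>i\<close>, and
  \<open>par i + 1\<close> the number of the second one, or \<open>i\<close> itself. The second neighbour and \<open>i\<close> are
  in the same block.
\<close>

locale bfs_inv = bfs_graph G n for G n +
  fixes num vtx par :: "nat \<Rightarrow> nat" and nx t \<tau> :: nat and S :: "nat set"
  assumes odd_nx: "odd nx" and odd_t: "odd t" and t_ge: "3 \<le> t" and t_le: "t \<le> nx"
    and num: "num v \<noteq> 0 \<Longrightarrow> v < n \<and> odd (num v) \<and> 3 \<le> num v \<and> num v < nx \<and> vtx (num v) = Suc v"
    and num_onto: "odd i \<Longrightarrow> 3 \<le> i \<Longrightarrow> i < nx \<Longrightarrow> \<exists>v. num v = i"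
    and vtx: "vtx i \<noteq> 0 \<Longrightarrow> num (vtx i - 1) = i \<and> i \<noteq> 0"
    and scanned: "num u \<noteq> 0 \<Longrightarrow> num u < t \<Longrightarrow> (u, v) \<in> E \<Longrightarrow> num v \<noteq> 0"
    and scanned_S: "v \<in> S \<Longrightarrow> num v \<noteq> 0"
    and root_cut: "num v \<noteq> 0 \<Longrightarrow> par (num v - 1) = 0 \<Longrightarrow> (x, y) \<in> E \<Longrightarrow> num x \<noteq> 0 \<Longrightarrow> num x < num v \<Longrightarrow>
      num y \<noteq> 0 \<and> num y < num v"
    and gate: "num v \<noteq> 0 \<Longrightarrow> par (num v - 1) \<noteq> 0 \<Longrightarrow>
      par (num v - 1) \<in> touchers num t S v \<and> par (num v - 1) < num v \<and> (\<forall>m\<in>touchers num t S v. par (num v - 1) \<le> m)"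
    and no_rep: "num v \<noteq> 0 \<Longrightarrow> par (num v) = 0 \<Longrightarrow>
      \<tau> \<le> num v \<and> (\<forall>m\<in>touchers num t S v. m = par (num v - 1))"
    and rep: "num v \<noteq> 0 \<Longrightarrow> par (num v) \<noteq> 0 \<Longrightarrow>
      \<exists>m. par (num v) = m - 1 \<and> m \<noteq> par (num v - 1) \<and> (m \<in> touchers num t S v \<or> m = num v \<and> num v < \<tau>) \<and>
        m \<le> num v \<and> (\<forall>m'\<in>touchers num t S v. m' \<noteq> par (num v - 1) \<longrightarrow> m \<le> m')"
    and par_range: "par x \<noteq> 0 \<Longrightarrow> 2 \<le> x \<and> x + 1 < nx"

context bfs_graph
begin

text \<open>The parameter \<tau> marks which vertices may be their own second neighbour: those with
  smaller numbers have begun their own scan. It equals \<open>t\<close> between scans and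
  \<open>t + 1\<close> during the scan of \<open>t\<close>. The clause \<open>root_cut\<close>
  records that a root is chosen only when the queue is empty, so the vertices numbered before it are
  closed under adjacency.\<close>

abbreviation "Bfs \<equiv> bfs_inv G n"

lemmas BfsI = bfs_inv.intro[OF bfs_graph_axioms bfs_inv_axioms.intro]

lemma bfs_init: "Bfs (\<lambda>_. 0) (\<lambda>_. 0) (\<lambda>_. 0) 3 3 3 {}"
  by (rule BfsI) simp_all

end

section \<open>Preservation of the search invariant\<close>

context bfs_inv
begin

lemma num_inj:
  assumes "num u = num v" "num u \<noteq> 0"
  shows "u = v"
proof -
  have a: "vtx (num u) = Suc u" using num[OF assms(2)] by blast
  have b: "vtx (num u) = Suc v" unfolding assms(1) using num[of v, folded assms(1), OF assms(2)] assms(1) by metis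
  have "Suc u = Suc v" using trans[OF sym[OF a] b] .
  then show ?thesis by (rule Suc_inject)
qed

lemma touchers_bound:
  assumes "m \<in> touchers num t S v"
  shows "odd m \<and> 3 \<le> m \<and> (m < t \<or> m = t \<and> v \<in> S)"
proof -
  have "m \<in> num ` {u. (u, v) \<in> E \<and> 0 < num u \<and> num u < t} \<or> m = t \<and> v \<in> S"
    using assms unfolding touchers_def by (cases "v \<in> S") (simp_all, blast)
  then show ?thesis
  proof
    assume "m \<in> num ` {u. (u, v) \<in> E \<and> 0 < num u \<and> num u < t}"
    then obtain u where u: "m = num u" "num u \<noteq> 0" "num u < t" by blast
    note nu = num[OF u(2)]
    have "odd m" unfolding u(1) by (rule conjunct1[OF conjunct2[OF nu]])
    moreover have "3 \<le> m" unfolding u(1) by (rule conjunct1[OF conjunct2[OF conjunct2[OF nu]]])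
    moreover have "m < t" unfolding u(1) by (rule u(3))
    ultimately show ?thesis by (intro conjI disjI1)
  next
    assume "m = t \<and> v \<in> S"
    then show ?thesis using odd_t t_ge by (intro conjI) simp_all
  qed
qed

lemma undiscovered:
  assumes "num v = 0"
  shows "touchers num t S v = {}"
proof -
  have "\<not> ((u, v) \<in> E \<and> 0 < num u \<and> num u < t)" for u
    using scanned[of u v] assms by (intro notI) simp
  then have "{u. (u, v) \<in> E \<and> 0 < num u \<and> num u < t} = {}" by blast
  moreover have "v \<notin> S" using scanned_S assms by blast
  ultimately show ?thesis unfolding touchers_def by simp
qed

text \<open>Vertex numbers and \<open>nx\<close> are odd, so neither the fresh number
  \<open>nx\<close> nor its block \<open>nx - 1\<close> collides with an entry in use.\<close>

lemma new_slot:
  assumes "num v \<noteq> 0"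
  shows "num v \<noteq> nx" "num v - 1 \<noteq> nx - 1" "num v \<noteq> nx - 1" "num v - 1 \<noteq> nx"
proof -
  have "odd (num v)" "num v < nx" "3 \<le> num v" using num assms by simp_all
  then show "num v \<noteq> nx" "num v - 1 \<noteq> nx - 1" "num v \<noteq> nx - 1" "num v - 1 \<noteq> nx"
    using odd_nx by (auto elim!: oddE)
qed

text \<open>A fresh number is at least \<open>t\<close>, so its vertex does not count as
  scanned.\<close>

lemma touchers_discover:
  assumes "num w = 0"
  shows "touchers (num(w := nx)) t U v = touchers num t U v"
proof -
  have "{u. (u, v) \<in> E \<and> 0 < (num(w := nx)) u \<and> (num(w := nx)) u < t} = {u. (u, v) \<in> E \<and> 0 < num u \<and> num u < t}"
    using assms t_le by auto
  moreover have "(num(w := nx)) ` {u. (u, v) \<in> E \<and> 0 < num u \<and> num u < t} = num ` {u. (u, v) \<in> E \<and> 0 < num u \<and> num u < t}"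
    using assms by (intro image_cong) auto
  ultimately show ?thesis unfolding touchers_def by (simp only:)
qed

lemma even_num: "num v \<noteq> 0 \<Longrightarrow> even (num v - 1)"
  using num[of v] by simp

text \<open>Serves both ways of finding a vertex: as a new root when the queue is empty, with
  \<open>p = 0\<close>, and as a neighbour of the vertex being scanned, with \<open>p = t\<close>.
  Only the gate entry at \<open>nx - 1\<close> is set; the entry at \<open>nx\<close> remains 0 for
  the time being.\<close>

lemma discover:
  assumes w: "num w = 0" "w < n" and tau: "\<tau> \<le> nx"
    and p: "p = 0 \<and> t = nx \<and> S' = S \<or> p = t \<and> t < nx \<and> S' = insert w S"
  shows "Bfs (num(w := nx)) (vtx(nx := Suc w)) (par(nx - 1 := p)) (nx + 2) t \<tau> S'"
proof -
  let ?num = "num(w := nx)" and ?par = "par(nx - 1 := p)" and ?vtx = "vtx(nx := Suc w)"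
  have nx3: "3 \<le> nx" using t_ge t_le by simp
  have T: "touchers ?num t S' v = (if v = w then (if p = 0 then {} else {t}) else touchers num t S v)" for v
  proof (cases "v = w")
    case True
    have "touchers num t {} w = {}" using undiscovered[OF w(1)] by (simp add: touchers_def)
    moreover have "touchers ?num t S' w = touchers num t {} w \<union> (if p = 0 then {} else {t})"
      using p scanned_S[of w] w(1) t_ge touchers_discover[OF w(1), of "{}" w] by (auto simp: touchers_def)
    ultimately show ?thesis using True by simp
  next
    case False
    then have "v \<in> S' \<longleftrightarrow> v \<in> S" using p by auto
    then have "touchers num t S' v = touchers num t S v" by (simp add: touchers_def)
    then show ?thesis using False touchers_discover[OF w(1)] by simp
  qed
  have P: "?par (num v - 1) = par (num v - 1)" "?par (num v) = par (num v)" if "num v \<noteq> 0" for v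
    using new_slot[OF that] by simp_all
  have Pn: "?par nx = 0" "par nx = 0" using par_range[of nx] nx3 by auto
  show ?thesis
  proof (rule BfsI)
    show "odd (nx + 2)" "odd t" "3 \<le> t" "t \<le> nx + 2" using odd_nx odd_t t_ge t_le by simp_all
  next
    fix v assume "?num v \<noteq> 0"
    then show "v < n \<and> odd (?num v) \<and> 3 \<le> ?num v \<and> ?num v < nx + 2 \<and>
        ?vtx (?num v) = Suc v"
      using num[of v] new_slot[of v] w nx3 odd_nx by (cases "v = w") simp_all
  next
    fix i assume i: "odd i" "3 \<le> i" "i < nx + 2"
    show "\<exists>v. ?num v = i"
    proof (cases "i = nx")
      case True
      then show ?thesis by (intro exI[of _ w]) simp
    next
      case False
      then have "i < nx" using i odd_nx by (cases "i = nx + 1") auto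
      then obtain v where "num v = i" using num_onto i by blast
      then show ?thesis using w i by (intro exI[of _ v]) auto
    qed
  next
    fix i assume "?vtx i \<noteq> 0"
    then show "?num (?vtx i - 1) = i \<and> i \<noteq> 0"
      using vtx[of i] w nx3 by (cases "i = nx") auto
  next
    fix u v assume "?num u \<noteq> 0" "?num u < t" "(u, v) \<in> E"
    then show "?num v \<noteq> 0" using scanned[of u v] t_le nx3 by (cases "u = w"; cases "v = w") simp_all
  next
    fix v assume "v \<in> S'"
    then show "?num v \<noteq> 0" using p scanned_S[of v] nx3 by (cases "v = w") auto
  next
    fix v x y assume v: "?num v \<noteq> 0" "?par (?num v - 1) = 0"
      and xy: "(x, y) \<in> E" "?num x \<noteq> 0" "?num x < ?num v"
    show "?num y \<noteq> 0 \<and> ?num y < ?num v"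
    proof (cases "v = w")
      case True
      then have "p = 0" using v by simp
      \<comment> \<open>An empty queue means that all numbered vertices are scanned, so no edge
        leads from them to an unnumbered vertex.\<close>
      then have "t = nx" using p t_ge by simp
      moreover have "x \<noteq> w" using xy True by auto
      ultimately have "num y \<noteq> 0" using scanned[of x y] xy True by simp
      then show ?thesis using num[of y] w True by auto
    next
      case False
      then have nv: "num v \<noteq> 0" "par (num v - 1) = 0" using v P(1)[of v] by auto
      have "x \<noteq> w" using xy num[OF nv(1)] False by auto
      then have "num y \<noteq> 0 \<and> num y < num v" using root_cut[OF nv xy(1)] xy False by simp
      then show ?thesis using False w by auto
    qed
  next
    fix v assume v: "?num v \<noteq> 0" "?par (?num v - 1) \<noteq> 0"
    show "?par (?num v - 1) \<in> touchers ?num t S' v \<and>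
      ?par (?num v - 1) < ?num v \<and>
      (\<forall>m\<in>touchers ?num t S' v. ?par (?num v - 1) \<le> m)"
      unfolding T using v gate[of v] P(1)[of v] p by (cases "v = w") auto
  next
    fix v assume v: "?num v \<noteq> 0" "?par (?num v) = 0"
    show "\<tau> \<le> ?num v \<and> (\<forall>m\<in>touchers ?num t S' v. m = ?par (?num v - 1))"
      unfolding T using v no_rep[of v] P[of v] p tau by (cases "v = w") auto
  next
    fix v assume v: "?num v \<noteq> 0" "?par (?num v) \<noteq> 0"
    have vw: "v \<noteq> w"
    proof
      assume "v = w"
      then show False using v(2) Pn(1) by (simp only: fun_upd_same)
    qed
    have e: "?num v = num v" using vw by simp
    have nv: "num v \<noteq> 0" using v(1) unfolding e .
    show "\<exists>m. ?par (?num v) = m - 1 \<and> m \<noteq> ?par (?num v - 1) \<and>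
       (m \<in> touchers ?num t S' v \<or> m = ?num v \<and> ?num v < \<tau>) \<and> m \<le> ?num v \<and>
       (\<forall>m'\<in>touchers ?num t S' v. m' \<noteq> ?par (?num v - 1) \<longrightarrow> m \<le> m')"
      unfolding T e P[OF nv] if_not_P[OF vw] by (rule rep[OF nv v(2)[unfolded e P(2)[OF nv]]])
  next
    fix x assume "?par x \<noteq> 0"
    then show "2 \<le> x \<and> x + 1 < nx + 2"
      using par_range[of x] nx3 by (cases "x = nx - 1") auto
  qed
qed

text \<open>A vertex whose own entry is still 0 when its scan begins has been met by its gate at
  most. So it is the first vertex found in its block and becomes its own representative.\<close>

lemma begin_scan:
  assumes u: "num u = t" and S: "S = {}" and tau: "\<tau> = t"
  shows "Bfs num vtx (if par t = 0 then par(t := t - 1) else par) nx t (t + 1) {}"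
proof -
  let ?par = "if par t = 0 then par(t := t - 1) else par"
  have nu: "num u \<noteq> 0" using u t_ge by simp
  have P: "?par (num v - 1) = par (num v - 1)" if "num v \<noteq> 0" for v
    using even_num[OF that] odd_t by auto
  have Pt: "?par t \<noteq> 0" using t_ge by simp
  have P': "?par (num v) = par (num v)" if "v \<noteq> u" for v
    using that num_inj[of v u] u t_ge by auto
  have tnx: "t < nx" using num[OF nu] u by simp
  show ?thesis
  proof (rule BfsI)
    show "odd nx" "odd t" "3 \<le> t" "t \<le> nx" by (rule odd_nx odd_t t_ge t_le)+
    show "\<And>v. num v \<noteq> 0 \<Longrightarrow> v < n \<and> odd (num v) \<and> 3 \<le> num v \<and> num v < nx \<and> vtx (num v) = Suc v" by (rule num)
    show "\<And>i. odd i \<Longrightarrow> 3 \<le> i \<Longrightarrow> i < nx \<Longrightarrow> \<exists>v. num v = i" by (rule num_onto)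
    show "\<And>i. vtx i \<noteq> 0 \<Longrightarrow> num (vtx i - 1) = i \<and> i \<noteq> 0" by (rule vtx)
    show "\<And>u v. num u \<noteq> 0 \<Longrightarrow> num u < t \<Longrightarrow> (u, v) \<in> E \<Longrightarrow> num v \<noteq> 0" by (rule scanned)
    show "\<And>v. v \<in> {} \<Longrightarrow> num v \<noteq> 0" by simp
  next
    fix v x y assume "num v \<noteq> 0" "?par (num v - 1) = 0" "(x, y) \<in> E" "num x \<noteq> 0" "num x < num v"
    then show "num y \<noteq> 0 \<and> num y < num v" using root_cut[of v x y] P by simp
  next
    fix v assume v: "num v \<noteq> 0" "?par (num v - 1) \<noteq> 0"
    then have "par (num v - 1) \<noteq> 0" using P by simp
    from gate[OF v(1) this] show "?par (num v - 1) \<in> touchers num t {} v \<and> ?par (num v - 1) < num v \<and> (\<forall>m\<in>touchers num t {} v. ?par (num v - 1) \<le> m)"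
      unfolding P[OF v(1)] using S by simp
  next
    fix v assume v: "num v \<noteq> 0" "?par (num v) = 0"
    then have vu: "v \<noteq> u" using Pt u by auto
    have "par (num v) = 0" using v(2) unfolding P'[OF vu] .
    from no_rep[OF v(1) this] have "t \<le> num v" "\<forall>m\<in>touchers num t {} v. m = par (num v - 1)" using S tau by simp_all
    moreover have "num v \<noteq> t" using vu num_inj[of v u] u v by auto
    ultimately show "t + 1 \<le> num v \<and> (\<forall>m\<in>touchers num t {} v. m = ?par (num v - 1))" unfolding P[OF v(1)] by simp
  next
    fix v assume v: "num v \<noteq> 0" "?par (num v) \<noteq> 0"
    show "\<exists>m. ?par (num v) = m - 1 \<and> m \<noteq> ?par (num v - 1) \<and>
      (m \<in> touchers num t {} v \<or> m = num v \<and> num v < t + 1) \<and> m \<le> num v \<and>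
      (\<forall>m'\<in>touchers num t {} v. m' \<noteq> ?par (num v - 1) \<longrightarrow> m \<le> m')"
    proof (cases "v = u \<and> par t = 0")
      case True
      then have n: "par (num v) = 0" using u by simp
      have "par (t - 1) \<noteq> t" using gate[OF nu] u t_ge by (cases "par (t - 1) = 0") auto
      then show ?thesis using no_rep[OF v(1) n] True u S unfolding P[OF v(1)]
        by (intro exI[of _ t]) auto
    next
      case False
      then have eq: "?par (num v) = par (num v)" using P'[of v] u by (cases "v = u") simp_all
      then have "par (num v) \<noteq> 0" using v by simp
      from rep[OF v(1) this] obtain m where m: "par (num v) = m - 1" "m \<noteq> par (num v - 1)"
        "m \<in> touchers num t S v \<or> m = num v \<and> num v < \<tau>" "m \<le> num v"
        "\<forall>m'\<in>touchers num t S v. m' \<noteq> par (num v - 1) \<longrightarrow> m \<le> m'" by (elim exE conjE)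
      then show ?thesis unfolding P[OF v(1)] eq using S tau by (intro exI[of _ m]) auto
    qed
  next
    fix x assume "?par x \<noteq> 0"
    then show "2 \<le> x \<and> x + 1 < nx"
      using par_range[of x] odd_nx odd_t tnx t_ge by (cases "x = t") (auto elim!: oddE split: if_splits)
  qed
qed

text \<open>A further meeting matters only while the entry at \<open>num w\<close> is 0: then no
  vertex other than the gate has met \<open>w\<close> before. An entry that is already set stays
  least, because scans come in increasing order of numbers.\<close>

lemma scan_old:
  assumes u: "num u = t" "(u, w) \<in> E" "w \<notin> S" and w: "num w \<noteq> 0" and tau: "\<tau> = t + 1"
  shows "Bfs num vtx (if par (num w) = 0 then par(num w := t - 1) else par) nx t \<tau> (insert w S)"
proof -
  let ?par = "if par (num w) = 0 then par(num w := t - 1) else par"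
  have P: "?par (num v - 1) = par (num v - 1)" if "num v \<noteq> 0" for v
  proof -
    have "even (num v - 1)" "odd (num w)" using even_num[OF that] num[OF w] by blast+
    then have "num v - 1 \<noteq> num w" by metis
    then show ?thesis by simp
  qed
  have Pw: "?par (num w) \<noteq> 0" using t_ge by simp
  have P': "?par (num v) = par (num v)" if "v \<noteq> w" for v
    using that num_inj[of w v] w by auto
  have tw: "t \<notin> touchers num t S w" using touchers_bound[of t w] u by auto
  have T: "touchers num t (insert w S) v = (if v = w then insert t (touchers num t S w) else touchers num t S v)" for v
    by (auto simp: touchers_def)
  show ?thesis
  proof (rule BfsI)
    show "odd nx" "odd t" "3 \<le> t" "t \<le> nx" by (rule odd_nx odd_t t_ge t_le)+
    show "\<And>v. num v \<noteq> 0 \<Longrightarrow> v < n \<and> odd (num v) \<and> 3 \<le> num v \<and> num v < nx \<and> vtx (num v) = Suc v" by (rule num)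
    show "\<And>i. odd i \<Longrightarrow> 3 \<le> i \<Longrightarrow> i < nx \<Longrightarrow> \<exists>v. num v = i" by (rule num_onto)
    show "\<And>i. vtx i \<noteq> 0 \<Longrightarrow> num (vtx i - 1) = i \<and> i \<noteq> 0" by (rule vtx)
    show "\<And>u v. num u \<noteq> 0 \<Longrightarrow> num u < t \<Longrightarrow> (u, v) \<in> E \<Longrightarrow> num v \<noteq> 0" by (rule scanned)
    show "\<And>v. v \<in> insert w S \<Longrightarrow> num v \<noteq> 0" using scanned_S w by blast
  next
    fix v x y assume "num v \<noteq> 0" "?par (num v - 1) = 0" "(x, y) \<in> E" "num x \<noteq> 0" "num x < num v"
    then show "num y \<noteq> 0 \<and> num y < num v" using root_cut[of v x y] P by simp
  next
    fix v assume v: "num v \<noteq> 0" "?par (num v - 1) \<noteq> 0"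
    then have "par (num v - 1) \<noteq> 0" using P by simp
    note g = gate[OF v(1) this]
    moreover have "par (num v - 1) \<le> t" using g touchers_bound[of "par (num v - 1)" v] by auto
    ultimately show "?par (num v - 1) \<in> touchers num t (insert w S) v \<and> ?par (num v - 1) < num v \<and> (\<forall>m\<in>touchers num t (insert w S) v. ?par (num v - 1) \<le> m)"
      unfolding P[OF v(1)] T by (cases "v = w") simp_all
  next
    fix v assume v: "num v \<noteq> 0" "?par (num v) = 0"
    then have vw: "v \<noteq> w" using Pw by auto
    have "par (num v) = 0" using v(2) unfolding P'[OF vw] .
    from no_rep[OF v(1) this] show "\<tau> \<le> num v \<and> (\<forall>m\<in>touchers num t (insert w S) v. m = ?par (num v - 1))"
      unfolding P[OF v(1)] T using vw by simp
  next
    fix v assume v: "num v \<noteq> 0" "?par (num v) \<noteq> 0"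
    show "\<exists>m. ?par (num v) = m - 1 \<and> m \<noteq> ?par (num v - 1) \<and>
      (m \<in> touchers num t (insert w S) v \<or> m = num v \<and> num v < \<tau>) \<and> m \<le> num v \<and>
      (\<forall>m'\<in>touchers num t (insert w S) v. m' \<noteq> ?par (num v - 1) \<longrightarrow> m \<le> m')"
    proof (cases "v = w \<and> par (num w) = 0")
      case True
      then have n: "par (num v) = 0" by simp
      note r = no_rep[OF v(1) n]
      have "par (num v - 1) \<noteq> t" using gate[OF v(1)] tw True t_ge by (cases "par (num v - 1) = 0") auto
      then show ?thesis using r True tau unfolding P[OF v(1)] T
        by (intro exI[of _ t]) auto
    next
      case False
      then have eq: "?par (num v) = par (num v)" using P'[of v] by (cases "v = w") simp_all
      then have "par (num v) \<noteq> 0" using v by simp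
      from rep[OF v(1) this] obtain m where m: "par (num v) = m - 1" "m \<noteq> par (num v - 1)"
        "m \<in> touchers num t S v \<or> m = num v \<and> num v < \<tau>" "m \<le> num v"
        "\<forall>m'\<in>touchers num t S v. m' \<noteq> par (num v - 1) \<longrightarrow> m \<le> m'" by (elim exE conjE)
      have "m \<le> t" using m(3) touchers_bound[of m v] tau by auto
      then show ?thesis unfolding P[OF v(1)] eq T using m by (intro exI[of _ m]) auto
    qed
  next
    fix x assume x: "?par x \<noteq> 0"
    have "num w + 1 < nx" using num[OF w] odd_nx by (auto elim!: oddE)
    then show "2 \<le> x \<and> x + 1 < nx"
      using x par_range[of x] num[OF w] by (cases "x = num w") (auto split: if_splits)
  qed
qed

lemma end_scan:
  assumes u: "num u = t" and S: "S = {v. (u, v) \<in> E}" and tau: "\<tau> = t + 1"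
  shows "Bfs num vtx par nx (t + 2) (t + 2) {}"
proof -
  have nu: "num u \<noteq> 0" using u t_ge by simp
  have lt: "num v < t + 2 \<longleftrightarrow> num v < t \<or> v = u" if "num v \<noteq> 0" for v
  proof -
    have "odd (num v)" using num[OF that] by simp
    then have "num v < t + 2 \<longleftrightarrow> num v < t \<or> num v = t" using odd_t by presburger
    then show ?thesis using num_inj[of v u] that u by auto
  qed
  have T: "touchers num (t + 2) {} v = touchers num t S v" for v
    using lt u nu S by (auto simp: touchers_def)
  show ?thesis
  proof (rule BfsI, unfold T)
    show "odd nx" "odd (t + 2)" "3 \<le> t + 2" using odd_nx odd_t t_ge by simp_all
    show "t + 2 \<le> nx" using num[OF nu] u odd_nx by (auto elim!: oddE)
    show "\<And>v. num v \<noteq> 0 \<Longrightarrow> v < n \<and> odd (num v) \<and> 3 \<le> num v \<and> num v < nx \<and> vtx (num v) = Suc v" by (rule num)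
    show "\<And>i. odd i \<Longrightarrow> 3 \<le> i \<Longrightarrow> i < nx \<Longrightarrow> \<exists>v. num v = i" by (rule num_onto)
    show "\<And>i. vtx i \<noteq> 0 \<Longrightarrow> num (vtx i - 1) = i \<and> i \<noteq> 0" by (rule vtx)
    show "num v \<noteq> 0" if "num x \<noteq> 0" "num x < t + 2" "(x, v) \<in> E" for x v
      using that lt[of x] scanned[of x v] scanned_S[of v] S by auto
    show "\<And>v. v \<in> {} \<Longrightarrow> num v \<noteq> 0" by simp
  next
    fix v assume v: "num v \<noteq> 0" "par (num v) = 0"
    note r = no_rep[OF this]
    show "t + 2 \<le> num v \<and> (\<forall>m\<in>touchers num t S v. m = par (num v - 1))"
    proof (intro conjI)
      have "odd (num v)" "t + 1 \<le> num v" using num[OF v(1)] r tau by simp_all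
      then show "t + 2 \<le> num v" using odd_t by presburger
      show "\<forall>m\<in>touchers num t S v. m = par (num v - 1)" using r by blast
    qed
  next
    fix v assume v: "num v \<noteq> 0" "par (num v) \<noteq> 0"
    from rep[OF this] obtain m where m: "par (num v) = m - 1" "m \<noteq> par (num v - 1)"
        "m \<in> touchers num t S v \<or> m = num v \<and> num v < \<tau>" "m \<le> num v"
        "\<forall>m'\<in>touchers num t S v. m' \<noteq> par (num v - 1) \<longrightarrow> m \<le> m'" by (elim exE conjE)
    then show "\<exists>m. par (num v) = m - 1 \<and> m \<noteq> par (num v - 1) \<and>
      (m \<in> touchers num t S v \<or> m = num v \<and> num v < t + 2) \<and> m \<le> num v \<and>
      (\<forall>m'\<in>touchers num t S v. m' \<noteq> par (num v - 1) \<longrightarrow> m \<le> m')" using tau by (intro exI[of _ m]) auto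
  qed ((rule root_cut gate par_range; assumption)+)
qed

end

section \<open>The block tree found by a completed search\<close>

locale bfs_done = bfs_inv G n num vtx par nx nx nx "{}" for G n num vtx par nx +
  assumes all_found: "v < n \<Longrightarrow> num v \<noteq> 0"
begin

lemma E_num: "(u, v) \<in> E \<Longrightarrow> num u \<noteq> 0 \<and> num v \<noteq> 0"
  using E_verts all_found by blast

lemma touchers_done: "touchers num nx {} v = num ` {u. (u, v) \<in> E}"
proof -
  have "{u. (u, v) \<in> E \<and> 0 < num u \<and> num u < nx} = {u. (u, v) \<in> E}"
    using E_num num by blast
  then show ?thesis by (simp add: touchers_def)
qed

lemma num_odd: "v < n \<Longrightarrow> odd (num v)" and num_ge: "v < n \<Longrightarrow> 3 \<le> num v"
  and num_less: "v < n \<Longrightarrow> num v < nx"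
  using num[OF all_found] by blast+

lemma num_eq: "u < n \<Longrightarrow> num u = num v \<Longrightarrow> u = v"
  using num_inj all_found by blast

lemma gateE:
  assumes "v < n" "par (num v - 1) \<noteq> 0"
  obtains p where "(p, v) \<in> E" "num p = par (num v - 1)" "num p < num v"
    "\<And>u. (u, v) \<in> E \<Longrightarrow> num p \<le> num u"
proof -
  note g = gate[OF all_found[OF assms(1)] assms(2), unfolded touchers_done]
  then obtain p where "(p, v) \<in> E" "par (num v - 1) = num p" by blast
  then show ?thesis using that[of p] g by simp
qed

text \<open>The representative \<open>w\<close> has the least number among \<open>v\<close> and its
  neighbours other than the gate. It exists because every vertex has begun its own scan, which
  leaves no entry 0.\<close>

lemma repE:
  assumes "v < n"
  obtains w where "w < n" "par (num v) = num w - 1" "num w \<noteq> par (num v - 1)" "w = v \<or> (w, v) \<in> E"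
    "num w \<le> num v" "\<And>u. (u, v) \<in> E \<Longrightarrow> num u \<noteq> par (num v - 1) \<Longrightarrow> num w \<le> num u"
proof -
  note nv = all_found[OF assms]
  have "par (num v) \<noteq> 0"
  proof
    assume "par (num v) = 0"
    then have "nx \<le> num v" using no_rep[OF nv] by blast
    then show False using num_less[OF assms] by simp
  qed
  from rep[OF nv this, unfolded touchers_done] obtain m where m: "par (num v) = m - 1" "m \<noteq> par (num v - 1)"
    "m \<in> num ` {u. (u, v) \<in> E} \<or> m = num v" "m \<le> num v" "\<forall>m'\<in>num ` {u. (u, v) \<in> E}. m' \<noteq> par (num v - 1) \<longrightarrow> m \<le> m'"
    by blast
  have "\<exists>w. m = num w \<and> (w = v \<or> (w, v) \<in> E)" using m(3) by blast
  then obtain w where w: "m = num w" "w = v \<or> (w, v) \<in> E" by blast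
  have "w < n" using w(2) assms E_verts by blast
  then show ?thesis using that[of w] m w by simp
qed

lemma earlier_nonroot:
  assumes "(u, v) \<in> E" "num u < num v"
  shows "par (num v - 1) \<noteq> 0"
  using root_cut[of v u v] E_num[OF assms(1)] assms by (intro notI) simp

abbreviation "E_on W \<equiv> {(x, y) \<in> E. x \<in> W \<and> y \<in> W}"

text \<open>Passing from gate to gate leads to a root through smaller and smaller numbers.\<close>

lemma root_path:
  "v < n \<Longrightarrow> \<exists>r<n. par (num r - 1) = 0 \<and> num r \<le> num v \<and> (v, r) \<in> (E_on {y. num y \<le> num v})\<^sup>*"
proof (induction "num v" arbitrary: v rule: less_induct)
  case less
  show ?case
  proof (cases "par (num v - 1) = 0")
    case True
    then show ?thesis using less.prems by (intro exI[of _ v]) simp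
  next
    case False
    then obtain p where p: "(p, v) \<in> E" "num p < num v" using gateE less.prems by blast
    then obtain r where r: "r < n" "par (num r - 1) = 0" "num r \<le> num p" "(p, r) \<in> (E_on {y. num y \<le> num p})\<^sup>*"
      using less.hyps[of p] E_verts by blast
    have "(E_on {y. num y \<le> num p})\<^sup>* \<subseteq> (E_on {y. num y \<le> num v})\<^sup>*"
      using p(2) by (intro rtrancl_mono) auto
    then have "(p, r) \<in> (E_on {y. num y \<le> num v})\<^sup>*" using r(4) by (rule subsetD)
    moreover have "(v, p) \<in> E_on {y. num y \<le> num v}" using p E_sym by simp
    ultimately have "(v, r) \<in> (E_on {y. num y \<le> num v})\<^sup>*" by (rule converse_rtrancl_into_rtrancl[rotated])
    then show ?thesis using r p(2) by (intro exI[of _ r]) simp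
  qed
qed

lemma path_below_root:
  assumes "(x, y) \<in> (E_on W)\<^sup>*" "r < n" "par (num r - 1) = 0" "num x < num r"
  shows "num y < num r"
  using assms(1)
proof (induction rule: rtrancl_induct)
  case base
  then show ?case by (rule assms(4))
next
  case (step y z)
  then have e: "(y, z) \<in> E" by simp
  then show ?case using root_cut[OF all_found[OF assms(2)] assms(3) e] E_num[OF e] step.IH by blast
qed

text \<open>Both neighbours reach roots through numbers below that of \<open>v\<close>. The roots
  coincide: otherwise the neighbour belonging to the smaller root would come before the other root
  and, by \<open>root_cut\<close>, so would \<open>v\<close>. Hence a path from \<open>a\<close> to
  \<open>b\<close> avoids \<open>v\<close>.\<close>

lemma earlier_neighbours_adj:
  assumes e: "(a, v) \<in> E" "(b, v) \<in> E" and less: "num a < num v" "num b < num v" and "a \<noteq> b"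
  shows "(a, b) \<in> E"
proof -
  let ?R = "E_on {y. num y < num v}"
  have sym: "sym ?R" using E_sym by (intro symI) simp
  have reach: "\<exists>r<n. par (num r - 1) = 0 \<and> num r \<le> num x \<and> (x, r) \<in> ?R\<^sup>*" if "(x, v) \<in> E" "num x < num v" for x
  proof -
    have x: "x < n" using E_verts[OF that(1)] by blast
    obtain r where r: "r < n" "par (num r - 1) = 0" "num r \<le> num x" "(x, r) \<in> (E_on {y. num y \<le> num x})\<^sup>*"
      using root_path[OF x] by blast
    have "(E_on {y. num y \<le> num x})\<^sup>* \<subseteq> ?R\<^sup>*" using that(2) by (intro rtrancl_mono) auto
    then have "(x, r) \<in> ?R\<^sup>*" using r(4) by (rule subsetD)
    then show ?thesis using r by blast
  qed
  obtain ra where ra: "ra < n" "par (num ra - 1) = 0" "num ra \<le> num a" "(a, ra) \<in> ?R\<^sup>*" using reach[OF e(1) less(1)] by blast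
  obtain rb where rb: "rb < n" "par (num rb - 1) = 0" "num rb \<le> num b" "(b, rb) \<in> ?R\<^sup>*" using reach[OF e(2) less(2)] by blast
  note ra' = symD[OF sym_rtrancl[OF sym] ra(4)] and rb' = symD[OF sym_rtrancl[OF sym] rb(4)]
  have cut: "\<not> num r < num s"
    if "(r, x) \<in> ?R\<^sup>*" "(x, v) \<in> E" "s < n" "par (num s - 1) = 0" "num s \<le> num v" for r s x
  proof
    assume "num r < num s"
    then have "num x < num s" using path_below_root[OF that(1,3,4)] by blast
    then have "num v < num s" using root_cut[OF all_found[OF that(3)] that(4,2)] E_num[OF that(2)] by blast
    then show False using that(5) by simp
  qed
  have "num ra = num rb"
    using cut[OF ra' e(1) rb(1,2)] cut[OF rb' e(2) ra(1,2)] ra(3) rb(3) less by simp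
  then have "ra = rb" by (rule num_eq[OF ra(1)])
  then have path: "(a, b) \<in> ?R\<^sup>*" using rtrancl_trans[OF ra(4)] rb' by blast
  show ?thesis
    by (rule block_graph_neighbours_adj[OF block_graph E_sym[OF e(1)] E_sym[OF e(2)] assms(5) path])
      (simp_all add: less)
qed

text \<open>\<open>w\<close> and the gate \<open>p\<close> of \<open>v\<close> are earlier
  neighbours of \<open>v\<close>, hence adjacent. A gate \<open>q\<close> of \<open>w\<close> before
  \<open>p\<close> would be adjacent to \<open>p\<close> and close the 4-cycle \<open>v\<close>,
  \<open>p\<close>, \<open>q\<close>, \<open>w\<close>; then \<open>v\<close> would have a neighbour
  before its gate.\<close>

lemma gate_common:
  assumes e: "(w, v) \<in> E" and less: "num w < num v" and ne: "num w \<noteq> par (num v - 1)"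
  shows "par (num w - 1) = par (num v - 1)" "\<exists>p. (p, v) \<in> E \<and> (p, w) \<in> E \<and> num p = par (num v - 1) \<and> num p < num w"
proof -
  have v: "v < n" "w < n" using E_verts[OF e] by blast+
  obtain p where p: "(p, v) \<in> E" "num p = par (num v - 1)" "num p < num v" "\<And>u. (u, v) \<in> E \<Longrightarrow> num p \<le> num u"
    using gateE[OF v(1) earlier_nonroot[OF e less]] by blast
  have pw: "p \<noteq> w" using p(2) ne by blast
  have npw: "num p < num w" using p(4)[OF e] p(2) ne by simp
  have epw: "(p, w) \<in> E" using earlier_neighbours_adj[OF p(1) e p(3) less pw] .
  then show "\<exists>p. (p, v) \<in> E \<and> (p, w) \<in> E \<and> num p = par (num v - 1) \<and> num p < num w"
    using p npw by blast
  obtain q where q: "(q, w) \<in> E" "num q = par (num w - 1)" "num q < num w" "\<And>u. (u, w) \<in> E \<Longrightarrow> num q \<le> num u"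
    using gateE[OF v(2) earlier_nonroot[OF epw npw]] by blast
  have "\<not> num q < num p"
  proof
    assume lt: "num q < num p"
    then have qp: "q \<noteq> p" by blast
    have eqp: "(q, p) \<in> E" using earlier_neighbours_adj[OF q(1) epw q(3) npw qp] .
    have "(v, q) \<in> E"
    proof (rule four_cycle)
      show "(v, p) \<in> E" "(p, q) \<in> E" "(q, w) \<in> E" "(w, v) \<in> E" using p q e eqp E_sym by simp_all
      show "v \<noteq> q" using q(3) less by auto
      show "p \<noteq> w" by (rule pw)
    qed
    then show False using p(4)[OF E_sym] lt by fastforce
  qed
  then show "par (num w - 1) = par (num v - 1)" using q(4)[OF epw] p(2) q(2) by simp
qed

text \<open>The representatives \<open>x\<close> of \<open>v\<close> and \<open>y\<close> of
  \<open>w\<close> are compared in both directions by minimality. If they are not \<open>v\<close>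
  or \<open>w\<close> themselves, \<open>x\<close> is adjacent to \<open>w\<close> as another
  earlier neighbour of \<open>v\<close>, and \<open>y\<close> is adjacent to \<open>v\<close> by a
  4-cycle through the common gate.\<close>

lemma rep_common:
  assumes e: "(w, v) \<in> E" and less: "num w < num v" and ne: "num w \<noteq> par (num v - 1)"
  shows "par (num w) = par (num v)"
proof -
  have v: "v < n" "w < n" using E_verts[OF e] by blast+
  note g = gate_common(1)[OF e less ne]
  obtain p where p: "(p, v) \<in> E" "(p, w) \<in> E" "num p = par (num v - 1)" "num p < num w"
    using gate_common(2)[OF e less ne] by blast
  obtain x where x: "x < n" "par (num v) = num x - 1" "num x \<noteq> par (num v - 1)" "x = v \<or> (x, v) \<in> E"
    "num x \<le> num v" "\<And>u. (u, v) \<in> E \<Longrightarrow> num u \<noteq> par (num v - 1) \<Longrightarrow> num x \<le> num u"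
    using repE[OF v(1)] by blast
  obtain y where y: "y < n" "par (num w) = num y - 1" "num y \<noteq> par (num w - 1)" "y = w \<or> (y, w) \<in> E"
    "num y \<le> num w" "\<And>u. (u, w) \<in> E \<Longrightarrow> num u \<noteq> par (num w - 1) \<Longrightarrow> num y \<le> num u"
    using repE[OF v(2)] by blast
  have xw: "num x \<le> num w" using x(6)[OF e ne] .
  have "num y \<le> num x"
  proof (cases "x = w")
    case True
    then show ?thesis using y(5) by simp
  next
    case False
    have "x \<noteq> v" using xw less by auto
    then have ex: "(x, v) \<in> E" using x(4) by blast
    have "(x, w) \<in> E" using earlier_neighbours_adj[OF ex e _ less False] xw less by simp
    then show ?thesis using y(6) x(3) g by simp
  qed
  moreover have "num x \<le> num y"
  proof (cases "y = w")
    case True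
    then show ?thesis using xw by simp
  next
    case False
    then have ey: "(y, w) \<in> E" using y(4) by blast
    have "num y \<noteq> num w" using num_eq[OF y(1)] False by blast
    then have lt: "num y < num w" using y(5) by simp
    have yp: "y \<noteq> p" using y(3) p(3) g by auto
    have yp_e: "(y, p) \<in> E" using earlier_neighbours_adj[OF ey p(2) lt p(4) yp] .
    have "(v, y) \<in> E"
    proof (rule four_cycle)
      show "(v, p) \<in> E" "(y, w) \<in> E" "(w, v) \<in> E" using p e ey E_sym by simp_all
      show "(p, y) \<in> E" using E_sym[OF yp_e] .
      show "v \<noteq> y" using lt less by auto
      show "p \<noteq> w" using p(4) by auto
    qed
    then show ?thesis using x(6)[OF E_sym] y(3) g by simp
  qed
  ultimately show ?thesis using x(2) y(2) by simp
qed

lemma rep_gate: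
  assumes "v < n" "w < n" "par (num v) = num w - 1" "w = v \<or> (w, v) \<in> E" "num w \<noteq> par (num v - 1)" "num w \<le> num v"
  shows "par (par (num v)) = par (num v - 1)"
proof (cases "w = v")
  case True
  then show ?thesis using assms by simp
next
  case False
  then have e: "(w, v) \<in> E" using assms by blast
  have "num w \<noteq> num v" using num_eq[OF assms(2)] False by blast
  then have "num w < num v" using assms(6) by simp
  then show ?thesis using gate_common(1)[OF e _ assms(5)] assms(3) by simp
qed

text \<open>Ties the odd and the even entries together: the block in which \<open>v\<close> hangs
  has the gate of \<open>v\<close> as its parent, although that block need not be numbered
  \<open>num v - 1\<close>.\<close>

lemma par_par: "v < n \<Longrightarrow> par (par (num v)) = par (num v - 1)"
  using repE rep_gate by metis

lemma num_pred_inj: "u < n \<Longrightarrow> v < n \<Longrightarrow> num u - 1 = num v - 1 \<Longrightarrow> u = v"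
  using num_eq[of u v] num_ge[of u] num_ge[of v] by simp

lemma root_rep:
  assumes v: "v < n" and root: "par (num v - 1) = 0"
  shows "par (num v) = num v - 1"
proof -
  obtain w where w: "w < n" "par (num v) = num w - 1" "w = v \<or> (w, v) \<in> E" "num w \<le> num v"
    using repE[OF v] by blast
  have "w = v"
  proof (rule ccontr)
    assume "w \<noteq> v"
    then have "(w, v) \<in> E" "num w \<noteq> num v" using w num_eq[OF w(1)] by blast+
    then show False using earlier_nonroot[of w v] w(4) root by simp
  qed
  then show ?thesis using w by simp
qed

lemma E_tadj:
  assumes e: "(u, v) \<in> E" and less: "num u < num v"
  shows "tadj par (num u) (num v)"
proof (cases "num u = par (num v - 1)")
  case True
  then show ?thesis using par_par[of v] E_verts[OF e] less by (simp add: tadj_def)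
next
  case False
  then show ?thesis using rep_common[OF e less] less by (simp add: tadj_def)
qed

lemma gate_E: "v < n \<Longrightarrow> u < n \<Longrightarrow> par (num v - 1) = num u \<Longrightarrow> (u, v) \<in> E"
  using gateE[of v] all_found[of u] num_eq[of u] by metis

text \<open>Unless one of them is the common representative, both vertices are adjacent to it and to
  the common gate. This gives a 4-cycle in which \<open>u\<close> and \<open>v\<close> are
  opposite.\<close>

lemma same_block_E:
  assumes uv: "u < n" "v < n" "u \<noteq> v" and eq: "par (num u) = par (num v)"
  shows "(u, v) \<in> E"
proof -
  obtain x where x: "x < n" "par (num u) = num x - 1" "num x \<noteq> par (num u - 1)" "x = u \<or> (x, u) \<in> E" "num x \<le> num u"
    using repE[OF uv(1)] by blast
  obtain y where y: "y < n" "par (num v) = num y - 1" "num y \<noteq> par (num v - 1)" "y = v \<or> (y, v) \<in> E" "num y \<le> num v"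
    using repE[OF uv(2)] by blast
  have xy: "x = y" using num_pred_inj[OF x(1) y(1)] x(2) y(2) eq by simp
  consider "x = u" | "x = v" | "x \<noteq> u" "x \<noteq> v" by blast
  then show ?thesis
  proof cases
    case 1
    then show ?thesis using y(4) xy uv(3) by blast
  next
    case 2
    then show ?thesis using x(4) xy uv(3) E_sym by blast
  next
    case 3
    then have e: "(x, u) \<in> E" "(x, v) \<in> E" using x(4) y(4) xy by blast+
    have "num x \<noteq> num u" "num x \<noteq> num v" using num_eq[OF x(1)] 3 by blast+
    then have less: "num x < num u" "num x < num v" using x(5) y(5) xy by simp_all
    obtain p where p: "(p, u) \<in> E" "(p, x) \<in> E" "num p = par (num u - 1)" "num p < num x"
      using gate_common(2)[OF e(1) less(1) x(3)] by blast
    obtain q where q: "(q, v) \<in> E" "(q, x) \<in> E" "num q = par (num v - 1)"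
      using gate_common(2)[OF e(2) less(2)] y(3) xy by blast
    have "num p = num q"
      using gate_common(1)[OF e(1) less(1) x(3)] gate_common(1)[OF e(2) less(2)] y(3) xy p(3) q(3) by simp
    then have "p = q" using num_eq[of p q] E_verts[OF p(1)] by blast
    show ?thesis
    proof (rule four_cycle)
      show "(u, p) \<in> E" "(p, v) \<in> E" "(v, x) \<in> E" "(x, u) \<in> E" using p q e \<open>p = q\<close> E_sym by simp_all
      show "u \<noteq> v" by (rule uv(3))
      show "p \<noteq> x" using p(4) by auto
    qed
  qed
qed

lemma par_cases:
  assumes "par x \<noteq> 0"
  obtains v where "v < n" "x = num v" | v where "v < n" "x = num v - 1" "even x"
proof -
  have x: "2 \<le> x" "x + 1 < nx" using par_range[OF assms] by simp_all
  show ?thesis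
  proof (cases "odd x")
    case True
    then have "3 \<le> x" using x(1) by (cases "x = 2") simp_all
    then obtain v where v: "num v = x" using num_onto[of x] x True by auto
    then have "v < n" using num[of v] x by simp
    then show ?thesis using that(1)[of v] v by simp
  next
    case False
    then obtain v where v: "num v = x + 1" using num_onto[of "x + 1"] x by auto
    then have "v < n" using num[of v] x by simp
    then show ?thesis using that(2)[of v] v False by simp
  qed
qed

lemma block_tree_graph: "block_tree_graph par (num ` {..<n}) G num (\<lambda>i. vtx i - 1)"
proof unfold_locales
  show p0: "par 0 = 0" using par_range[of 0] by auto
  show "par x < x" if "0 < x" for x
  proof (cases "par x = 0")
    case False
    then show ?thesis
    proof (cases x rule: par_cases)
      case (1 v)
      obtain w where w: "w < n" "par (num v) = num w - 1" "num w \<le> num v" using repE[OF 1(1)] by blast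
      then show ?thesis using 1 num_ge[OF w(1)] by simp
    next
      case (2 v)
      obtain p where p: "(p, v) \<in> E" "num p = par (num v - 1)" "num p < num v" using gateE[of v] 2 False by blast
      have "odd (num p)" using num_odd E_verts[OF p(1)] by blast
      then have "num p \<noteq> x" using 2(3) by blast
      then show ?thesis using p 2 by simp
    qed
  qed (use that in simp)
  show "even (par x)" if x: "odd x" for x
  proof (cases "par x = 0")
    case False
    then show ?thesis
    proof (cases x rule: par_cases)
      case (1 v)
      obtain w where w: "w < n" "par (num v) = num w - 1" using repE[OF 1(1)] by blast
      then show ?thesis using 1 num_odd[OF w(1)] by simp
    qed (use x in blast)
  qed simp
  show "par x = 0 \<or> odd (par x)" if x: "even x" for x
  proof (cases "par x = 0")
    case False
    then show ?thesis
    proof (cases x rule: par_cases)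
      case (1 v)
      then show ?thesis using x num_odd by blast
    next
      case (2 v)
      obtain p where p: "(p, v) \<in> E" "num p = par (num v - 1)" using gateE[of v] 2 False by blast
      then show ?thesis using 2 num_odd E_verts[OF p(1)] by metis
    qed
  qed simp
  show "finite (num ` {..<n})" by simp
  show "odd x" if "x \<in> num ` {..<n}" for x using that num_odd by blast
  show pX: "par x \<noteq> 0" if xX: "x \<in> num ` {..<n}" for x
  proof -
    obtain v where v: "v < n" "x = num v" using xX by blast
    obtain w where w: "w < n" "par (num v) = num w - 1" using repE[OF v(1)] by blast
    then show ?thesis using num_ge[OF w(1)] v by simp
  qed
  show "par (par x) = 0 \<or> par (par x) \<in> num ` {..<n}" if xX: "x \<in> num ` {..<n}" for x
  proof -
    obtain v where v: "v < n" "x = num v" using xX by blast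
    show ?thesis
    proof (cases "par (num v - 1) = 0")
      case False
      then obtain p where p: "(p, v) \<in> E" "num p = par (num v - 1)" using gateE[OF v(1)] by blast
      then show ?thesis using par_par[OF v(1)] v E_verts[OF p(1)] by (metis image_eqI lessThan_iff)
    qed (simp add: par_par[OF v(1)] v)
  qed
  show root: "x = Suc (par x)" if xX: "x \<in> num ` {..<n}" "par (par x) = 0" for x
  proof -
    obtain v where v: "v < n" "x = num v" using xX(1) by blast
    then have "par (num v - 1) = 0" using par_par[OF v(1)] xX(2) by simp
    then show ?thesis using root_rep[OF v(1)] v num_ge[OF v(1)] by simp
  qed
  show "z = x" if "x \<in> num ` {..<n}" "z \<in> num ` {..<n}" "par (par x) = 0" "par z = par x" for x z
    using root[OF that(1,3)] root[OF that(2)] that(3,4) by simp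
  show "num ` pverts G = num ` {..<n}" by (simp add: verts)
  show "vtx (num v) - 1 = v" if "v \<in> pverts G" for v
    using num[OF all_found[of v]] that by (simp add: verts)
  show "finite (pverts G)" by (simp add: verts)
  show "(u, v) \<in> E \<longleftrightarrow> u \<in> pverts G \<and> v \<in> pverts G \<and> tadj par (num u) (num v)" for u v
  proof
    assume e: "(u, v) \<in> E"
    have uv: "u < n" "v < n" using E_verts[OF e] by blast+
    have "num u \<noteq> num v" using num_eq[OF uv(1)] E_neq[OF e] by blast
    then have "tadj par (num u) (num v) \<or> tadj par (num v) (num u)"
      using E_tadj[OF e] E_tadj[OF E_sym[OF e]] by (meson linorder_neqE_nat)
    then have "tadj par (num u) (num v)" unfolding tadj_def by metis
    then show "u \<in> pverts G \<and> v \<in> pverts G \<and> tadj par (num u) (num v)" using uv by (simp add: verts)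
  next
    assume a: "u \<in> pverts G \<and> v \<in> pverts G \<and> tadj par (num u) (num v)"
    then have uv: "u < n" "v < n" and t: "tadj par (num u) (num v)" by (simp_all add: verts)
    have ne: "u \<noteq> v" using t by (auto simp: tadj_def)
    consider "par (num u) = par (num v)" | "par (num u - 1) = num v" | "par (num v - 1) = num u"
      using t par_par[OF uv(1)] par_par[OF uv(2)] unfolding tadj_def by metis
    then show "(u, v) \<in> E"
    proof cases
      case 1
      then show ?thesis using same_block_E uv ne by blast
    next
      case 2
      then show ?thesis using gate_E[OF uv] E_sym by blast
    next
      case 3
      then show ?thesis using gate_E[OF uv(2,1)] by blast
    qed
  qed
qed

text \<open>The odd numbers from 3 up to below \<open>nx\<close> are counted twice, as the images of
  the \<open>n\<close> vertices and by an explicit enumeration. This fixes the linear range of the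
  later sweep.\<close>

lemma card_nx: "nx = 2 * n + 3"
proof -
  have "bij_betw num {..<n} {i. odd i \<and> 3 \<le> i \<and> i < nx}"
  proof (rule bij_betw_imageI)
    show "inj_on num {..<n}" using num_eq by (intro inj_onI) simp
    show "num ` {..<n} = {i. odd i \<and> 3 \<le> i \<and> i < nx}"
    proof
      show "num ` {..<n} \<subseteq> {i. odd i \<and> 3 \<le> i \<and> i < nx}" using num_odd num_ge num_less by blast
      show "{i. odd i \<and> 3 \<le> i \<and> i < nx} \<subseteq> num ` {..<n}"
      proof
        fix i assume "i \<in> {i. odd i \<and> 3 \<le> i \<and> i < nx}"
        then have i: "odd i" "3 \<le> i" "i < nx" by simp_all
        then obtain v where v: "num v = i" using num_onto by blast
        then have "v < n" using num[of v] i(2) by simp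
        then show "i \<in> num ` {..<n}" using v by blast
      qed
    qed
  qed
  then have "card {i. odd i \<and> 3 \<le> i \<and> i < nx} = n" using bij_betw_same_card by fastforce
  moreover obtain k where k: "nx = 2 * k + 3"
  proof -
    obtain l where l: "nx = 2 * l + 1" using odd_nx by (auto elim: oddE)
    then have "nx = 2 * (l - 1) + 3" using t_ge by simp
    then show ?thesis using that by blast
  qed
  have "bij_betw (\<lambda>j. 2 * j + 3) {..<k} {i. odd i \<and> 3 \<le> i \<and> i < nx}"
  proof (rule bij_betw_imageI)
    show "inj_on (\<lambda>j. 2 * j + 3) {..<k}" by (intro inj_onI) simp
    show "(\<lambda>j. 2 * j + 3) ` {..<k} = {i. odd i \<and> 3 \<le> i \<and> i < nx}"
    proof
      show "(\<lambda>j. 2 * j + 3) ` {..<k} \<subseteq> {i. odd i \<and> 3 \<le> i \<and> i < nx}" using k by auto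
      show "{i. odd i \<and> 3 \<le> i \<and> i < nx} \<subseteq> (\<lambda>j. 2 * j + 3) ` {..<k}"
      proof
        fix i assume "i \<in> {i. odd i \<and> 3 \<le> i \<and> i < nx}"
        then have i: "odd i" "3 \<le> i" "i < nx" by simp_all
        then obtain l where "i = 2 * l + 1" by (auto elim: oddE)
        then have "i = 2 * (l - 1) + 3" "l - 1 < k" using i k by simp_all
        then show "i \<in> (\<lambda>j. 2 * j + 3) ` {..<k}" by blast
      qed
    qed
  qed
  then have "card {i. odd i \<and> 3 \<le> i \<and> i < nx} = k" using bij_betw_same_card by fastforce
  ultimately show ?thesis using k by simp
qed

end

section \<open>A while language for the random access machine\<close>

datatype exp = Num nat | Var nat | Plus exp exp | Minus exp exp | Arr nat exp

datatype com =
    Assign nat exp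
  | Update nat exp exp
  | Input nat
  | Output exp
  | Seq com com (infixr \<open>;;\<close> 60)
  | Ite exp com com
  | While exp com

text \<open>The field \<open>tick\<close> is a ghost clock.\<close>

record state =
  var :: "nat \<Rightarrow> nat"
  arr :: "nat \<Rightarrow> nat \<Rightarrow> nat"
  tape :: "nat list"
  printed :: "nat list"
  tick :: nat

fun val :: "exp \<Rightarrow> state \<Rightarrow> nat" where
  "val (Num n) s = n"
| "val (Var x) s = var s x"
| "val (Plus e f) s = val e s + val f s"
| "val (Minus e f) s = val e s - val f s"
| "val (Arr a e) s = arr s a (val e s)"

inductive exec :: "com \<Rightarrow> state \<Rightarrow> state \<Rightarrow> bool" where
  exec_Assign: "exec (Assign x e) s (s\<lparr>var := (var s)(x := val e s), tick := tick s + 1\<rparr>)"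
| exec_Update: "exec (Update a e f) s (s\<lparr>arr := (arr s)(a := (arr s a)(val e s := val f s)), tick := tick s + 1\<rparr>)"
| exec_Input: "exec (Input x) s (s\<lparr>var := (var s)(x := (case tape s of [] \<Rightarrow> 0 | y # _ \<Rightarrow> y)), tape := tl (tape s), tick := tick s + 1\<rparr>)"
| exec_Output: "exec (Output e) s (s\<lparr>printed := printed s @ [val e s], tick := tick s + 1\<rparr>)"
| exec_Seq: "exec c s s' \<Longrightarrow> exec d s' s'' \<Longrightarrow> exec (c ;; d) s s''"
| exec_Ite: "exec (if 0 < val e s then c else d) (s\<lparr>tick := tick s + 1\<rparr>) s' \<Longrightarrow> exec (Ite e c d) s s'"
| exec_While_end: "val e s = 0 \<Longrightarrow> exec (While e c) s (s\<lparr>tick := tick s + 1\<rparr>)"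
| exec_While_step: "0 < val e s \<Longrightarrow> exec c (s\<lparr>tick := tick s + 1\<rparr>) s' \<Longrightarrow> exec (While e c) s' s'' \<Longrightarrow> exec (While e c) s s''"

definition wp :: "com \<Rightarrow> (state \<Rightarrow> bool) \<Rightarrow> state \<Rightarrow> bool" where
  "wp c Q s \<longleftrightarrow> (\<exists>s'. exec c s s' \<and> Q s')"

inductive_simps exec_iff:
  "exec (Assign x e) s s'" "exec (Update a e f) s s'" "exec (Input x) s s'" "exec (Output e) s s'"
  "exec (c ;; d) s s'" "exec (Ite e c d) s s'"

lemma wp_simps[simp]:
  "wp (Assign x e) Q s \<longleftrightarrow> Q (s\<lparr>var := (var s)(x := val e s), tick := tick s + 1\<rparr>)"
  "wp (Update a e f) Q s \<longleftrightarrow> Q (s\<lparr>arr := (arr s)(a := (arr s a)(val e s := val f s)), tick := tick s + 1\<rparr>)"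
  "wp (Input x) Q s \<longleftrightarrow> Q (s\<lparr>var := (var s)(x := (case tape s of [] \<Rightarrow> 0 | y # _ \<Rightarrow> y)), tape := tl (tape s), tick := tick s + 1\<rparr>)"
  "wp (Output e) Q s \<longleftrightarrow> Q (s\<lparr>printed := printed s @ [val e s], tick := tick s + 1\<rparr>)"
  "wp (c ;; d) Q s \<longleftrightarrow> wp c (wp d Q) s"
  "wp (Ite e c d) Q s \<longleftrightarrow> wp (if 0 < val e s then c else d) Q (s\<lparr>tick := tick s + 1\<rparr>)"
  unfolding wp_def exec_iff by - (simp, simp, simp, simp, blast, simp)

lemma wp_mono: "wp c Q s \<Longrightarrow> (\<And>s. Q s \<Longrightarrow> R s) \<Longrightarrow> wp c R s"
  unfolding wp_def by blast

text \<open>The measure yields termination, which \<open>wp\<close> includes since it asserts that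
  an execution exists.\<close>

lemma wp_While:
  fixes \<mu> :: "state \<Rightarrow> nat"
  assumes "I s"
    and step: "\<And>s. I s \<Longrightarrow> 0 < val e s \<Longrightarrow> wp c (\<lambda>s'. I s' \<and> \<mu> s' < \<mu> s) (s\<lparr>tick := tick s + 1\<rparr>)"
    and exit: "\<And>s. I s \<Longrightarrow> val e s = 0 \<Longrightarrow> Q (s\<lparr>tick := tick s + 1\<rparr>)"
  shows "wp (While e c) Q s"
  using assms(1)
proof (induction "\<mu> s" arbitrary: s rule: less_induct)
  case less
  show ?case
  proof (cases "val e s = 0")
    case True
    then show ?thesis using exit[OF less.prems] unfolding wp_def by (blast intro: exec_While_end)
  next
    case False
    then obtain s' where s': "exec c (s\<lparr>tick := tick s + 1\<rparr>) s'" "I s'" "\<mu> s' < \<mu> s"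
      using step[OF less.prems] unfolding wp_def by auto
    obtain s'' where "exec (While e c) s' s''" "Q s''"
      using less.hyps[OF s'(3,2)] unfolding wp_def by blast
    then show ?thesis using exec_While_step[of e s c s' s''] s'(1) False unfolding wp_def by blast
  qed
qed

subsection \<open>Compilation\<close>

text \<open>
  Variables live in registers 0 to 15, expressions are evaluated on a stack in registers 16 to 31,
  and the entry \<open>i\<close> of the array \<open>a\<close> is in register \<open>32 * (i + 1) + a\<close>.
\<close>

fun comp_exp :: "nat \<Rightarrow> exp \<Rightarrow> instr list" where
  "comp_exp d (Num n) = [Const (16 + d) n]"
| "comp_exp d (Var x) = [Const (16 + d) 0, Add (16 + d) x (16 + d)]"
| "comp_exp d (Plus e f) = comp_exp d e @ comp_exp (d + 1) f @ [Add (16 + d) (16 + d) (17 + d)]"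
| "comp_exp d (Minus e f) = comp_exp d e @ comp_exp (d + 1) f @ [Sub (16 + d) (16 + d) (17 + d)]"
| "comp_exp d (Arr a e) = comp_exp d e @ replicate 5 (Add (16 + d) (16 + d) (16 + d)) @
     [Const (17 + d) (32 + a), Add (16 + d) (16 + d) (17 + d), Load (16 + d) (16 + d)]"

text \<open>The number of stack registers used. An array access needs at least two, the second one
  for the base address.\<close>

fun depth :: "exp \<Rightarrow> nat" where
  "depth (Num n) = 1"
| "depth (Var x) = 1"
| "depth (Plus e f) = max (depth e) (depth f + 1)"
| "depth (Minus e f) = max (depth e) (depth f + 1)"
| "depth (Arr a e) = max 2 (depth e)"

fun wf_exp :: "exp \<Rightarrow> bool" where
  "wf_exp (Num n) = True"
| "wf_exp (Var x) = (x < 16)"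
| "wf_exp (Plus e f) = (wf_exp e \<and> wf_exp f)"
| "wf_exp (Minus e f) = (wf_exp e \<and> wf_exp f)"
| "wf_exp (Arr a e) = (a < 32 \<and> wf_exp e)"

fun code_size :: "com \<Rightarrow> nat" where
  "code_size (Assign x e) = length (comp_exp 0 e) + 2"
| "code_size (Update a e f) = length (comp_exp 0 e) + 7 + length (comp_exp 1 f) + 1"
| "code_size (Input x) = 1"
| "code_size (Output e) = length (comp_exp 0 e) + 1"
| "code_size (c ;; d) = code_size c + code_size d"
| "code_size (Ite e c d) = length (comp_exp 0 e) + 3 + code_size c + code_size d"
| "code_size (While e c) = length (comp_exp 0 e) + 5 + code_size c"

text \<open>The machine has no move and no unconditional jump: copying is addition of 0, and
  \<open>JumpPos\<close> follows a constant 1. Since the jump is taken on a positive value, the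
  second branch of \<open>Ite\<close> is placed before the first one. In \<open>Update\<close> the
  address stays in register 16 while the value is computed from register 17 on.\<close>

fun compile :: "nat \<Rightarrow> com \<Rightarrow> instr list" where
  "compile p (Assign x e) = comp_exp 0 e @ [Const 17 0, Add x 16 17]"
| "compile p (Update a e f) = comp_exp 0 e @ replicate 5 (Add 16 16 16) @ [Const 17 (32 + a), Add 16 16 17] @
     comp_exp 1 f @ [Store 16 17]"
| "compile p (Input x) = [Read x]"
| "compile p (Output e) = comp_exp 0 e @ [Print 16]"
| "compile p (c ;; d) = compile p c @ compile (p + code_size c) d"
| "compile p (Ite e c d) = (let q = p + length (comp_exp 0 e) in
     comp_exp 0 e @ [JumpPos 16 (q + 3 + code_size d)] @ compile (q + 1) d @
     [Const 16 1, JumpPos 16 (q + 3 + code_size d + code_size c)] @ compile (q + 3 + code_size d) c)"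
| "compile p (While e c) = (let q = p + length (comp_exp 0 e) in
     comp_exp 0 e @ [JumpPos 16 (q + 3), Const 16 1, JumpPos 16 (q + 5 + code_size c)] @
     compile (q + 3) c @ [Const 16 1, JumpPos 16 p])"

fun wf_com :: "com \<Rightarrow> bool" where
  "wf_com (Assign x e) = (x < 16 \<and> wf_exp e \<and> depth e \<le> 15)"
| "wf_com (Update a e f) = (a < 32 \<and> wf_exp e \<and> wf_exp f \<and> depth e \<le> 15 \<and> depth f \<le> 15)"
| "wf_com (Input x) = (x < 16)"
| "wf_com (Output e) = (wf_exp e \<and> depth e \<le> 15)"
| "wf_com (c ;; d) = (wf_com c \<and> wf_com d)"
| "wf_com (Ite e c d) = (wf_exp e \<and> depth e \<le> 15 \<and> wf_com c \<and> wf_com d)"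
| "wf_com (While e c) = (wf_exp e \<and> depth e \<le> 15 \<and> wf_com c)"

lemma length_compile: "length (compile p c) = code_size c"
  by (induction c arbitrary: p) (simp_all add: Let_def)

fun no_jump :: "instr \<Rightarrow> bool" where
  "no_jump (JumpPos i l) = False"
| "no_jump _ = True"

lemma no_jump_comp_exp: "i \<in> set (comp_exp d e) \<Longrightarrow> no_jump i"
  by (induction e arbitrary: d) auto

definition code_at :: "instr list \<Rightarrow> nat \<Rightarrow> instr list \<Rightarrow> bool" where
  "code_at P p c \<longleftrightarrow> (\<exists>P1 P2. P = P1 @ c @ P2 \<and> length P1 = p)"

lemma code_at_append: "code_at P p (c @ d) \<longleftrightarrow> code_at P p c \<and> code_at P (p + length c) d" 
proof
  assume "code_at P p (c @ d)"
  then obtain P1 P2 where P: "P = P1 @ (c @ d) @ P2" "length P1 = p" by (auto simp: code_at_def)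
  then have "P = P1 @ c @ (d @ P2)" "P = (P1 @ c) @ d @ P2" "length (P1 @ c) = p + length c" by simp_all
  then show "code_at P p c \<and> code_at P (p + length c) d" unfolding code_at_def using P(2) by blast
next
  assume "code_at P p c \<and> code_at P (p + length c) d"
  then obtain P1 P2 P3 P4 where P: "P = P1 @ c @ P2" "length P1 = p" "P = P3 @ d @ P4" "length P3 = p + length c"
    unfolding code_at_def by blast
  then have "P1 @ c = P3" by (metis append_assoc append_eq_append_conv length_append)
  then have "P = P1 @ (c @ d) @ P4" using P(3) by simp
  then show "code_at P p (c @ d)" using P(2) unfolding code_at_def by blast
qed

lemma code_at_Cons: "code_at P p (i # c) \<longleftrightarrow> p < length P \<and> P ! p = i \<and> code_at P (p + 1) c"
proof -
  have "code_at P p [i]" if "p < length P" "P ! p = i"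
  proof -
    have "P = take p P @ [i] @ drop (Suc p) P" "length (take p P) = p"
      using that id_take_nth_drop[of p P] by simp_all
    then show ?thesis unfolding code_at_def by blast
  qed
  moreover have "p < length P \<and> P ! p = i" if "code_at P p [i]"
    using that by (auto simp: code_at_def)
  ultimately have "code_at P p [i] \<longleftrightarrow> p < length P \<and> P ! p = i" by blast
  then show ?thesis using code_at_append[of P p "[i]" c] by simp
qed

section \<open>Simulation of the while language by the machine\<close>

definition steps :: "instr list \<Rightarrow> nat \<Rightarrow> ram_state \<Rightarrow> ram_state \<Rightarrow> bool" where
  "steps P t s s' \<longleftrightarrow> (ram_step P ^^ t) s = s'"

lemma steps_trans: "steps P t s s' \<Longrightarrow> steps P u s' s'' \<Longrightarrow> steps P (t + u) s s''"
  unfolding steps_def by (subst add.commute) (simp add: funpow_add)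

lemma steps_0: "steps P 0 s s"
  by (simp add: steps_def)

lemma steps_1: "pc s < length P \<Longrightarrow> P ! pc s = i \<Longrightarrow> steps P 1 s (ram_instr i s)"
  by (simp add: steps_def ram_step_def)

lemma pc_no_jump: "no_jump i \<Longrightarrow> pc (ram_instr i s) = pc s + 1"
  by (cases i) simp_all

lemma steps_straight:
  "code_at P (pc s) c \<Longrightarrow> (\<And>i. i \<in> set c \<Longrightarrow> no_jump i) \<Longrightarrow> steps P (length c) s (fold ram_instr c s)"
proof (induction c arbitrary: s)
  case Nil
  then show ?case by (simp add: steps_0)
next
  case (Cons i c)
  have "steps P 1 s (ram_instr i s)"
    using Cons.prems by (intro steps_1) (simp_all add: code_at_Cons)
  moreover have "steps P (length c) (ram_instr i s) (fold ram_instr c (ram_instr i s))"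
    using Cons.prems pc_no_jump[of i s] by (intro Cons.IH) (simp_all add: code_at_Cons)
  ultimately show ?case using steps_trans by fastforce
qed

definition sim :: "(nat \<Rightarrow> nat) \<Rightarrow> state \<Rightarrow> bool" where
  "sim m s \<longleftrightarrow> (\<forall>x<16. m x = var s x) \<and> (\<forall>a<32. \<forall>i. m (32 * Suc i + a) = arr s a i)"

text \<open>Evaluation on a stack that begins at register \<open>r\<close> may change only the
  registers from \<open>r\<close> to 31.\<close>

definition agree :: "nat \<Rightarrow> (nat \<Rightarrow> nat) \<Rightarrow> (nat \<Rightarrow> nat) \<Rightarrow> bool" where
  "agree r m m' \<longleftrightarrow> (\<forall>x. x < r \<or> 32 \<le> x \<longrightarrow> m' x = m x)"

lemma sim_agree: "sim m s \<Longrightarrow> agree r m m' \<Longrightarrow> 16 \<le> r \<Longrightarrow> sim m' s"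
  by (auto simp: sim_def agree_def)

lemma fold_double:
  "(ram_instr (Add r r r) ^^ n) s = s\<lparr>pc := pc s + n, mem := (mem s)(r := 2 ^ n * mem s r)\<rparr>"
proof (induction n)
  case 0
  show ?case by (rule ram_state.equality) simp_all
next
  case (Suc n)
  show ?case
    by (simp only: funpow.simps comp_apply Suc) (intro ram_state.equality; simp add: fun_eq_iff)
qed

lemma comp_exp_correct:
  assumes "sim (mem s) st" "wf_exp e" "d + depth e \<le> 16"
  shows "\<exists>m. fold ram_instr (comp_exp d e) s = s\<lparr>pc := pc s + length (comp_exp d e), mem := m\<rparr> \<and>
    m (16 + d) = val e st \<and> agree (16 + d) (mem s) m"
  using assms
proof (induction e arbitrary: d s)
  case (Num n)
  then show ?case by (auto simp: agree_def)
next
  case (Var x)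
  then show ?case by (auto simp: agree_def sim_def)
next
  case (Plus e f)
  have dp: "d + depth e \<le> 16" "d + 1 + depth f \<le> 16" using Plus.prems(3) by (auto simp: max_def split: if_splits)
  obtain m where m: "fold ram_instr (comp_exp d e) s = s\<lparr>pc := pc s + length (comp_exp d e), mem := m\<rparr>"
    "m (16 + d) = val e st" "agree (16 + d) (mem s) m" using Plus.IH(1)[of s d] Plus.prems dp by auto
  let ?s = "s\<lparr>pc := pc s + length (comp_exp d e), mem := m\<rparr>"
  have "sim (mem ?s) st" using sim_agree[OF Plus.prems(1) m(3)] by simp
  then obtain m' where m': "fold ram_instr (comp_exp (d + 1) f) ?s = ?s\<lparr>pc := pc ?s + length (comp_exp (d + 1) f), mem := m'\<rparr>"
    "m' (16 + (d + 1)) = val f st" "agree (16 + (d + 1)) m m'" using Plus.IH(2)[of ?s "d + 1"] Plus.prems dp by auto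
  have "m' (16 + d) = m (16 + d)" using m'(3) by (simp add: agree_def)
  then show ?case using m m' Plus.prems
    by (intro exI[of _ "m'(16 + d := m' (16 + d) + m' (17 + d))"]) (auto simp: agree_def fun_upd_def add.assoc)
next
  case (Minus e f)
  have dp: "d + depth e \<le> 16" "d + 1 + depth f \<le> 16" using Minus.prems(3) by (auto simp: max_def split: if_splits)
  obtain m where m: "fold ram_instr (comp_exp d e) s = s\<lparr>pc := pc s + length (comp_exp d e), mem := m\<rparr>"
    "m (16 + d) = val e st" "agree (16 + d) (mem s) m" using Minus.IH(1)[of s d] Minus.prems dp by auto
  let ?s = "s\<lparr>pc := pc s + length (comp_exp d e), mem := m\<rparr>"
  have "sim (mem ?s) st" using sim_agree[OF Minus.prems(1) m(3)] by simp
  then obtain m' where m': "fold ram_instr (comp_exp (d + 1) f) ?s = ?s\<lparr>pc := pc ?s + length (comp_exp (d + 1) f), mem := m'\<rparr>"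
    "m' (16 + (d + 1)) = val f st" "agree (16 + (d + 1)) m m'" using Minus.IH(2)[of ?s "d + 1"] Minus.prems dp by auto
  have "m' (16 + d) = m (16 + d)" using m'(3) by (simp add: agree_def)
  then show ?case using m m' Minus.prems
    by (intro exI[of _ "m'(16 + d := m' (16 + d) - m' (17 + d))"]) (auto simp: agree_def fun_upd_def add.assoc)
next
  case (Arr a e)
  obtain m where m: "fold ram_instr (comp_exp d e) s = s\<lparr>pc := pc s + length (comp_exp d e), mem := m\<rparr>"
    "m (16 + d) = val e st" "agree (16 + d) (mem s) m" using Arr.IH[of s d] Arr.prems by (auto simp: max_def split: if_splits)
  have "sim m st" using sim_agree[OF Arr.prems(1) m(3)] by simp
  then have v: "m (32 * Suc (val e st) + a) = arr st a (val e st)" using Arr.prems by (simp add: sim_def)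
  let ?m = "m(17 + d := 32 + a, 16 + d := arr st a (val e st))"
  have "fold ram_instr (comp_exp d (Arr a e)) s =
      ram_instr (Load (16 + d) (16 + d)) (ram_instr (Add (16 + d) (16 + d) (17 + d)) (ram_instr (Const (17 + d) (32 + a))
        (s\<lparr>pc := pc s + length (comp_exp d e) + 5, mem := m(16 + d := 32 * val e st)\<rparr>)))"
    using m(1,2) by (simp add: fold_double del: ram_instr.simps)
  also have "\<dots> = s\<lparr>pc := pc s + length (comp_exp d (Arr a e)), mem := ?m\<rparr>"
    using v Arr.prems by (intro ram_state.equality) (auto simp: fun_eq_iff add_ac)
  finally have F: "fold ram_instr (comp_exp d (Arr a e)) s = s\<lparr>pc := pc s + length (comp_exp d (Arr a e)), mem := ?m\<rparr>" .
  have d: "d \<le> 14" using Arr.prems(3) by (simp add: max_def split: if_splits)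
  have "agree (16 + d) (mem s) ?m" using m(3) d by (auto simp: agree_def)
  then have "fold ram_instr (comp_exp d (Arr a e)) s = s\<lparr>pc := pc s + length (comp_exp d (Arr a e)), mem := ?m\<rparr> \<and>
      ?m (16 + d) = val (Arr a e) st \<and> agree (16 + d) (mem s) ?m" using F by (intro conjI) simp_all
  then show ?case by (rule exI[of _ ?m])
qed

text \<open>A bound for the machine steps that one tick stands for. Tests are charged together with
  their jumps, and bodies are charged to their own ticks, hence the maximum instead of a
  sum.\<close>

fun unit_cost :: "com \<Rightarrow> nat" where
  "unit_cost (c ;; d) = max (unit_cost c) (unit_cost d)"
| "unit_cost (Ite e c d) = max (length (comp_exp 0 e) + 3) (max (unit_cost c) (unit_cost d))"
| "unit_cost (While e c) = max (length (comp_exp 0 e) + 5) (unit_cost c)"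
| "unit_cost c = code_size c"

definition simulates :: "ram_state \<Rightarrow> state \<Rightarrow> bool" where
  "simulates r s \<longleftrightarrow> sim (mem r) s \<and> inp r = tape s \<and> out r = printed s"

lemma steps_exp:
  assumes "code_at P (pc r) (comp_exp d e)" "simulates r s" "wf_exp e" "d + depth e \<le> 16"
  shows "\<exists>m. steps P (length (comp_exp d e)) r (r\<lparr>pc := pc r + length (comp_exp d e), mem := m\<rparr>) \<and>
    m (16 + d) = val e s \<and> agree (16 + d) (mem r) m \<and> simulates (r\<lparr>pc := pc r + length (comp_exp d e), mem := m\<rparr>) s"
proof -
  obtain m where m: "fold ram_instr (comp_exp d e) r = r\<lparr>pc := pc r + length (comp_exp d e), mem := m\<rparr>"
    "m (16 + d) = val e s" "agree (16 + d) (mem r) m"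
    using comp_exp_correct[of r s e d] assms by (auto simp: simulates_def)
  have "sim m s" using sim_agree[OF _ m(3)] assms(2) by (auto simp: simulates_def)
  then show ?thesis using m assms(2) steps_straight[OF assms(1) no_jump_comp_exp]
    by (intro exI[of _ m]) (simp add: simulates_def)
qed

lemma sim_var: "sim m s \<Longrightarrow> x < 16 \<Longrightarrow> sim (m(x := v)) (s\<lparr>var := (var s)(x := v), tick := t\<rparr>)"
  by (auto simp: sim_def)

text \<open>Array registers do not overlap: division by 32 recovers the index, and the rest recovers
  the array.\<close>

lemma sim_arr:
  assumes "sim m s" "a < 32"
  shows "sim (m(32 * Suc i + a := v)) (s\<lparr>arr := (arr s)(a := (arr s a)(i := v)), tick := t\<rparr>)"
proof -
  have inj: "b = a \<and> j = i" if "32 * Suc j + b = 32 * Suc i + a" "b < 32" for b j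
  proof -
    have "(32 * Suc j + b) div 32 = Suc j" "(32 * Suc i + a) div 32 = Suc i"
      using that(2) assms(2) by (intro div_nat_eqI; simp)+
    then have "j = i" using that(1) by simp
    then show ?thesis using that by simp
  qed
  show ?thesis
    unfolding sim_def
  proof (intro conjI allI impI)
    fix x :: nat assume "x < 16"
    then show "(m(32 * Suc i + a := v)) x = var (s\<lparr>arr := (arr s)(a := (arr s a)(i := v)), tick := t\<rparr>) x"
      using assms(1) by (simp add: sim_def)
  next
    fix b j :: nat assume b: "b < 32"
    show "(m(32 * Suc i + a := v)) (32 * Suc j + b) = arr (s\<lparr>arr := (arr s)(a := (arr s a)(i := v)), tick := t\<rparr>) b j"
    proof (cases "b = a \<and> j = i")
      case False
      then have "32 * Suc j + b \<noteq> 32 * Suc i + a" using inj b by blast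
      then have "(m(32 * Suc i + a := v)) (32 * Suc j + b) = m (32 * Suc j + b)" by (rule fun_upd_other)
      also have "\<dots> = arr s b j" using assms(1) b unfolding sim_def by blast
      finally show ?thesis using False by auto
    qed simp
  qed
qed

text \<open>The time bound \<open>t + K * tick s \<le> K * tick s'\<close> telescopes along
  sequences and loop iterations. Induction on the execution covers loops without a separate
  termination argument.\<close>

theorem compile_correct:
  assumes "exec c s s'" "wf_com c" "simulates r s" "code_at P (pc r) (compile (pc r) c)" "unit_cost c \<le> K"
  shows "\<exists>t r'. steps P t r r' \<and> simulates r' s' \<and> pc r' = pc r + code_size c \<and>
    t + K * tick s \<le> K * tick s'"
  using assms
proof (induction arbitrary: r rule: exec.induct)
  case (exec_Assign x e s)
  obtain m where m: "steps P (length (comp_exp 0 e)) r (r\<lparr>pc := pc r + length (comp_exp 0 e), mem := m\<rparr>)"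
    "m 16 = val e s" "simulates (r\<lparr>pc := pc r + length (comp_exp 0 e), mem := m\<rparr>) s"
    using steps_exp[of P r 0 e s] exec_Assign by (auto simp: code_at_append)
  let ?r = "r\<lparr>pc := pc r + length (comp_exp 0 e), mem := m\<rparr>"
  have s2: "steps P (length [Const 17 0, Add x 16 17]) ?r (fold ram_instr [Const 17 0, Add x 16 17] ?r)"
    using exec_Assign by (intro steps_straight) (auto simp: code_at_append)
  have "sim (m(17 := 0)) s" using m(3) by (auto simp: simulates_def sim_def)
  then have "simulates (fold ram_instr [Const 17 0, Add x 16 17] ?r) (s\<lparr>var := (var s)(x := val e s), tick := tick s + 1\<rparr>)"
    using sim_var[of "m(17 := 0)" s x "val e s"] m exec_Assign by (simp add: simulates_def)
  then show ?case using steps_trans[OF m(1) s2] exec_Assign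
    by (intro exI[of _ "length (comp_exp 0 e) + 2"] exI[of _ "fold ram_instr [Const 17 0, Add x 16 17] ?r"]) simp
next
  case (exec_Update a e f s)
  obtain m where m: "steps P (length (comp_exp 0 e)) r (r\<lparr>pc := pc r + length (comp_exp 0 e), mem := m\<rparr>)"
    "m 16 = val e s" "simulates (r\<lparr>pc := pc r + length (comp_exp 0 e), mem := m\<rparr>) s"
    using steps_exp[of P r 0 e s] exec_Update by (auto simp: code_at_append)
  let ?r = "r\<lparr>pc := pc r + length (comp_exp 0 e), mem := m\<rparr>"
  let ?c = "replicate 5 (Add 16 16 16) @ [Const 17 (32 + a), Add 16 16 17]"
  have cmp: "compile (pc r) (Update a e f) = comp_exp 0 e @ ?c @ comp_exp 1 f @ [Store 16 17]" and len: "length ?c = 7"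
    by simp_all
  have at: "code_at P (pc r + length (comp_exp 0 e)) ?c" "code_at P (pc r + length (comp_exp 0 e) + 7) (comp_exp 1 f)"
    "code_at P (pc r + length (comp_exp 0 e) + 7 + length (comp_exp 1 f)) [Store 16 17]"
    using exec_Update.prems(3) unfolding cmp code_at_append len by blast+
  have s2: "steps P (length ?c) ?r (fold ram_instr ?c ?r)"
    using at(1) by (intro steps_straight) (auto simp: set_replicate_conv_if)
  let ?r2 = "fold ram_instr ?c ?r"
  have pc2: "pc ?r2 = pc r + length (comp_exp 0 e) + 7" and m2: "mem ?r2 16 = 32 * Suc (val e s) + a"
    and "\<forall>x. x \<noteq> 16 \<and> x \<noteq> 17 \<longrightarrow> mem ?r2 x = m x" "inp ?r2 = inp r" "out ?r2 = out r"
    using m(2) by (simp_all add: fold_double)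
  then have sim2: "simulates ?r2 s" using m(3) by (auto simp: simulates_def sim_def)
  have "code_at P (pc ?r2) (comp_exp 1 f)" unfolding pc2 by (rule at(2))
  then obtain m3 where m3: "steps P (length (comp_exp 1 f)) ?r2 (?r2\<lparr>pc := pc ?r2 + length (comp_exp 1 f), mem := m3\<rparr>)"
    "m3 17 = val f s" "agree 17 (mem ?r2) m3" "simulates (?r2\<lparr>pc := pc ?r2 + length (comp_exp 1 f), mem := m3\<rparr>) s"
    using steps_exp[of P ?r2 1 f s] sim2 exec_Update by auto
  let ?r3 = "?r2\<lparr>pc := pc ?r2 + length (comp_exp 1 f), mem := m3\<rparr>"
  have "m3 16 = 32 * Suc (val e s) + a" using m3(3) m2 by (simp add: agree_def)
  then have "simulates (ram_instr (Store 16 17) ?r3) (s\<lparr>arr := (arr s)(a := (arr s a)(val e s := val f s)), tick := tick s + 1\<rparr>)"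
    using m3(2,4) sim_arr[of m3 s a "val e s" "val f s"] exec_Update by (simp add: simulates_def)
  moreover have "steps P 1 ?r3 (ram_instr (Store 16 17) ?r3)"
  proof (rule steps_1)
    have "pc ?r3 = pc r + length (comp_exp 0 e) + 7 + length (comp_exp 1 f)" using pc2 by simp
    then show "pc ?r3 < length P" "P ! pc ?r3 = Store 16 17" using at(3) by (simp_all only: code_at_Cons)
  qed
  note steps_trans[OF steps_trans[OF steps_trans[OF m(1) s2] m3(1)] this]
  ultimately show ?case using exec_Update pc2
    by (intro exI[of _ "length (comp_exp 0 e) + 7 + length (comp_exp 1 f) + 1"] exI[of _ "ram_instr (Store 16 17) ?r3"]) simp
next
  case (exec_Input x s)
  then have "steps P 1 r (ram_instr (Read x) r)" by (intro steps_1) (simp_all add: code_at_Cons)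
  moreover have "simulates (ram_instr (Read x) r) (s\<lparr>var := (var s)(x := (case tape s of [] \<Rightarrow> 0 | y # _ \<Rightarrow> y)), tape := tl (tape s), tick := tick s + 1\<rparr>)"
    using exec_Input by (auto simp: simulates_def sim_def)
  ultimately show ?case using exec_Input by (intro exI[of _ 1] exI[of _ "ram_instr (Read x) r"]) simp
next
  case (exec_Output e s)
  obtain m where m: "steps P (length (comp_exp 0 e)) r (r\<lparr>pc := pc r + length (comp_exp 0 e), mem := m\<rparr>)"
    "m 16 = val e s" "simulates (r\<lparr>pc := pc r + length (comp_exp 0 e), mem := m\<rparr>) s"
    using steps_exp[of P r 0 e s] exec_Output by (auto simp: code_at_append)
  let ?r = "r\<lparr>pc := pc r + length (comp_exp 0 e), mem := m\<rparr>"
  have "steps P 1 ?r (ram_instr (Print 16) ?r)" using exec_Output by (intro steps_1) (simp_all add: code_at_append code_at_Cons)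
  note steps_trans[OF m(1) this]
  moreover have "simulates (ram_instr (Print 16) ?r) (s\<lparr>printed := printed s @ [val e s], tick := tick s + 1\<rparr>)"
    using m by (simp add: simulates_def sim_def)
  ultimately show ?case using exec_Output
    by (intro exI[of _ "length (comp_exp 0 e) + 1"] exI[of _ "ram_instr (Print 16) ?r"]) simp
next
  case (exec_Seq c s s' d s'')
  obtain t1 r1 where 1: "steps P t1 r r1" "simulates r1 s'" "pc r1 = pc r + code_size c" "t1 + K * tick s \<le> K * tick s'"
    using exec_Seq.IH(1)[of r] exec_Seq.prems by (auto simp: code_at_append)
  obtain t2 r2 where 2: "steps P t2 r1 r2" "simulates r2 s''" "pc r2 = pc r1 + code_size d" "t2 + K * tick s' \<le> K * tick s''"
    using exec_Seq.IH(2)[of r1] exec_Seq.prems 1 by (auto simp: code_at_append length_compile)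
  show ?case using steps_trans[OF 1(1) 2(1)] 1 2 by (intro exI[of _ "t1 + t2"] exI[of _ r2]) simp
next
  case (exec_Ite e s c d s')
  let ?l = "length (comp_exp 0 e)"
  obtain m where m: "steps P ?l r (r\<lparr>pc := pc r + ?l, mem := m\<rparr>)"
    "m 16 = val e s" "simulates (r\<lparr>pc := pc r + ?l, mem := m\<rparr>) s"
    using steps_exp[of P r 0 e s] exec_Ite.prems by (auto simp: code_at_append Let_def)
  let ?r = "r\<lparr>pc := pc r + ?l, mem := m\<rparr>"
  let ?j = "JumpPos 16 (pc r + ?l + 3 + code_size d)"
  have j: "steps P 1 ?r (ram_instr ?j ?r)"
    using exec_Ite.prems by (intro steps_1) (simp_all add: code_at_append code_at_Cons Let_def)
  note s1 = steps_trans[OF m(1) j]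
  have sm: "simulates (ram_instr ?j ?r) (s\<lparr>tick := tick s + 1\<rparr>)" using m(3) by (simp add: simulates_def sim_def)
  have K: "?l + 3 \<le> K" using exec_Ite.prems by simp
  show ?case
  proof (cases "0 < val e s")
    case True
    obtain t2 r2 where 2: "steps P t2 (ram_instr ?j ?r) r2" "simulates r2 s'" "pc r2 = pc (ram_instr ?j ?r) + code_size c"
      "t2 + K * (tick s + 1) \<le> K * tick s'"
      using exec_Ite.IH[of "ram_instr ?j ?r"] exec_Ite.prems sm True m(2)
      by (auto simp: code_at_append code_at_Cons Let_def length_compile add.commute add.left_commute numeral_3_eq_3)
    show ?thesis using steps_trans[OF s1 2(1)] 2 True m(2) K
      by (intro exI[of _ "?l + 1 + t2"] exI[of _ r2]) (simp add: algebra_simps)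
  next
    case False
    obtain t2 r2 where 2: "steps P t2 (ram_instr ?j ?r) r2" "simulates r2 s'" "pc r2 = pc (ram_instr ?j ?r) + code_size d"
      "t2 + K * (tick s + 1) \<le> K * tick s'"
      using exec_Ite.IH[of "ram_instr ?j ?r"] exec_Ite.prems sm False m(2)
      by (auto simp: code_at_append code_at_Cons Let_def length_compile)
    let ?e = "[Const 16 1]"
    let ?k = "JumpPos 16 (pc r + ?l + 3 + code_size d + code_size c)"
    let ?r3 = "ram_instr (Const 16 1) r2"
    have p: "pc r2 = pc r + ?l + 1 + code_size d" using 2(3) False m(2) by simp
    have a: "steps P 1 r2 ?r3"
      using exec_Ite.prems p by (intro steps_1) (simp_all add: code_at_append code_at_Cons Let_def length_compile)
    have b: "steps P 1 ?r3 (ram_instr ?k ?r3)"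
      using exec_Ite.prems p by (intro steps_1) (simp_all add: code_at_append code_at_Cons Let_def length_compile)
    have "simulates (ram_instr ?k ?r3) s'" using 2(2) by (simp add: simulates_def sim_def)
    then show ?thesis using steps_trans[OF steps_trans[OF steps_trans[OF s1 2(1)] a] b] 2 K
      by (intro exI[of _ "?l + 1 + t2 + 1 + 1"] exI[of _ "ram_instr ?k ?r3"]) (simp add: algebra_simps)
  qed
next
  case (exec_While_end e s c)
  let ?l = "length (comp_exp 0 e)"
  obtain m where m: "steps P ?l r (r\<lparr>pc := pc r + ?l, mem := m\<rparr>)"
    "m 16 = val e s" "simulates (r\<lparr>pc := pc r + ?l, mem := m\<rparr>) s"
    using steps_exp[of P r 0 e s] exec_While_end.prems by (auto simp: code_at_append Let_def)
  let ?r = "r\<lparr>pc := pc r + ?l, mem := m\<rparr>"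
  let ?r1 = "ram_instr (JumpPos 16 (pc r + ?l + 3)) ?r"
  let ?r2 = "ram_instr (Const 16 1) ?r1"
  let ?r3 = "ram_instr (JumpPos 16 (pc r + ?l + 5 + code_size c)) ?r2"
  have a: "steps P 1 ?r ?r1"
    using exec_While_end.prems by (intro steps_1) (simp_all add: code_at_append code_at_Cons Let_def)
  have b: "steps P 1 ?r1 ?r2"
    using exec_While_end.prems exec_While_end.hyps m(2) by (intro steps_1) (simp_all add: code_at_append code_at_Cons Let_def)
  have c: "steps P 1 ?r2 ?r3"
    using exec_While_end.prems exec_While_end.hyps m(2) by (intro steps_1) (simp_all add: code_at_append code_at_Cons Let_def)
  have "simulates ?r3 (s\<lparr>tick := tick s + 1\<rparr>)" using m(3) by (simp add: simulates_def sim_def)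
  then show ?case using steps_trans[OF steps_trans[OF steps_trans[OF m(1) a] b] c] exec_While_end.prems
    by (intro exI[of _ "?l + 1 + 1 + 1"] exI[of _ ?r3]) (simp add: algebra_simps)
next
  case (exec_While_step e s c s' s'')
  let ?l = "length (comp_exp 0 e)"
  obtain m where m: "steps P ?l r (r\<lparr>pc := pc r + ?l, mem := m\<rparr>)"
    "m 16 = val e s" "simulates (r\<lparr>pc := pc r + ?l, mem := m\<rparr>) s"
    using steps_exp[of P r 0 e s] exec_While_step.prems by (auto simp: code_at_append Let_def)
  let ?r = "r\<lparr>pc := pc r + ?l, mem := m\<rparr>"
  let ?r1 = "ram_instr (JumpPos 16 (pc r + ?l + 3)) ?r"
  have a: "steps P 1 ?r ?r1"
    using exec_While_step.prems by (intro steps_1) (simp_all add: code_at_append code_at_Cons Let_def)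
  have sm: "simulates ?r1 (s\<lparr>tick := tick s + 1\<rparr>)" using m(3) by (simp add: simulates_def sim_def)
  have p1: "pc ?r1 = pc r + ?l + 3" using exec_While_step.hyps m(2) by simp
  have "code_at P (pc ?r1) (compile (pc ?r1) c)"
    using exec_While_step.prems unfolding p1 by (simp add: code_at_append code_at_Cons Let_def numeral_3_eq_3)
  then obtain t2 r2 where 2: "steps P t2 ?r1 r2" "simulates r2 s'" "pc r2 = pc r + ?l + 3 + code_size c"
      "t2 + K * (tick s + 1) \<le> K * tick s'"
    using exec_While_step.IH(1)[OF _ sm] exec_While_step.prems p1 by auto
  let ?r3 = "ram_instr (Const 16 1) r2"
  let ?r4 = "ram_instr (JumpPos 16 (pc r)) ?r3"
  have b: "steps P 1 r2 ?r3"
    using exec_While_step.prems 2(3) by (intro steps_1) (simp_all add: code_at_append code_at_Cons Let_def length_compile numeral_3_eq_3)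
  have c: "steps P 1 ?r3 ?r4"
    using exec_While_step.prems 2(3) by (intro steps_1) (simp_all add: code_at_append code_at_Cons Let_def length_compile numeral_3_eq_3)
  have "simulates ?r4 s'" "pc ?r4 = pc r" using 2(2) by (simp_all add: simulates_def sim_def)
  then obtain t5 r5 where 5: "steps P t5 ?r4 r5" "simulates r5 s''" "pc r5 = pc r + code_size (While e c)"
      "t5 + K * tick s' \<le> K * tick s''"
    using exec_While_step.IH(2)[of ?r4] exec_While_step.prems by auto
  note steps_trans[OF steps_trans[OF steps_trans[OF steps_trans[OF steps_trans[OF m(1) a] 2(1)] b] c] 5(1)]
  moreover have "?l + 5 \<le> K" using exec_While_step.prems by simp
  ultimately show ?case using 5 2(4)
    by (intro exI[of _ "?l + 1 + t2 + 1 + 1 + t5"] exI[of _ r5]) (simp add: algebra_simps)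
qed

definition start :: "nat list \<Rightarrow> state" where
  "start xs = \<lparr>var = \<lambda>_. 0, arr = \<lambda>_ _. 0, tape = xs, printed = [], tick = 0\<rparr>"

corollary wp_ram_computes:
  assumes "wp c (\<lambda>s. printed s = ys \<and> tick s \<le> T) (start xs)" "wf_com c"
  shows "\<exists>t \<le> unit_cost c * T. ram_computes (compile 0 c) xs ys t"
proof -
  obtain s' where s': "exec c (start xs) s'" "printed s' = ys" "tick s' \<le> T" using assms(1) by (auto simp: wp_def)
  have "simulates (ram_init xs) (start xs)" by (simp add: simulates_def sim_def ram_init_def start_def)
  moreover have "code_at (compile 0 c) (pc (ram_init xs)) (compile (pc (ram_init xs)) c)"
    by (auto simp: code_at_def ram_init_def)
  ultimately obtain t r' where t: "steps (compile 0 c) t (ram_init xs) r'" "simulates r' s'"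
    "pc r' = pc (ram_init xs) + code_size c" "t + unit_cost c * tick (start xs) \<le> unit_cost c * tick s'"
    using compile_correct[OF s'(1) assms(2) _ _ order_refl] by blast
  have "ram_computes (compile 0 c) xs ys t"
    using t s' by (simp add: ram_computes_def steps_def simulates_def ram_init_def length_compile)
  moreover have "t \<le> unit_cost c * T"
    using t(4) s'(3) by (meson add_leD1 le_trans mult_le_mono2)
  ultimately show ?thesis by blast
qed

section \<open>The program and its verification\<close>

inductive_simps exec_While_iff: "exec (While e c) s s'"

lemma wp_While_unfold:
  "wp (While e c) Q s \<longleftrightarrow> (if val e s = 0 then Q (s\<lparr>tick := tick s + 1\<rparr>)
     else wp c (wp (While e c) Q) (s\<lparr>tick := tick s + 1\<rparr>))"
  unfolding wp_def by (subst exec_While_iff) auto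

lemma wp_Ite: "wp (Ite e c d) Q s \<longleftrightarrow>
    (0 < val e s \<longrightarrow> wp c Q (s\<lparr>tick := tick s + 1\<rparr>)) \<and> (val e s = 0 \<longrightarrow> wp d Q (s\<lparr>tick := tick s + 1\<rparr>))"
  by simp

declare wp_simps(6)[simp del]
declare wp_Ite[simp]

definition frame :: "nat set \<Rightarrow> nat set \<Rightarrow> state \<Rightarrow> state \<Rightarrow> bool" where
  "frame X Y s s' \<longleftrightarrow> (\<forall>x. x \<notin> X \<longrightarrow> var s' x = var s x) \<and> (\<forall>a. a \<notin> Y \<longrightarrow> arr s' a = arr s a)"

section \<open>Reading the adjacency lists\<close>

text \<open>
  Variables: 2 number of vertices; 3 current vertex; 4, 5 position in an adjacency list and number
  of entries left, later the fill levels of the buffers 13, 14; 6, 7 a neighbour and its number;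
  8 next free number; 9, 10 number being scanned and its vertex; 11 current node, later current pair;
  12 parent of the node, later a counter; 13 number of emitted pairs; 14, 15 two open ends, later the
  two nodes that climb.

  Arrays: 2 degrees; 3 offsets into the concatenation 4 of the adjacency lists; 5 number of a vertex
  (0 if undiscovered); 6 vertex with a number, plus 1; 7 parents; 8, 9 open ends in the slot of a
  node (0 if absent); 10 nodes into which several children were merged; 11, 12 emitted pairs;
  13, 14 the two halves of a path.
\<close>

definition read_entry :: com where
  "read_entry = Input 6 ;; Update 4 (Var 4) (Var 6) ;; Assign 4 (Plus (Var 4) (Num 1)) ;; Assign 5 (Minus (Var 5) (Num 1))"

definition read_row :: com where
  "read_row = While (Var 5) read_entry"

lemmas wp_read_row_unfold = wp_While_unfold[of "Var 5" read_entry, folded read_row_def]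

definition read_graph :: com where
  "read_graph = Input 2 ;; While (Minus (Var 2) (Var 3)) (Input 5 ;; Update 2 (Var 3) (Var 5) ;;
     Update 3 (Var 3) (Var 4) ;; read_row ;; Assign 3 (Plus (Var 3) (Num 1)))"

text \<open>Stated for an arbitrary postcondition, so that it applies in the middle of a sequence;
  the induction follows the part of the tape that holds the row.\<close>

lemma wp_read_row:
  assumes "tape s = xs @ rest" "var s 5 = length xs"
    and "\<And>s'. frame {4, 5, 6} {4} s s' \<Longrightarrow> var s' 4 = var s 4 + length xs \<Longrightarrow> tape s' = rest \<Longrightarrow>
      (\<forall>i. arr s' 4 i = (if var s 4 \<le> i \<and> i < var s 4 + length xs then xs ! (i - var s 4) else arr s 4 i)) \<Longrightarrow>
      printed s' = printed s \<Longrightarrow> tick s' = tick s + 5 * length xs + 1 \<Longrightarrow> Q s'"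
  shows "wp read_row Q s"
  using assms
proof (induction xs arbitrary: s)
  case Nil
  show ?case
    by (subst wp_read_row_unfold) (use Nil in \<open>simp add: frame_def\<close>)
next
  case (Cons x xs)
  show ?case
  proof (subst wp_read_row_unfold, simp add: Cons.prems(1,2) read_entry_def, rule Cons.IH, goal_cases)
    case (3 s')
    show ?case
    proof (rule Cons.prems(3))
      show "\<forall>i. arr s' 4 i = (if var s 4 \<le> i \<and> i < var s 4 + length (x # xs) then (x # xs) ! (i - var s 4) else arr s 4 i)"
        using 3(4) by (auto simp: nth_Cons' Suc_le_eq)
    qed (use 3 in \<open>auto simp: frame_def\<close>)
  qed simp_all
qed

definition offset :: "nat list list \<Rightarrow> nat \<Rightarrow> nat" where
  "offset L v = length (concat (take v L))"

lemma offset_Suc: "v < length L \<Longrightarrow> offset L (Suc v) = offset L v + length (L ! v)"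
  by (simp add: offset_def take_Suc_conv_app_nth)

lemma offset_length: "offset L (length L) = length (concat L)"
  by (simp add: offset_def)

definition stored :: "nat list list \<Rightarrow> nat \<Rightarrow> state \<Rightarrow> bool" where
  "stored L v s \<longleftrightarrow> var s 2 = length L \<and> (\<forall>u<v. arr s 2 u = length (L ! u) \<and> arr s 3 u = offset L u \<and>
     (\<forall>i<length (L ! u). arr s 4 (offset L u + i) = L ! u ! i))"

lemma offset_mono: "u \<le> v \<Longrightarrow> offset L u \<le> offset L v"
  unfolding offset_def by (metis concat_append le_add1 length_append min.absorb1 take_append take_add le_Suc_ex)

lemma wp_read_graph:
  assumes "\<And>s. stored L (length L) s \<Longrightarrow> (\<forall>a\<ge>5. arr s a = (\<lambda>_. 0)) \<Longrightarrow> (\<forall>x. x \<notin> {2, 3, 4, 5, 6} \<longrightarrow> var s x = 0) \<Longrightarrow>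
      printed s = [] \<Longrightarrow> tick s \<le> 6 * length L + 5 * length (concat L) + 2 \<Longrightarrow> Q s"
  shows "wp read_graph Q (start (encode_lists L))"
proof -
  let ?rows = "\<lambda>v. concat (map (\<lambda>xs. length xs # xs) (drop v L))"
  define I where "I s \<longleftrightarrow> var s 3 \<le> length L \<and> stored L (var s 3) s \<and> tape s = ?rows (var s 3) \<and> var s 4 = offset L (var s 3) \<and>
     (\<forall>a\<ge>5. arr s a = (\<lambda>_. 0)) \<and> (\<forall>x. x \<notin> {2, 3, 4, 5, 6} \<longrightarrow> var s x = 0) \<and> printed s = [] \<and>
     tick s = 6 * var s 3 + 5 * offset L (var s 3) + 1" for s
  show ?thesis
    unfolding read_graph_def wp_simps
  proof (rule wp_While[where I = I and \<mu> = "\<lambda>s. length L - var s 3"])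
    show "I (start (encode_lists L)\<lparr>var := (var (start (encode_lists L)))
          (2 := case tape (start (encode_lists L)) of [] \<Rightarrow> 0 | y # x \<Rightarrow> y),
          tape := tl (tape (start (encode_lists L))), tick := tick (start (encode_lists L)) + 1\<rparr>)"
      by (simp add: I_def stored_def start_def encode_lists_def offset_def)
  next
    fix s assume I: "I s" and "0 < val (Minus (Var 2) (Var 3)) s"
    define v where "v = var s 3"
    have v: "v < length L" using \<open>0 < val _ _\<close> I by (simp add: I_def stored_def v_def)
    have tape: "tape s = length (L ! v) # (L ! v) @ ?rows (Suc v)"
      using I v by (simp add: I_def v_def Cons_nth_drop_Suc[symmetric])
    \<comment> \<open>Entries of earlier rows lie strictly before the row being written, so they
      survive.\<close>
    have below: "offset L u + i < offset L v" if "u < v" "i < length (L ! u)" for u i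
      using offset_mono[of "Suc u" v L] offset_Suc[of u L] that v by simp
    show "wp (Input 5 ;; Update 2 (Var 3) (Var 5) ;; Update 3 (Var 3) (Var 4) ;; read_row ;; Assign 3 (Plus (Var 3) (Num 1)))
         (\<lambda>s'. I s' \<and> length L - var s' 3 < length L - var s 3) (s\<lparr>tick := tick s + 1\<rparr>)"
      unfolding wp_simps
    proof (rule wp_read_row[where xs = "L ! v" and rest = "?rows (Suc v)"], goal_cases)
      case 1
      then show ?case by (simp add: tape)
    next
      case 2
      then show ?case by (simp add: tape)
    next
      case (3 s')
      have fr: "var s' 2 = length L" "var s' 3 = v" "arr s' 2 = (arr s 2)(v := length (L ! v))"
        "arr s' 3 = (arr s 3)(v := offset L v)" "\<And>a. 5 \<le> a \<Longrightarrow> arr s' a = (\<lambda>_. 0)"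
        "\<And>x. x \<notin> {2, 3, 4, 5, 6} \<Longrightarrow> var s' x = 0"
        using 3(1) I by (auto simp: frame_def tape I_def stored_def v_def)
      have p: "var s' 4 = offset L (Suc v)" "tape s' = ?rows (Suc v)" "printed s' = []"
        using 3(2,3,5) I v by (auto simp: I_def v_def offset_Suc)
      have tk: "tick s' = 6 * v + 5 * offset L (Suc v) + 6"
        using 3(6) I v by (auto simp: I_def v_def offset_Suc)
      have a4: "arr s' 4 i = (if offset L v \<le> i \<and> i < offset L v + length (L ! v) then L ! v ! (i - offset L v) else arr s 4 i)" for i
        using 3(4) I by (simp add: I_def v_def)
      have "stored L (Suc v) s'"
        unfolding stored_def
      proof (intro conjI allI impI)
        show "var s' 2 = length L" by (rule fr)
        fix u assume u: "u < Suc v"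
        show "arr s' 2 u = length (L ! u)" "arr s' 3 u = offset L u"
          using u I fr by (auto simp: I_def stored_def v_def less_Suc_eq)
        fix i assume i: "i < length (L ! u)"
        show "arr s' 4 (offset L u + i) = L ! u ! i"
        proof (cases "u = v")
          case True
          then show ?thesis using i by (simp add: a4)
        next
          case False
          then have "u < v" using u by simp
          then show ?thesis using below[OF _ i] I i by (simp add: a4 I_def stored_def v_def)
        qed
      qed
      then show ?case using fr p tk v by (auto simp: I_def stored_def v_def[symmetric])
    qed
  next
    fix s assume I: "I s" and "val (Minus (Var 2) (Var 3)) s = 0"
    then have v: "var s 3 = length L" by (simp add: I_def stored_def)
    show "Q (s\<lparr>tick := tick s + 1\<rparr>)"
      by (rule assms) (use I v in \<open>simp_all add: I_def stored_def offset_length\<close>)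
  qed
qed

text \<open>The language has no empty command. This one costs a tick, and 15 is listed in frames
  although its value does not change.\<close>

definition skip :: com where
  "skip = Assign 15 (Var 15)"

section \<open>Breadth-first search as a program\<close>

definition scan_entry :: com where
  "scan_entry = Assign 6 (Arr 4 (Var 4)) ;; Assign 7 (Arr 5 (Var 6)) ;;
     Ite (Var 7) (Ite (Arr 7 (Var 7)) skip (Update 7 (Var 7) (Minus (Var 9) (Num 1))))
       (Update 5 (Var 6) (Var 8) ;; Update 6 (Var 8) (Plus (Var 6) (Num 1)) ;;
        Update 7 (Minus (Var 8) (Num 1)) (Var 9) ;; Assign 8 (Plus (Var 8) (Num 2))) ;;
     Assign 4 (Plus (Var 4) (Num 1)) ;; Assign 5 (Minus (Var 5) (Num 1))"

definition scan_row :: com where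
  "scan_row = While (Var 5) scan_entry"

definition visit :: com where
  "visit = Assign 10 (Minus (Arr 6 (Var 9)) (Num 1)) ;;
     Ite (Arr 7 (Var 9)) skip (Update 7 (Var 9) (Minus (Var 9) (Num 1))) ;;
     Assign 4 (Arr 3 (Var 10)) ;; Assign 5 (Arr 2 (Var 10)) ;; scan_row ;; Assign 9 (Plus (Var 9) (Num 2))"

definition visit_all :: com where
  "visit_all = While (Minus (Var 8) (Var 9)) visit"

definition search_from :: com where
  "search_from = Ite (Arr 5 (Var 3)) skip
       (Update 5 (Var 3) (Var 8) ;; Update 6 (Var 8) (Plus (Var 3) (Num 1)) ;; Assign 8 (Plus (Var 8) (Num 2))) ;;
     visit_all ;; Assign 3 (Plus (Var 3) (Num 1))"

definition search :: com where
  "search = Assign 3 (Num 0) ;; Assign 8 (Num 3) ;; Assign 9 (Num 3) ;; While (Minus (Var 2) (Var 3)) search_from"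

lemmas wp_scan_row_unfold = wp_While_unfold[of "Var 5" scan_entry, folded scan_row_def]

lemma frame_tick[simp]: "frame X Y (s\<lparr>tick := k\<rparr>) s' = frame X Y s s'"
  by (simp add: frame_def)

lemma frame_trans: "frame X Y s s' \<Longrightarrow> frame X Y s' s'' \<Longrightarrow> frame X Y s s''"
  unfolding frame_def by simp

text \<open>Existing numbers are kept and new ones exceed \<open>t\<close>, so whatever is
  discovered during the scan of \<open>t\<close> remains to be scanned.\<close>

definition grow :: "(nat \<Rightarrow> nat) \<Rightarrow> (nat \<Rightarrow> nat) \<Rightarrow> nat \<Rightarrow> bool" where
  "grow f g t \<longleftrightarrow> (\<forall>v. (f v \<noteq> 0 \<longrightarrow> g v = f v) \<and> (f v = 0 \<longrightarrow> g v = 0 \<or> t < g v))"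

lemma grow_trans: "grow f g t \<Longrightarrow> grow g h t \<Longrightarrow> grow f h t"
  unfolding grow_def by (metis not_less_zero)

lemma grow_refl: "grow f f t"
  by (simp add: grow_def)

locale bfs_program = bfs_graph +
  fixes L :: "nat list list"
  assumes adjacency: "adjacency_lists G L" and n_def: "n = length L"
begin

lemma row: "v < n \<Longrightarrow> distinct (L ! v)" "v < n \<Longrightarrow> set (L ! v) = {w. (v, w) \<in> E}"
  using adjacency n_def by (simp_all add: adjacency_lists_def)

definition Bst :: "state \<Rightarrow> nat \<Rightarrow> nat set \<Rightarrow> bool" where
  "Bst s \<tau> S \<longleftrightarrow> Bfs (arr s 5) (arr s 6) (arr s 7) (var s 8) (var s 9) \<tau> S"

lemma wp_scan_entry:
  assumes bf: "Bst s (t + 1) S" and t: "var s 9 = t" "arr s 5 u = t"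
    and w: "arr s 4 (var s 4) = w" "(u, w) \<in> E" "w \<notin> S"
  shows "wp scan_entry (\<lambda>s'. frame {4, 5, 6, 7, 8, 15} {5, 6, 7} s s' \<and> Bst s' (t + 1) (insert w S) \<and>
    var s' 4 = var s 4 + 1 \<and> var s' 5 = var s 5 - 1 \<and> printed s' = printed s \<and> tick s' \<le> tick s + 9 \<and>
    grow (arr s 5) (arr s' 5) t) s"
proof -
  interpret B: bfs_inv G n "arr s 5" "arr s 6" "arr s 7" "var s 8" t "t + 1" S
    using bf t by (simp add: Bst_def)
  have u0: "arr s 5 u \<noteq> 0" using t B.t_ge by simp
  have tn: "t < var s 8" using B.num[OF u0] t(2) by simp
  have wn: "w < n" using E_verts w(2) by blast
  show ?thesis
  proof (cases "arr s 5 w = 0")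
    case True
    have "Bfs ((arr s 5)(w := var s 8)) ((arr s 6)(var s 8 := Suc w)) ((arr s 7)(var s 8 - 1 := t)) (var s 8 + 2) t (t + 1) (insert w S)"
      by (rule B.discover) (use True wn tn in simp_all)
    moreover have "grow (arr s 5) ((arr s 5)(w := var s 8)) t" using True tn by (simp add: grow_def)
    ultimately show ?thesis
      using True t(1) w(1) by (simp add: scan_entry_def frame_def Bst_def)
  next
    case False
    note b = B.scan_old[OF t(2) w(2,3) False refl]
    show ?thesis
    proof (cases "arr s 7 (arr s 5 w) = 0")
      case z: True
      then show ?thesis
        using b False t(1) w(1) by (simp add: scan_entry_def frame_def Bst_def grow_refl)
    next
      case nz: False
      then show ?thesis
        using b False t(1) w(1) by (simp add: scan_entry_def skip_def frame_def Bst_def grow_refl)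
    qed
  qed
qed

lemma wp_scan_row:
  assumes "Bst s (t + 1) S" "var s 9 = t" "arr s 5 u = t" "t \<noteq> 0" "var s 5 = length ws"
    and "\<forall>i<length ws. arr s 4 (var s 4 + i) = ws ! i" "distinct ws" "set ws \<inter> S = {}" "\<forall>w\<in>set ws. (u, w) \<in> E"
  shows "wp scan_row (\<lambda>s'. frame {4, 5, 6, 7, 8, 15} {5, 6, 7} s s' \<and> Bst s' (t + 1) (S \<union> set ws) \<and>
    printed s' = printed s \<and> tick s' \<le> tick s + 10 * length ws + 1 \<and> grow (arr s 5) (arr s' 5) t) s"
    (is "wp _ (?Q ws s S) _")
  using assms
proof (induction ws arbitrary: s S)
  case Nil
  then show ?case by (subst wp_scan_row_unfold) (simp add: frame_def Bst_def grow_refl)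
next
  case (Cons w ws)
  let ?s = "s\<lparr>tick := tick s + 1\<rparr>"
  have B: "Bst ?s (t + 1) S" using Cons.prems(1) by (simp add: Bst_def)
  have "wp scan_entry (wp scan_row (?Q (w # ws) s S)) ?s"
  proof (rule wp_mono[OF wp_scan_entry[OF B, of u w]])
    show "var ?s 9 = t" "arr ?s 5 u = t" using Cons.prems by simp_all
    show "arr ?s 4 (var ?s 4) = w" using Cons.prems(6) by (auto dest: spec[of _ 0])
    show "(u, w) \<in> E" "w \<notin> S" using Cons.prems by auto
    fix s1 assume s1: "frame {4, 5, 6, 7, 8, 15} {5, 6, 7} ?s s1 \<and> Bst s1 (t + 1) (insert w S) \<and>
      var s1 4 = var ?s 4 + 1 \<and> var s1 5 = var ?s 5 - 1 \<and> printed s1 = printed ?s \<and> tick s1 \<le> tick ?s + 9 \<and>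
      grow (arr ?s 5) (arr s1 5) t"
    have a4: "arr s1 4 = arr s 4" "var s1 9 = t" using s1 Cons.prems(2) by (auto simp: frame_def)
    have IH: "wp scan_row (\<lambda>s'. frame {4, 5, 6, 7, 8, 15} {5, 6, 7} s1 s' \<and> Bst s' (t + 1) (insert w S \<union> set ws) \<and>
      printed s' = printed s1 \<and> tick s' \<le> tick s1 + 10 * length ws + 1 \<and> grow (arr s1 5) (arr s' 5) t) s1"
    proof (rule Cons.IH)
      show "Bst s1 (t + 1) (insert w S)" using s1 by blast
      show "arr s1 5 u = t" using s1 Cons.prems(3,4) by (simp add: grow_def)
      show "\<forall>i<length ws. arr s1 4 (var s1 4 + i) = ws ! i"
        using Cons.prems(6) s1 a4 by (auto dest: spec[of _ "Suc _"])
    qed (use s1 Cons.prems a4 in auto)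
    show "wp scan_row (?Q (w # ws) s S) s1"
      by (rule wp_mono[OF IH]) (use s1 in \<open>auto intro: frame_trans grow_trans\<close>)
  qed
  then show ?case by (subst wp_scan_row_unfold) (use Cons.prems(5) in simp)
qed

definition unscanned :: "state \<Rightarrow> nat set" where
  "unscanned s = {v. v < n \<and> \<not> (arr s 5 v \<noteq> 0 \<and> arr s 5 v < var s 9)}"

text \<open>The potential of the time analysis. A list entry costs at most 9 ticks and a loop test,
  and 9 ticks suffice for the rest of a visit, including the test of the outer loop.\<close>

definition work :: "state \<Rightarrow> nat" where
  "work s = (\<Sum>v\<in>unscanned s. 10 * length (L ! v) + 9)"

text \<open>The 1 on the left of the clock bound pays for the loop test in
  \<open>visit_all\<close>.\<close>

lemma wp_visit:
  assumes bf: "Bst s (var s 9) {}" and st: "stored L n s" and less: "var s 9 < var s 8"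
  shows "wp visit (\<lambda>s'. frame {4, 5, 6, 7, 8, 9, 10, 15} {5, 6, 7} s s' \<and> Bst s' (var s' 9) {} \<and>
    printed s' = printed s \<and> tick s' + work s' + 1 \<le> tick s + work s \<and> work s' < work s \<and>
    (\<forall>v. arr s 5 v \<noteq> 0 \<longrightarrow> arr s' 5 v \<noteq> 0)) s" (is "wp _ ?Q _")
proof -
  define t where "t = var s 9"
  interpret B: bfs_inv G n "arr s 5" "arr s 6" "arr s 7" "var s 8" t t "{}"
    using bf by (simp add: Bst_def t_def)
  have t0: "t \<noteq> 0" using B.t_ge by simp
  obtain u where u: "arr s 5 u = t" using B.num_onto[of t] B.odd_t B.t_ge less by (auto simp: t_def)
  have un: "u < n" "arr s 6 t = Suc u" using B.num[of u] u t0 by auto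
  note b = B.begin_scan[OF u refl refl]
  define s1 where "s1 = s\<lparr>var := (var s)(10 := u, 4 := offset L u, 5 := length (L ! u), 15 := var s 15),
      arr := (arr s)(7 := (if arr s 7 t = 0 then (arr s 7)(t := t - 1) else arr s 7)), tick := Suc (Suc (Suc (Suc (Suc (tick s)))))\<rparr>"
  have dg: "arr s 3 u = offset L u" "arr s 2 u = length (L ! u)" "\<And>i. i < length (L ! u) \<Longrightarrow> arr s 4 (offset L u + i) = L ! u ! i"
    using st un by (simp_all add: stored_def)
  have "wp scan_row (\<lambda>s'. frame {4, 5, 6, 7, 8, 15} {5, 6, 7} s1 s' \<and> Bst s' (t + 1) ({} \<union> set (L ! u)) \<and>
    printed s' = printed s1 \<and> tick s' \<le> tick s1 + 10 * length (L ! u) + 1 \<and> grow (arr s1 5) (arr s' 5) t) s1"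
  proof (rule wp_scan_row)
    show "Bst s1 (t + 1) {}" using b by (simp add: Bst_def s1_def t_def)
    show "\<forall>i<length (L ! u). arr s1 4 (var s1 4 + i) = L ! u ! i" using dg by (simp add: s1_def)
    show "\<forall>w\<in>set (L ! u). (u, w) \<in> E" using row un by blast
  qed (use u un row t0 in \<open>simp_all add: s1_def t_def\<close>)
  then have scan: "wp scan_row (wp (Assign 9 (Plus (Var 9) (Num 2))) ?Q) s1"
  proof (rule wp_mono)
    fix s2 assume s2: "frame {4, 5, 6, 7, 8, 15} {5, 6, 7} s1 s2 \<and> Bst s2 (t + 1) ({} \<union> set (L ! u)) \<and>
      printed s2 = printed s1 \<and> tick s2 \<le> tick s1 + 10 * length (L ! u) + 1 \<and> grow (arr s1 5) (arr s2 5) t"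
    let ?s = "s2\<lparr>var := (var s2)(9 := t + 2), tick := tick s2 + 1\<rparr>"
    have t2: "var s2 9 = t" and g: "grow (arr s 5) (arr s2 5) t" using s2 by (auto simp: frame_def s1_def t_def)
    interpret C: bfs_inv G n "arr s2 5" "arr s2 6" "arr s2 7" "var s2 8" t "t + 1" "set (L ! u)"
      using s2 t2 by (simp add: Bst_def)
    have u2: "arr s2 5 u = t" using g u t0 by (simp add: grow_def)
    have B2: "Bfs (arr s2 5) (arr s2 6) (arr s2 7) (var s2 8) (t + 2) (t + 2) {}"
      using C.end_scan[OF u2] row un by simp
    have "frame {4, 5, 6, 7, 8, 9, 10, 15} {5, 6, 7} s ?s" using s2 by (auto simp: frame_def s1_def)
    \<comment> \<open>Exactly one vertex leaves the unscanned set: those found meanwhile were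
      unscanned before, and their numbers are at least \<open>t + 2\<close>.\<close>
    moreover have "unscanned s = insert u (unscanned ?s)" and "u \<notin> unscanned ?s"
    proof -
      show "u \<notin> unscanned ?s" using u2 t0 by (simp add: unscanned_def)
      have "v \<in> unscanned s \<longleftrightarrow> v = u \<or> v \<in> unscanned ?s" for v
      proof (cases "arr s 5 v = 0")
        case True
        have "v \<noteq> u" using True u t0 by auto
        moreover have "arr s2 5 v \<noteq> 0 \<Longrightarrow> t + 2 \<le> arr s2 5 v"
        proof -
          assume a: "arr s2 5 v \<noteq> 0"
          then have "odd (arr s2 5 v)" using C.num by blast
          moreover have "t < arr s2 5 v" using spec[OF g[unfolded grow_def], of v] True a by simp
          ultimately show ?thesis using C.odd_t by presburger
        qed
        ultimately show ?thesis using True by (auto simp: unscanned_def t_def[symmetric])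
      next
        case False
        then have e: "arr s2 5 v = arr s 5 v" using g by (simp add: grow_def)
        have "odd (arr s 5 v)" using B.num False by blast
        then have "arr s 5 v < t + 2 \<longleftrightarrow> arr s 5 v < t \<or> arr s 5 v = t" using B.odd_t by presburger
        moreover have "arr s 5 v = t \<longleftrightarrow> v = u" using B.num_inj[of v u] u t0 by metis
        ultimately show ?thesis using False e t0 un u by (auto simp: unscanned_def t_def[symmetric])
      qed
      then show "unscanned s = insert u (unscanned ?s)" by blast
    qed
    then have W: "work s = 10 * length (L ! u) + 9 + work ?s"
      unfolding work_def by (simp add: unscanned_def)
    have tk: "tick s2 \<le> tick s + 10 * length (L ! u) + 6" using s2 by (simp add: s1_def)
    have "frame {4, 5, 6, 7, 8, 9, 10, 15} {5, 6, 7} s ?s \<and> Bst ?s (var ?s 9) {} \<and>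
      printed ?s = printed s \<and> tick ?s + work ?s + 1 \<le> tick s + work s \<and> work ?s < work s \<and>
      (\<forall>v. arr s 5 v \<noteq> 0 \<longrightarrow> arr ?s 5 v \<noteq> 0)"
      using calculation B2 W tk s2 g by (simp add: Bst_def s1_def grow_def)
    then show "wp (Assign 9 (Plus (Var 9) (Num 2))) ?Q s2"
      using t2 by simp
  qed
  have nine: "var s 9 = t" by (simp add: t_def)
  show ?thesis
  proof (cases "arr s 7 t = 0")
    case True
    then have "s1 = s\<lparr>arr := (arr s)(7 := (arr s 7)(t := t - 1)),
      var := (var s)(10 := u, 4 := offset L u, 5 := length (L ! u)), tick := Suc (Suc (Suc (Suc (Suc (tick s)))))\<rparr>"
      by (intro state.equality) (simp_all add: s1_def fun_eq_iff)
    then show ?thesis using scan True nine un dg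
      unfolding visit_def wp_simps(1-5) wp_Ite by (simp add: nine)
  next
    case False
    then have "s1 = s\<lparr>var := (var s)(10 := u, 15 := var s 15, 4 := offset L u, 5 := length (L ! u)), tick := Suc (Suc (Suc (Suc (Suc (tick s)))))\<rparr>"
      by (intro state.equality) (simp_all add: s1_def fun_eq_iff)
    then show ?thesis using scan False nine un dg
      unfolding visit_def wp_simps(1-5) wp_Ite skip_def by (simp add: nine)
  qed
qed

end

lemma stored_frame:
  "frame X Y s s' \<Longrightarrow> 2 \<notin> X \<Longrightarrow> 2 \<notin> Y \<Longrightarrow> 3 \<notin> Y \<Longrightarrow> 4 \<notin> Y \<Longrightarrow> stored L v s' \<longleftrightarrow> stored L v s"
  by (simp add: frame_def stored_def)

lemma frame_refl[simp]: "frame X Y s s"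
  by (simp add: frame_def)

lemma frame_tick_right[simp]: "frame X Y s (s'\<lparr>tick := k\<rparr>) = frame X Y s s'"
  by (simp add: frame_def)

lemma frame_mono: "frame X Y s s' \<Longrightarrow> X \<subseteq> X' \<Longrightarrow> Y \<subseteq> Y' \<Longrightarrow> frame X' Y' s s'"
  unfolding frame_def by blast

context bfs_program
begin

lemma Bst_tick[simp]: "Bst (s\<lparr>tick := k\<rparr>) \<tau> S = Bst s \<tau> S"
  by (simp add: Bst_def)

lemma work_tick[simp]: "work (s\<lparr>tick := k\<rparr>) = work s"
  by (simp add: work_def unscanned_def)

lemma stored_tick[simp]: "stored L v (s\<lparr>tick := k\<rparr>) = stored L v s"
  by (simp add: stored_def)

lemma wp_visit_all:
  assumes "Bst s (var s 9) {}" "stored L n s"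
  shows "wp visit_all (\<lambda>s'. frame {4, 5, 6, 7, 8, 9, 10, 15} {5, 6, 7} s s' \<and> Bst s' (var s' 9) {} \<and> var s' 8 = var s' 9 \<and>
    printed s' = printed s \<and> tick s' + work s' \<le> tick s + work s + 1 \<and> (\<forall>v. arr s 5 v \<noteq> 0 \<longrightarrow> arr s' 5 v \<noteq> 0)) s"
  unfolding visit_all_def
proof (rule wp_While[where \<mu> = work and I = "\<lambda>s'. frame {4, 5, 6, 7, 8, 9, 10, 15} {5, 6, 7} s s' \<and> Bst s' (var s' 9) {} \<and>
    printed s' = printed s \<and> tick s' + work s' \<le> tick s + work s \<and> (\<forall>v. arr s 5 v \<noteq> 0 \<longrightarrow> arr s' 5 v \<noteq> 0)"], goal_cases)
  case 1
  then show ?case using assms by simp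
next
  case (2 s1)
  have st: "stored L n s1" using stored_frame[of _ _ s s1] 2(1) assms(2) by auto
  show ?case
  proof (rule wp_mono[OF wp_visit[of "s1\<lparr>tick := tick s1 + 1\<rparr>"]], goal_cases)
    case (4 s2)
    then show ?case using 2(1) by (auto intro: frame_trans)
  qed (use 2 st in simp_all)
next
  case (3 s1)
  then have "Bst s1 (var s1 9) {}" by blast
  then have "var s1 9 \<le> var s1 8" unfolding Bst_def by (rule bfs_inv.t_le)
  then show ?case using 3 by simp
qed

lemma wp_search_from:
  assumes bf: "Bst s (var s 9) {}" "var s 8 = var s 9" and st: "stored L n s" and v: "var s 3 < n"
  shows "wp search_from (\<lambda>s'. frame {3, 4, 5, 6, 7, 8, 9, 10, 15} {5, 6, 7} s s' \<and> Bst s' (var s' 9) {} \<and> var s' 8 = var s' 9 \<and>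
    printed s' = printed s \<and> tick s' + work s' \<le> tick s + work s + 6 \<and> var s' 3 = var s 3 + 1 \<and>
    arr s' 5 (var s 3) \<noteq> 0 \<and> (\<forall>v. arr s 5 v \<noteq> 0 \<longrightarrow> arr s' 5 v \<noteq> 0)) s" (is "wp _ ?Q _")
proof -
  let ?R = "wp visit_all (wp (Assign 3 (Plus (Var 3) (Num 1))) ?Q)"
  let ?P = "\<lambda>s1. frame {8, 15} {5, 6} s s1 \<and> Bst s1 (var s1 9) {} \<and> printed s1 = printed s \<and> tick s1 \<le> tick s + 4 \<and> work s1 = work s \<and>
      arr s1 5 (var s 3) \<noteq> 0 \<and> (\<forall>v. arr s 5 v \<noteq> 0 \<longrightarrow> arr s1 5 v \<noteq> 0)"
  have main: "wp visit_all (wp (Assign 3 (Plus (Var 3) (Num 1))) ?Q) s1"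
    if s1: "frame {8, 15} {5, 6} s s1" "Bst s1 (var s1 9) {}" "printed s1 = printed s" "tick s1 \<le> tick s + 4" "work s1 = work s"
      "arr s1 5 (var s 3) \<noteq> 0" "\<forall>v. arr s 5 v \<noteq> 0 \<longrightarrow> arr s1 5 v \<noteq> 0" for s1
  proof (rule wp_mono[OF wp_visit_all[OF s1(2)]])
    show "stored L n s1" using stored_frame[OF s1(1)] st by simp
    fix s2 assume s2: "frame {4, 5, 6, 7, 8, 9, 10, 15} {5, 6, 7} s1 s2 \<and> Bst s2 (var s2 9) {} \<and> var s2 8 = var s2 9 \<and>
      printed s2 = printed s1 \<and> tick s2 + work s2 \<le> tick s1 + work s1 + 1 \<and> (\<forall>v. arr s1 5 v \<noteq> 0 \<longrightarrow> arr s2 5 v \<noteq> 0)"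
    have f: "frame {3, 4, 5, 6, 7, 8, 9, 10, 15} {5, 6, 7} s s2"
      by (rule frame_trans[OF frame_mono[OF s1(1)] frame_mono[OF conjunct1[OF s2]]]) auto
    have "var s2 3 = var s 3" using s1(1) s2 by (auto simp: frame_def)
    moreover have "frame {3, 4, 5, 6, 7, 8, 9, 10, 15} {5, 6, 7} s (s2\<lparr>var := (var s2)(3 := k), tick := j\<rparr>)" for k j
      using f by (simp add: frame_def)
    moreover have "work (s2\<lparr>var := (var s2)(3 := k), tick := j\<rparr>) = work s2" for k j
      by (simp add: work_def unscanned_def)
    moreover have "Bst (s2\<lparr>var := (var s2)(3 := k), tick := j\<rparr>) (var s2 9) {}" for k j
    proof -
      have "Bst s2 (var s2 9) {}" using s2 by blast
      then show ?thesis by (simp add: Bst_def)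
    qed
    ultimately show "wp (Assign 3 (Plus (Var 3) (Num 1))) ?Q s2"
      using s1 s2 by simp
  qed
  interpret B: bfs_inv G n "arr s 5" "arr s 6" "arr s 7" "var s 9" "var s 9" "var s 9" "{}"
    using bf by (simp add: Bst_def)
  show ?thesis
  proof (cases "arr s 5 (var s 3) = 0")
    case False
    have "wp (Assign 15 (Var 15)) ?P (s\<lparr>tick := tick s + 1\<rparr>)"
      using bf False by (simp add: frame_def Bst_def work_def unscanned_def)
    then have X: "wp (Assign 15 (Var 15)) ?R (s\<lparr>tick := tick s + 1\<rparr>)"
      by (rule wp_mono) (intro main, blast+)
    show ?thesis unfolding search_from_def wp_simps(5) wp_Ite skip_def
    proof (intro conjI impI, goal_cases)
      case 1
      show ?case by (rule X)
    next
      case 2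
      then show ?case using False by simp
    qed
  next
    case True
    \<comment> \<open>The gate entry of a root is the default 0, so the program does not write it,
      whereas \<open>discover\<close> speaks of an update with 0.\<close>
    have "arr s 7 (var s 9 - 1) = 0"
    proof (rule ccontr)
      assume "arr s 7 (var s 9 - 1) \<noteq> 0"
      then have "var s 9 - 1 + 1 < var s 9" using B.par_range by blast
      then show False by simp
    qed
    then have p: "(arr s 7)(var s 9 - 1 := 0) = arr s 7" by (simp add: fun_eq_iff)
    have D: "Bfs ((arr s 5)(var s 3 := var s 9)) ((arr s 6)(var s 9 := Suc (var s 3))) (arr s 7) (var s 9 + 2) (var s 9) (var s 9) {}"
      using B.discover[OF True v, of 0 "{}"] p by simp
    have W: "{u. u < n \<and> \<not> (((arr s 5)(var s 3 := var s 9)) u \<noteq> 0 \<and> ((arr s 5)(var s 3 := var s 9)) u < var s 9)} = unscanned s"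
      using True by (auto simp: unscanned_def)
    have "wp (Update 5 (Var 3) (Var 8) ;; Update 6 (Var 8) (Plus (Var 3) (Num 1)) ;; Assign 8 (Plus (Var 8) (Num 2)))
      ?P (s\<lparr>tick := tick s + 1\<rparr>)"
      using D W B.t_ge bf(2) by (simp add: frame_def Bst_def work_def unscanned_def[of "state.fields _ _ _ _ _"] unscanned_def)
    then have "wp (Update 5 (Var 3) (Var 8) ;; Update 6 (Var 8) (Plus (Var 3) (Num 1)) ;; Assign 8 (Plus (Var 8) (Num 2)))
      ?R (s\<lparr>tick := tick s + 1\<rparr>)"
      by (rule wp_mono) (intro main, blast+)
    note X = this[unfolded wp_simps(5)]
    show ?thesis unfolding search_from_def wp_simps(5) wp_Ite
    proof (intro conjI impI, goal_cases)
      case 1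
      then show ?case using True by simp
    next
      case 2
      show ?case by (rule X)
    qed
  qed
qed

lemma sum_lengths: "(\<Sum>v<n. length (L ! v)) = length (concat L)"
  by (simp add: n_def length_concat sum_list_sum_nth atLeast0LessThan)

lemma wp_search:
  assumes st: "stored L n s" and z: "\<forall>a\<ge>5. arr s a = (\<lambda>_. 0)"
  shows "wp search (\<lambda>s'. frame {3, 4, 5, 6, 7, 8, 9, 10, 15} {5, 6, 7} s s' \<and>
    bfs_done G n (arr s' 5) (arr s' 6) (arr s' 7) (var s' 8) \<and>
    printed s' = printed s \<and> tick s' \<le> tick s + 10 * length (concat L) + 16 * n + 4) s"
  unfolding search_def wp_simps
\<comment> \<open>A start vertex costs 7 ticks, namely 6 beyond the released potential in
  \<open>search_from\<close> and 1 for the test. The terms with the list lengths and with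
  \<open>9 * n\<close> are the initial potential.\<close>
proof (rule wp_While[where \<mu> = "\<lambda>s'. n - var s' 3" and I = "\<lambda>s'. frame {3, 4, 5, 6, 7, 8, 9, 10, 15} {5, 6, 7} s s' \<and>
    Bst s' (var s' 9) {} \<and> var s' 8 = var s' 9 \<and> var s' 3 \<le> n \<and> (\<forall>v<var s' 3. arr s' 5 v \<noteq> 0) \<and>
    printed s' = printed s \<and> tick s' + work s' \<le> tick s + 10 * length (concat L) + 9 * n + 7 * var s' 3 + 3"], goal_cases)
  case 1
  have "(\<Sum>v<n. 10 * length (L ! v) + 9) = 10 * length (concat L) + 9 * n"
    using sum_lengths by (simp add: sum.distrib sum_distrib_left[symmetric])
  then show ?case using z bfs_init by (simp add: frame_def Bst_def work_def unscanned_def lessThan_def)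
next
  case (2 s1)
  then have f: "frame {3, 4, 5, 6, 7, 8, 9, 10, 15} {5, 6, 7} s s1" by blast
  have st1: "stored L n s1" using stored_frame[OF f] st by simp
  then have v: "var s1 3 < n" using 2(2) by (simp add: stored_def n_def)
  show ?case
  proof (rule wp_mono[OF wp_search_from[of "s1\<lparr>tick := tick s1 + 1\<rparr>"]], goal_cases)
    case (5 s2)
    then show ?case using 2(1) v frame_trans[OF f] by (auto simp: less_Suc_eq)
  qed (use 2 st1 v in simp_all)
next
  case (3 s1)
  then have f: "frame {3, 4, 5, 6, 7, 8, 9, 10, 15} {5, 6, 7} s s1" by blast
  have st1: "stored L n s1" using stored_frame[OF f] st by simp
  then have v: "var s1 3 = n" using 3 by (simp add: stored_def n_def)
  have "bfs_done G n (arr s1 5) (arr s1 6) (arr s1 7) (var s1 8)"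
  proof (intro bfs_done.intro bfs_done_axioms.intro)
    have "Bst s1 (var s1 9) {}" "var s1 9 = var s1 8" using 3(1) by simp_all
    then show "Bfs (arr s1 5) (arr s1 6) (arr s1 7) (var s1 8) (var s1 8) (var s1 8) {}"
      by (simp only: Bst_def)
    show "arr s1 5 u \<noteq> 0" if "u < n" for u using 3(1) v that by blast
  qed
  then show ?case using 3 v by simp
qed

end

section \<open>The pairing of open paths as a program\<close>

definition emit :: "exp \<Rightarrow> exp \<Rightarrow> com" where
  "emit e f = Update 11 (Var 13) e ;; Update 12 (Var 13) f ;; Assign 13 (Plus (Var 13) (Num 1))"

text \<open>One or two ends remain in the slot. Of three or four ends, the old one in array 8 is
  joined with the new one in variable 14. Whenever two ends remain in a slot that was not empty
  before, one is old and one is new, so they again come from different children.\<close>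

definition merge :: com where
  "merge = Ite (Arr 8 (Var 12))
     (Update 10 (Var 12) (Num 1) ;;
      Ite (Var 15)
        (emit (Arr 8 (Var 12)) (Var 14) ;; Update 8 (Var 12) (Var 15))
        (Ite (Arr 9 (Var 12))
          (emit (Arr 8 (Var 12)) (Var 14) ;; Update 8 (Var 12) (Arr 9 (Var 12)) ;; Update 9 (Var 12) (Num 0))
          (Update 9 (Var 12) (Var 14))))
     (Update 8 (Var 12) (Var 14) ;; Update 9 (Var 12) (Var 15))"

definition finish :: com where
  "finish = Ite (Var 15)
     (Ite (Arr 10 (Var 11)) (emit (Var 14) (Var 15)) (emit (Var 14) (Var 11) ;; emit (Var 15) (Var 11)))
     (emit (Var 14) (Var 11))"

definition take_slot :: com where
  "take_slot = Assign 14 (Arr 8 (Var 11)) ;; Assign 15 (Arr 9 (Var 11)) ;;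
     Ite (Var 14) skip (Ite (Arr 6 (Var 11)) (Assign 14 (Var 11)) skip)"

definition greedy_step :: com where
  "greedy_step = take_slot ;;
     Ite (Var 14) (Assign 12 (Arr 7 (Var 11)) ;; Ite (Arr 7 (Var 12)) merge finish) skip ;;
     Assign 11 (Minus (Var 11) (Num 1))"

text \<open>The sweep begins at the largest vertex number, which is 2 below the next free one, and
  stops at 1.\<close>

definition greedy :: com where
  "greedy = Assign 11 (Minus (Var 8) (Num 2)) ;; Assign 13 (Num 0) ;; While (Minus (Var 11) (Num 1)) greedy_step"

definition elist :: "(nat \<Rightarrow> nat) \<Rightarrow> (nat \<Rightarrow> nat) \<Rightarrow> nat \<Rightarrow> (nat \<times> nat) list" where
  "elist f g k = map (\<lambda>i. (f i, g i)) [0..<k]"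

lemma elist_0[simp]: "elist f g 0 = []"
  by (simp add: elist_def)

lemma elist_Suc[simp]: "elist (f(k := p)) (g(k := q)) (Suc k) = elist f g k @ [(p, q)]"
  by (simp add: elist_def)

context block_tree_on
begin

definition Gst :: "nat \<Rightarrow> nat \<Rightarrow> nat \<Rightarrow> nat \<Rightarrow> nat \<Rightarrow> state \<Rightarrow> bool" where
  "Gst N k j a b s \<longleftrightarrow> Inv N k j a b (arr s 8) (arr s 9) (arr s 10) (elist (arr s 11) (arr s 12) (var s 13))"

lemma wp_merge:
  assumes inv: "Gst N k (Suc k) a b s" and k: "real_node k" "k \<le> N" "par (par k) \<noteq> 0"
    and a: "a \<in> X" "anc par a k" and b: "b \<noteq> 0 \<Longrightarrow> b \<in> X \<and> anc par b k"
    and v: "var s 14 = a" "var s 15 = b" "var s 12 = par k"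
  shows "wp merge (\<lambda>s'. frame {13} {8, 9, 10, 11, 12} s s' \<and> Gst N k k 0 0 s' \<and> printed s' = printed s \<and> tick s' \<le> tick s + 9) s"
proof -
  let ?A = "arr s 8" and ?B = "arr s 9" and ?M = "arr s 10" and ?es = "elist (arr s 11) (arr s 12) (var s 13)"
  define y where "y = par k"
  note vy = v(3)[folded y_def] and py = k(3)[folded y_def]
  have a0: "a \<noteq> 0" using X_pos[OF a(1)] by simp
  note M = inv_merge[OF inv[unfolded Gst_def] k(1,2) y_def py a b]
  consider "?A y = 0" | "?A y \<noteq> 0" "b \<noteq> 0" | "?A y \<noteq> 0" "b = 0" "?B y \<noteq> 0" | "?A y \<noteq> 0" "b = 0" "?B y = 0" by blast
  then show ?thesis
  proof cases
    case 1
    have "y < k" using par_less real_pos k(1) y_def by blast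
    then have B0: "?B y = 0"
      using greedy_inv.A0_B0[OF inv[unfolded Gst_def]] 1 by blast
    have "Inv N k k 0 0 (?A(y := a)) (?B(y := b)) ?M (?es @ [])"
      by (rule M[where p = a and q = b and em = "[]"]) (use 1 a0 B0 in simp_all)
    then show ?thesis using 1 v vy by (simp add: merge_def frame_def Gst_def)
  next
    case 2
    have "Inv N k k 0 0 (?A(y := b)) (?B(y := ?B y)) (?M(y := 1)) (?es @ [(?A y, a)])"
      by (rule M[where p = b and q = "?B y" and em = "[(?A y, a)]"]) (use 2 in simp_all)
    then show ?thesis using 2 v vy by (simp add: merge_def emit_def frame_def Gst_def)
  next
    case 3
    have "Inv N k k 0 0 (?A(y := ?B y)) (?B(y := 0)) (?M(y := 1)) (?es @ [(?A y, a)])"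
      by (rule M[where p = "?B y" and q = 0 and em = "[(?A y, a)]"]) (use 3 in simp_all)
    then show ?thesis using 3 v vy by (simp add: merge_def emit_def frame_def Gst_def)
  next
    case 4
    have "Inv N k k 0 0 (?A(y := ?A y)) (?B(y := a)) (?M(y := 1)) (?es @ [])"
      by (rule M[where p = "?A y" and q = a and em = "[]"]) (use 4 in simp_all)
    then show ?thesis using 4 v vy by (simp add: merge_def emit_def frame_def Gst_def)
  qed
qed

lemma wp_finish:
  assumes inv: "Gst N k (Suc k) a b s" and k: "k \<in> X" "par (par k) = 0"
    and a: "a \<in> X" "anc par a k" and b: "b \<noteq> 0 \<Longrightarrow> b \<in> X \<and> anc par b k \<and> \<not> leaf k"
    and split: "arr s 10 k \<noteq> 0 \<Longrightarrow> b \<noteq> 0 \<Longrightarrow> split_at k a b"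
    and v: "var s 14 = a" "var s 15 = b" "var s 11 = k"
  shows "wp finish (\<lambda>s'. frame {13} {8, 9, 10, 11, 12} s s' \<and> Gst N k k 0 0 s' \<and> printed s' = printed s \<and> tick s' \<le> tick s + 9) s"
  using inv_finish[OF inv[unfolded Gst_def] k a b split refl] v
  by (simp add: finish_def emit_def frame_def Gst_def split: if_splits)

lemma wp_greedy_step:
  assumes inv: "Gst N (Suc x) (Suc x) 0 0 s" and x: "var s 11 = x" "0 < x" "x \<le> N"
    and par: "arr s 7 = par" and vt: "\<And>i. arr s 6 i \<noteq> 0 \<longleftrightarrow> i \<in> X"
  shows "wp greedy_step (\<lambda>s'. frame {11, 12, 13, 14, 15} {8, 9, 10, 11, 12} s s' \<and> var s' 11 = x - 1 \<and> Gst N x x 0 0 s' \<and>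
    printed s' = printed s \<and> tick s' \<le> tick s + 20) s" (is "wp _ ?Q _")
proof -
  let ?A = "arr s 8" and ?B = "arr s 9" and ?M = "arr s 10" and ?es = "elist (arr s 11) (arr s 12) (var s 13)"
  note I = inv[unfolded Gst_def]
  have B0: "?A x = 0 \<Longrightarrow> ?B x = 0" using greedy_inv.A0_B0[OF I, of x] by simp
  define rest where "rest = Ite (Var 14) (Assign 12 (Arr 7 (Var 11)) ;; Ite (Arr 7 (Var 12)) merge finish) skip ;;
     Assign 11 (Minus (Var 11) (Num 1))"
  define a where "a = (if ?A x \<noteq> 0 then ?A x else if x \<in> X then x else 0)"
  define b where "b = ?B x"
  have ts: "wp take_slot (\<lambda>s1. frame {14, 15} {} s s1 \<and> var s1 14 = a \<and> var s1 15 = b \<and> printed s1 = printed s \<and> tick s1 \<le> tick s + 5) s"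
    using vt[of x] x by (simp add: take_slot_def skip_def frame_def a_def b_def)
  have "wp rest ?Q s1" if s1: "frame {14, 15} {} s s1" "var s1 14 = a" "var s1 15 = b" "printed s1 = printed s" "tick s1 \<le> tick s + 5" for s1
  proof -
    have fr: "arr s1 = arr s" "var s1 11 = x" "var s1 13 = var s 13" using s1(1) x(1) by (auto simp: frame_def)
    have G1: "Gst m k j p q s1 = Gst m k j p q s" for m k j p q using fr by (simp add: Gst_def)
    show ?thesis
    proof (cases "a = 0")
      case True
      then have A0: "?A x = 0" "x \<notin> X" using x(2) by (auto simp: a_def split: if_splits)
      have "Gst N x x 0 0 s" unfolding Gst_def by (rule inv_skip[OF I A0 x(2)])
      then show ?thesis using True s1 fr by (simp add: rest_def skip_def frame_def Gst_def)
    next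
      case False
      have H: "Gst N x (Suc x) a b s" "real_node x" "a \<in> X" "anc par a x" "b \<noteq> 0 \<Longrightarrow> b \<in> X \<and> anc par b x \<and> \<not> leaf x"
        "?M x \<noteq> 0 \<Longrightarrow> b \<noteq> 0 \<Longrightarrow> split_at x a b"
      proof -
        consider "?A x \<noteq> 0" "a = ?A x" | "?A x = 0" "x \<in> X" "a = x" "b = 0"
          using False B0 by (auto simp: a_def b_def split: if_splits)
        then have "Gst N x (Suc x) a b s \<and> real_node x \<and> a \<in> X \<and> anc par a x \<and> (b \<noteq> 0 \<longrightarrow> b \<in> X \<and> anc par b x \<and> \<not> leaf x) \<and>
          (?M x \<noteq> 0 \<longrightarrow> b \<noteq> 0 \<longrightarrow> split_at x a b)"
        proof cases
          case 1
          note h = inv_hold_slot[OF I 1(1) x(2)]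
          show ?thesis unfolding 1(2) b_def Gst_def using h by blast
        next
          case 2
          then show ?thesis using inv_hold_leaf[OF I 2(1,2)] anc_refl by (simp add: Gst_def real_node_def)
        qed
        then show "Gst N x (Suc x) a b s" "real_node x" "a \<in> X" "anc par a x" "b \<noteq> 0 \<Longrightarrow> b \<in> X \<and> anc par b x \<and> \<not> leaf x"
          "?M x \<noteq> 0 \<Longrightarrow> b \<noteq> 0 \<Longrightarrow> split_at x a b" by blast+
      qed
      define s2 where "s2 = s1\<lparr>var := (var s1)(12 := par x), tick := Suc (Suc (Suc (tick s1)))\<rparr>"
      have G2: "Gst N x (Suc x) a b s2" using H(1) G1 fr by (simp add: s2_def Gst_def)
      have v2: "var s2 14 = a" "var s2 15 = b" "var s2 12 = par x" "var s2 11 = x" "arr s2 10 = ?M"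
        using s1 fr by (simp_all add: s2_def)
      let ?F = "\<lambda>s'. frame {13} {8, 9, 10, 11, 12} s2 s' \<and> Gst N x x 0 0 s' \<and> printed s' = printed s2 \<and> tick s' \<le> tick s2 + 9"
      have "wp (if par (par x) \<noteq> 0 then merge else finish)
         ?F s2"
      proof (cases "par (par x) = 0")
        case True
        have "x \<in> X" using real_even[OF H(2)] True by blast
        then have "wp finish ?F s2"
          using True H v2 by (intro wp_finish[OF G2]) simp_all
        then show ?thesis using True by simp
      next
        case False
        then have "wp merge ?F s2"
          using H v2 x by (intro wp_merge[OF G2]) simp_all
        then show ?thesis using False by simp
      qed
      then have "wp (if par (par x) \<noteq> 0 then merge else finish) (wp (Assign 11 (Minus (Var 11) (Num 1))) ?Q) s2"
      proof (rule wp_mono)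
        fix s3 assume s3: "frame {13} {8, 9, 10, 11, 12} s2 s3 \<and> Gst N x x 0 0 s3 \<and> printed s3 = printed s2 \<and> tick s3 \<le> tick s2 + 9"
        then have "var s3 11 = x" using v2 by (auto simp: frame_def)
        moreover have "frame {11, 12, 13, 14, 15} {8, 9, 10, 11, 12} s s3"
          using s3 s1(1) by (auto simp: frame_def s2_def)
        then have "frame {11, 12, 13, 14, 15} {8, 9, 10, 11, 12} s (s3\<lparr>var := (var s3)(11 := i), tick := t\<rparr>)" for i t
          by (simp add: frame_def)
        moreover have "Gst N x x 0 0 (s3\<lparr>var := (var s3)(11 := i), tick := t\<rparr>)" for i t
          using s3 by (simp add: Gst_def)
        moreover have "printed s3 = printed s" "tick s3 \<le> tick s + 17"
          using s3 s1(4,5) by (simp_all add: s2_def)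
        ultimately show "wp (Assign 11 (Minus (Var 11) (Num 1))) ?Q s3" by simp
      qed
      then have W: "(0 < par (par x) \<longrightarrow> wp merge (wp (Assign 11 (Minus (Var 11) (Num 1))) ?Q) s2) \<and>
        (par (par x) = 0 \<longrightarrow> wp finish (wp (Assign 11 (Minus (Var 11) (Num 1))) ?Q) s2)" by (cases "par (par x) = 0") simp_all
      show ?thesis
        unfolding rest_def wp_simps(5) wp_Ite wp_simps(1)
      proof (intro conjI impI, goal_cases)
        case 1
        show ?case using W[unfolded wp_simps(1)] 1 fr par by (simp add: s2_def)
      next
        case 2
        show ?case using W[unfolded wp_simps(1)] 2 fr par by (simp add: s2_def)
      next
        case 3
        then show ?case using False s1 by simp
      qed
    qed
  qed
  then have "wp rest ?Q s1" if "frame {14, 15} {} s s1 \<and> var s1 14 = a \<and> var s1 15 = b \<and> printed s1 = printed s \<and> tick s1 \<le> tick s + 5" for s1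
    using that by blast
  from wp_mono[OF ts this] show ?thesis unfolding greedy_step_def rest_def wp_simps(5) .
qed

lemma wp_greedy:
  assumes nx: "var s 8 = N + 2" and XN: "X \<subseteq> {..N}" and N: "1 \<le> N"
    and par: "arr s 7 = par" and vt: "\<And>i. arr s 6 i \<noteq> 0 \<longleftrightarrow> i \<in> X" and z: "\<forall>a\<ge>8. arr s a = (\<lambda>_. 0)"
  shows "wp greedy (\<lambda>s'. frame {11, 12, 13, 14, 15} {8, 9, 10, 11, 12} s s' \<and> Gst N 2 2 0 0 s' \<and>
    printed s' = printed s \<and> tick s' \<le> tick s + 21 * N + 3) s"
  unfolding greedy_def wp_simps
proof (rule wp_While[where \<mu> = "\<lambda>s'. var s' 11" and I = "\<lambda>s'. frame {11, 12, 13, 14, 15} {8, 9, 10, 11, 12} s s' \<and>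
    1 \<le> var s' 11 \<and> var s' 11 \<le> N \<and> Gst N (Suc (var s' 11)) (Suc (var s' 11)) 0 0 s' \<and>
    printed s' = printed s \<and> tick s' \<le> tick s + 21 * (N - var s' 11) + 2"], goal_cases)
  case 1
  show ?case using inv_init[OF XN] nx N z by (simp add: frame_def Gst_def)
next
  case (2 s1)
  let ?s = "s1\<lparr>tick := tick s1 + 1\<rparr>"
  have f: "frame {11, 12, 13, 14, 15} {8, 9, 10, 11, 12} s s1" using 2 by blast
  have fa: "arr s1 7 = par" "arr s1 6 = arr s 6" using f par by (auto simp: frame_def)
  show ?case
  proof (rule wp_mono[OF wp_greedy_step[of N "var s1 11" ?s]], goal_cases)
    case 1
    then show ?case using 2(1) by (simp add: Gst_def)
  next
    case (7 s2)
    have "Suc (var s2 11) = var s1 11" using 7 2 by simp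
    moreover have "frame {11, 12, 13, 14, 15} {8, 9, 10, 11, 12} s s2" using 7 frame_trans[OF f] by simp
    moreover have "21 * (N - var s2 11) = 21 * (N - var s1 11) + 21"
    proof -
      have "var s2 11 = var s1 11 - 1" "1 < var s1 11" "var s1 11 \<le> N" using 7 2 by simp_all
      then show ?thesis by arith
    qed
    moreover have "1 \<le> var s2 11 \<and> var s2 11 \<le> N"
    proof -
      have "var s2 11 = var s1 11 - 1" "1 < var s1 11" "var s1 11 \<le> N" using 7 2 by simp_all
      then show ?thesis by arith
    qed
    ultimately show ?case using 7 2 by simp
  qed (use 2 fa vt in simp_all)
next
  case (3 s1)
  then have "var s1 11 = 1" by simp
  moreover have "tick s1 \<le> tick s + 21 * N + 2"
  proof -
    have "tick s1 \<le> tick s + 21 * (N - 1) + 2" using 3 calculation by simp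
    then show ?thesis by arith
  qed
  ultimately show ?case using 3 N by (simp add: Gst_def numeral_2_eq_2)
qed

end

section \<open>Printing the paths\<close>

definition climb_step :: com where
  "climb_step = Ite (Minus (Var 14) (Var 15))
     (Ite (Arr 6 (Var 14)) (Update 13 (Var 4) (Minus (Arr 6 (Var 14)) (Num 1)) ;; Assign 4 (Plus (Var 4) (Num 1))) skip ;;
      Assign 14 (Arr 7 (Var 14)))
     (Ite (Arr 6 (Var 15)) (Update 14 (Var 5) (Minus (Arr 6 (Var 15)) (Num 1)) ;; Assign 5 (Plus (Var 5) (Num 1))) skip ;;
      Assign 15 (Arr 7 (Var 15)))"

definition climb_loop :: com where
  "climb_loop = While (Plus (Minus (Var 14) (Var 15)) (Minus (Var 15) (Var 14))) climb_step"

definition print_up :: com where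
  "print_up = While (Minus (Var 4) (Var 12)) (Output (Arr 13 (Var 12)) ;; Assign 12 (Plus (Var 12) (Num 1)))"

definition print_down :: com where
  "print_down = While (Var 5) (Assign 5 (Minus (Var 5) (Num 1)) ;; Output (Arr 14 (Var 5)))"

definition print_path :: com where
  "print_path = Assign 14 (Arr 11 (Var 11)) ;; Assign 15 (Arr 12 (Var 11)) ;; Assign 4 (Num 0) ;; Assign 5 (Num 0) ;;
     climb_loop ;;
     Ite (Arr 6 (Var 14)) (Update 13 (Var 4) (Minus (Arr 6 (Var 14)) (Num 1)) ;; Assign 4 (Plus (Var 4) (Num 1))) skip ;;
     Output (Plus (Var 4) (Var 5)) ;; Assign 12 (Num 0) ;; print_up ;; print_down ;; Assign 11 (Plus (Var 11) (Num 1))"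

text \<open>The number of pairs is printed twice: as the isometric-path number, and as the length
  that begins the encoded list of paths.\<close>

definition print_all :: com where
  "print_all = Output (Var 13) ;; Output (Var 13) ;; Assign 11 (Num 0) ;; While (Minus (Var 13) (Var 11)) print_path"

lemmas wp_climb_unfold = wp_While_unfold[of "Plus (Minus (Var 14) (Var 15)) (Minus (Var 15) (Var 14))" climb_step, folded climb_loop_def]

definition elems :: "(nat \<Rightarrow> nat) \<Rightarrow> nat \<Rightarrow> nat list" where
  "elems f k = map f [0..<k]"

lemma elems_Suc[simp]: "elems (f(k := x)) (Suc k) = elems f k @ [x]"
  by (simp add: elems_def)

lemma elems_0[simp]: "elems f 0 = []"
  by (simp add: elems_def)

lemma length_elems[simp]: "length (elems f k) = k"
  by (simp add: elems_def)

text \<open>The vertices on a path of nodes; \<open>vtx x\<close> is 0 for a block and a vertex plus 1 otherwise.\<close>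

definition vertices :: "(nat \<Rightarrow> nat) \<Rightarrow> nat list \<Rightarrow> nat list" where
  "vertices vtx l = map (\<lambda>x. vtx x - 1) (filter (\<lambda>x. vtx x \<noteq> 0) l)"

lemma vertices_simps[simp]: "vertices vtx [] = []" "vertices vtx (l @ l') = vertices vtx l @ vertices vtx l'"
  "vertices vtx (x # l) = (if vtx x = 0 then [] else [vtx x - 1]) @ vertices vtx l" "vertices vtx (rev l) = rev (vertices vtx l)"
  by (simp_all add: vertices_def rev_filter[symmetric] rev_map)

lemma wp_print_up:
  assumes "var s 12 = 0"
  shows "wp print_up (\<lambda>s'. frame {12} {} s s' \<and> printed s' = printed s @ elems (arr s 13) (var s 4) \<and> tick s' = tick s + 3 * var s 4 + 1) s"
  unfolding print_up_def
proof (rule wp_While[where \<mu> = "\<lambda>s'. var s 4 - var s' 12" and I = "\<lambda>s'. frame {12} {} s s' \<and> var s' 12 \<le> var s 4 \<and>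
    printed s' = printed s @ elems (arr s 13) (var s' 12) \<and> tick s' = tick s + 3 * var s' 12"], goal_cases)
  case 1
  then show ?case using assms by simp
next
  case (2 s1)
  then have "var s1 4 = var s 4" "arr s1 13 = arr s 13" by (auto simp: frame_def)
  then show ?case using 2 by (auto simp: frame_def elems_def)
next
  case (3 s1)
  then have "var s1 4 = var s 4" by (auto simp: frame_def)
  then show ?case using 3 by simp
qed

lemma wp_print_down:
  "wp print_down (\<lambda>s'. frame {5} {} s s' \<and> printed s' = printed s @ rev (elems (arr s 14) (var s 5)) \<and> tick s' = tick s + 3 * var s 5 + 1) s"
  unfolding print_down_def
proof (rule wp_While[where \<mu> = "\<lambda>s'. var s' 5" and I = "\<lambda>s'. frame {5} {} s s' \<and> var s' 5 \<le> var s 5 \<and>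
    printed s' @ rev (elems (arr s 14) (var s' 5)) = printed s @ rev (elems (arr s 14) (var s 5)) \<and> tick s' + 3 * var s' 5 = tick s + 3 * var s 5"], goal_cases)
  case 1
  then show ?case by simp
next
  case (2 s1)
  then obtain d where d: "var s1 5 = Suc d" by (cases "var s1 5") auto
  have "arr s1 14 = arr s 14" using 2 by (auto simp: frame_def)
  then show ?case using 2 d by (auto simp: frame_def elems_def)
next
  case (3 s1)
  then show ?case by simp
qed

context parent_tree
begin

text \<open>The branch of \<open>a\<close> is collected in the order of the path and the branch of
  \<open>b\<close> in reverse order. The node \<open>c\<close> where they meet is in neither buffer
  yet.\<close>

lemma wp_climb:
  assumes "arr s 7 = par" "var s 14 = a" "var s 15 = b"
  shows "wp climb_loop (\<lambda>s'. \<exists>l1 c l2. climb par a b = l1 @ [c] @ rev l2 \<and> frame {4, 5, 14, 15} {13, 14} s s' \<and> var s' 14 = c \<and>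
    elems (arr s' 13) (var s' 4) = elems (arr s 13) (var s 4) @ vertices (arr s 6) l1 \<and>
    elems (arr s' 14) (var s' 5) = elems (arr s 14) (var s 5) @ vertices (arr s 6) l2 \<and>
    printed s' = printed s \<and> tick s' \<le> tick s + 6 * (length l1 + length l2) + 1) s" (is "wp _ (?Q a b s) _")
  using assms
proof (induction a b arbitrary: s rule: climb_induct)
  case (same a)
  then show ?case
    by (subst wp_climb_unfold) (simp, intro exI[of _ "[]"], simp)
next
  case (gt a b)
  let ?s = "s\<lparr>tick := tick s + 1\<rparr>"
  have "wp climb_step (\<lambda>s1. frame {4, 5, 14, 15} {13, 14} s s1 \<and> var s1 14 = par a \<and> var s1 15 = b \<and>
    elems (arr s1 13) (var s1 4) = elems (arr s 13) (var s 4) @ vertices (arr s 6) [a] \<and>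
    elems (arr s1 14) (var s1 5) = elems (arr s 14) (var s 5) \<and> printed s1 = printed s \<and> tick s1 \<le> tick s + 6) ?s"
    using gt.hyps gt.prems by (simp add: climb_step_def skip_def frame_def)
  then have "wp climb_step (wp climb_loop (?Q a b s)) ?s"
  proof (rule wp_mono)
    fix s1 assume s1: "frame {4, 5, 14, 15} {13, 14} s s1 \<and> var s1 14 = par a \<and> var s1 15 = b \<and>
      elems (arr s1 13) (var s1 4) = elems (arr s 13) (var s 4) @ vertices (arr s 6) [a] \<and>
      elems (arr s1 14) (var s1 5) = elems (arr s 14) (var s 5) \<and> printed s1 = printed s \<and> tick s1 \<le> tick s + 6"
    have fa: "arr s1 7 = par" "arr s1 6 = arr s 6" using s1 gt.prems by (auto simp: frame_def)
    show "wp climb_loop (?Q a b s) s1"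
    proof (rule wp_mono[OF gt.IH[of s1]], goal_cases)
      case (4 s2)
      then obtain l1 c l2 where l: "climb par (par a) b = l1 @ [c] @ rev l2" "frame {4, 5, 14, 15} {13, 14} s1 s2" "var s2 14 = c"
        "elems (arr s2 13) (var s2 4) = elems (arr s1 13) (var s1 4) @ vertices (arr s1 6) l1"
        "elems (arr s2 14) (var s2 5) = elems (arr s1 14) (var s1 5) @ vertices (arr s1 6) l2"
        "printed s2 = printed s1" "tick s2 \<le> tick s1 + 6 * (length l1 + length l2) + 1" by blast
      have "frame {4, 5, 14, 15} {13, 14} s s2" using frame_trans s1 l(2) by blast
      then show ?case using l s1 gt.hyps fa
        by (intro exI[of _ "a # l1"] exI[of _ c] exI[of _ l2]) (simp add: climb_gt)
    qed (use s1 fa in simp_all)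
  qed
  then show ?case using gt.hyps gt.prems by (subst wp_climb_unfold) simp
next
  case (lt a b)
  let ?s = "s\<lparr>tick := tick s + 1\<rparr>"
  have "wp climb_step (\<lambda>s1. frame {4, 5, 14, 15} {13, 14} s s1 \<and> var s1 14 = a \<and> var s1 15 = par b \<and>
    elems (arr s1 13) (var s1 4) = elems (arr s 13) (var s 4) \<and>
    elems (arr s1 14) (var s1 5) = elems (arr s 14) (var s 5) @ vertices (arr s 6) [b] \<and> printed s1 = printed s \<and> tick s1 \<le> tick s + 6) ?s"
    using lt.hyps lt.prems by (simp add: climb_step_def skip_def frame_def)
  then have "wp climb_step (wp climb_loop (?Q a b s)) ?s"
  proof (rule wp_mono)
    fix s1 assume s1: "frame {4, 5, 14, 15} {13, 14} s s1 \<and> var s1 14 = a \<and> var s1 15 = par b \<and>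
      elems (arr s1 13) (var s1 4) = elems (arr s 13) (var s 4) \<and>
      elems (arr s1 14) (var s1 5) = elems (arr s 14) (var s 5) @ vertices (arr s 6) [b] \<and> printed s1 = printed s \<and> tick s1 \<le> tick s + 6"
    have fa: "arr s1 7 = par" "arr s1 6 = arr s 6" using s1 lt.prems by (auto simp: frame_def)
    show "wp climb_loop (?Q a b s) s1"
    proof (rule wp_mono[OF lt.IH[of s1]], goal_cases)
      case (4 s2)
      then obtain l1 c l2 where l: "climb par a (par b) = l1 @ [c] @ rev l2" "frame {4, 5, 14, 15} {13, 14} s1 s2" "var s2 14 = c"
        "elems (arr s2 13) (var s2 4) = elems (arr s1 13) (var s1 4) @ vertices (arr s1 6) l1"
        "elems (arr s2 14) (var s2 5) = elems (arr s1 14) (var s1 5) @ vertices (arr s1 6) l2"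
        "printed s2 = printed s1" "tick s2 \<le> tick s1 + 6 * (length l1 + length l2) + 1" by blast
      have "frame {4, 5, 14, 15} {13, 14} s s2" using frame_trans s1 l(2) by blast
      then show ?case using l s1 lt.hyps fa
        by (intro exI[of _ l1] exI[of _ c] exI[of _ "b # l2"]) (simp add: climb_lt)
    qed (use s1 fa in simp_all)
  qed
  then show ?case using lt.hyps lt.prems by (subst wp_climb_unfold) simp
qed

definition node_path :: "(nat \<Rightarrow> nat) \<Rightarrow> nat \<times> nat \<Rightarrow> nat list" where
  "node_path vtx e = vertices vtx (climb par (fst e) (snd e))"

text \<open>The factor 9 consists of 6 ticks for climbing from a node and 3 for printing an
  entry.\<close>

lemma wp_print_path:
  assumes par: "arr s 7 = par"
  defines "e \<equiv> (arr s 11 (var s 11), arr s 12 (var s 11))"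
  shows "wp print_path (\<lambda>s'. frame {4, 5, 11, 12, 14, 15} {13, 14} s s' \<and> var s' 11 = Suc (var s 11) \<and>
    printed s' = printed s @ length (node_path (arr s 6) e) # node_path (arr s 6) e \<and>
    tick s' \<le> tick s + 9 * tdist par (fst e) (snd e) + 20) s" (is "wp _ ?Q _")
proof -
  define s1 where "s1 = s\<lparr>var := (var s)(14 := fst e, 15 := snd e, 4 := 0, 5 := 0), tick := Suc (Suc (Suc (Suc (tick s))))\<rparr>"
  define rest where "rest = Ite (Arr 6 (Var 14)) (Update 13 (Var 4) (Minus (Arr 6 (Var 14)) (Num 1)) ;; Assign 4 (Plus (Var 4) (Num 1))) skip ;;
     Output (Plus (Var 4) (Var 5)) ;; Assign 12 (Num 0) ;; print_up ;; print_down ;; Assign 11 (Plus (Var 11) (Num 1))"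
  have "wp climb_loop (wp rest ?Q) s1"
  proof (rule wp_mono[OF wp_climb[of s1 "fst e" "snd e"]], goal_cases)
    case (4 s2)
    then obtain l1 c l2 where l: "climb par (fst e) (snd e) = l1 @ [c] @ rev l2" "frame {4, 5, 14, 15} {13, 14} s1 s2" "var s2 14 = c"
        "elems (arr s2 13) (var s2 4) = vertices (arr s 6) l1" "elems (arr s2 14) (var s2 5) = vertices (arr s 6) l2"
        "printed s2 = printed s" "tick s2 \<le> tick s1 + 6 * (length l1 + length l2) + 1"
      by (auto simp: s1_def)
    have len: "length l1 + length l2 = tdist par (fst e) (snd e)"
      using length_climb[of "fst e" "snd e"] l(1) by simp
    have np: "node_path (arr s 6) e = vertices (arr s 6) (l1 @ [c]) @ rev (vertices (arr s 6) l2)"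
      by (simp add: node_path_def l(1))
    have vl: "length (vertices (arr s 6) l) \<le> length l" for l by (simp add: vertices_def)
    have fr: "frame {4, 5, 14, 15} {13, 14} s s2" using l(2) by (auto simp: frame_def s1_def)
    have a6: "arr s2 6 = arr s 6" using fr by (simp add: frame_def)
    have 3: "wp print_up (wp print_down (wp (Assign 11 (Plus (Var 11) (Num 1))) ?Q)) s3"
      if s3: "frame {4, 5, 12, 14, 15} {13, 14} s s3" "var s3 12 = 0" "elems (arr s3 13) (var s3 4) = vertices (arr s 6) (l1 @ [c])"
        "elems (arr s3 14) (var s3 5) = vertices (arr s 6) l2" "printed s3 = printed s @ [var s3 4 + var s3 5]"
        "tick s3 \<le> tick s2 + 5" for s3
    proof (rule wp_mono[OF wp_print_up[OF s3(2)]])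
      fix s4 assume s4: "frame {12} {} s3 s4 \<and> printed s4 = printed s3 @ elems (arr s3 13) (var s3 4) \<and> tick s4 = tick s3 + 3 * var s3 4 + 1"
      then have e4: "var s4 5 = var s3 5" "arr s4 14 = arr s3 14" by (auto simp: frame_def)
      show "wp print_down (wp (Assign 11 (Plus (Var 11) (Num 1))) ?Q) s4"
      proof (rule wp_mono[OF wp_print_down])
        fix s5 assume s5: "frame {5} {} s4 s5 \<and> printed s5 = printed s4 @ rev (elems (arr s4 14) (var s4 5)) \<and> tick s5 = tick s4 + 3 * var s4 5 + 1"
        have v11: "var s5 11 = var s 11" using s5 s4 s3(1) by (auto simp: frame_def)
        have f5: "frame {4, 5, 11, 12, 14, 15} {13, 14} s (s5\<lparr>var := (var s5)(11 := i), tick := t\<rparr>)" for i t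
          using s5 s4 s3(1) by (auto simp: frame_def)
        have c1: "var s3 4 = length (vertices (arr s 6) (l1 @ [c]))" "var s3 5 = length (vertices (arr s 6) l2)"
          using s3(3,4) length_elems by metis+
        then have pr: "printed s5 = printed s @ length (node_path (arr s 6) e) # node_path (arr s 6) e"
          using s5 s4 s3(3,4,5) e4 by (simp add: np)
        have "var s3 4 \<le> length l1 + 1" "var s3 5 \<le> length l2"
          using c1 vl[of "l1 @ [c]"] vl[of l2] by simp_all
        then have "tick s5 \<le> tick s + 9 * tdist par (fst e) (snd e) + 15"
          using s5 s4 s3(6) l(7) e4 len[symmetric] by (simp add: s1_def)
        then show "wp (Assign 11 (Plus (Var 11) (Num 1))) ?Q s5" using f5 pr v11 by simp
      qed
    qed
    let ?pre = "Ite (Arr 6 (Var 14)) (Update 13 (Var 4) (Minus (Arr 6 (Var 14)) (Num 1)) ;; Assign 4 (Plus (Var 4) (Num 1))) skip ;;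
      Output (Plus (Var 4) (Var 5)) ;; Assign 12 (Num 0)"
    have "wp ?pre (\<lambda>s3. frame {4, 5, 12, 14, 15} {13, 14} s s3 \<and> var s3 12 = 0 \<and>
        elems (arr s3 13) (var s3 4) = vertices (arr s 6) (l1 @ [c]) \<and> elems (arr s3 14) (var s3 5) = vertices (arr s 6) l2 \<and>
        printed s3 = printed s @ [var s3 4 + var s3 5] \<and> tick s3 \<le> tick s2 + 5) s2"
      using fr l a6 by (simp add: skip_def frame_def)
    then have "wp ?pre (wp print_up (wp print_down (wp (Assign 11 (Plus (Var 11) (Num 1))) ?Q))) s2"
      by (rule wp_mono) (use 3 in blast)
    then show ?case unfolding rest_def wp_simps(5) .
  qed (simp_all add: s1_def par)
  then show ?thesis
    unfolding print_path_def rest_def wp_simps(5) by (simp add: s1_def e_def)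
qed

end

section \<open>Optimality of the pairing\<close>

context block_tree_graph
begin

text \<open>All neighbours of a leaf hang in the same block as the leaf or are the parent of that
  block. All neighbours of a root with one child block hang in that block.\<close>

lemma simple_simplicial:
  assumes l: "l \<in> X" "simple l"
  shows "simplicial (parcs G) (vt l)"
  unfolding simplicial_def
proof (intro allI impI, elim conjE)
  fix u v assume uv: "(vt l, u) \<in> parcs G" "(vt l, v) \<in> parcs G" "u \<noteq> v"
  let ?x = "num u" and ?y = "num v"
  have V: "u \<in> pverts G" "v \<in> pverts G" and t: "tadj par l ?x" "tadj par l ?y"
    using uv(1,2) vt_X[OF l(1)] by (simp_all add: parcs_iff)
  have X: "?x \<in> X" "?y \<in> X" using num_in_X V by blast+
  have xy: "?x \<noteq> ?y" using vt_num[OF V(1)] vt_num[OF V(2)] uv(3) by metis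
  have real: "real_node (par z)" if "z \<in> X" "par (par z) = l" for z
    unfolding real_node_def using that X_pos[OF l(1)] by simp
  have "tadj par ?x ?y"
  proof (cases "leaf l")
    case True
    have c: "par z = par l \<or> par (par l) = z" if "z \<in> X" "tadj par l z" for z
      using that real[OF that(1)] True unfolding tadj_def leaf_def by metis
    show ?thesis using c[OF X(1) t(1)] c[OF X(2) t(2)] xy unfolding tadj_def by metis
  next
    case False
    then have r: "par (par l) = 0" using l(2) by (auto simp: simple_def)
    have c: "par (par z) = l" if z: "z \<in> X" "tadj par l z" for z
    proof -
      have "par l \<noteq> par z" using X_root_only[OF l(1) z(1) r] z(2) by (auto simp: tadj_def)
      moreover have "z \<noteq> 0" using X_pos[OF z(1)] by simp
      ultimately show ?thesis using z(2) r unfolding tadj_def by metis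
    qed
    have "par ?x = par ?y"
      using l(2) real[OF X(1) c[OF X(1) t(1)]] real[OF X(2) c[OF X(2) t(2)]] c[OF X(1) t(1)] c[OF X(2) t(2)]
      unfolding simple_def by blast
    then show ?thesis using xy by (simp add: tadj_def)
  qed
  then show "(u, v) \<in> parcs G" using V by (simp add: parcs_iff)
qed

text \<open>Component by component, the bound on the emitted pairs by simple vertices meets the
  lower bound for covers. The last claim follows by comparison with the cover by single vertices; it
  keeps the constant cost per printed path linear in total.\<close>

lemma greedy_optimal:
  assumes "Inv N 2 2 0 0 A B M es"
  defines "ps \<equiv> map (\<lambda>e. gpath (fst e) (snd e)) es"
  shows "isometric_path_cover (with_proj G) ps" "length ps = ip (with_proj G)" "length ps \<le> card (pverts G)"
proof -
  note F = inv_final[OF assms(1)]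
  show cover: "isometric_path_cover (with_proj G) ps"
    unfolding isometric_path_cover_def
  proof (intro conjI ballI)
    fix p assume "p \<in> set ps"
    then obtain e where "e \<in> set es" "p = gpath (fst e) (snd e)" by (auto simp: ps_def)
    then show "isometric_path (with_proj G) p" using isometric_gpath(1) F(3) by blast
  next
    fix v assume "v \<in> verts (with_proj G)"
    then have v: "v \<in> pverts G" by simp
    then obtain e where e: "e \<in> set es" "num v \<in> set (climb par (fst e) (snd e))"
      using F(1)[OF num_in_X[OF v]] by (auto simp: covered_def)
    have "fst e \<in> X \<and> snd e \<in> X \<and> root_of par (fst e) = root_of par (snd e)" using F(3)[OF e(1)] .
    then have "vt (num v) \<in> set (gpath (fst e) (snd e))"
      using isometric_gpath(3)[OF _ _ _ num_in_X[OF v] e(2)] by blast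
    then show "\<exists>p\<in>set ps. v \<in> set p" using e(1) vt_num[OF v] by (auto simp: ps_def)
  qed
  let ?cid = "\<lambda>v. root_of par (num v)"
  let ?C = "?cid ` pverts G"
  have lower: "length es \<le> length qs" if "isometric_path_cover (with_proj G) qs" for qs
  proof -
    have "length es = (\<Sum>c\<in>?C. ends_in c es)"
      unfolding ends_in_def
    proof (rule length_filter_partition)
      show "finite ?C" using finite_pverts by simp
      fix e assume "e \<in> set es"
      then have "fst e \<in> X" using F(3) by blast
      then show "root_of par (fst e) \<in> ?C" using vt_X[of "fst e"] by (metis image_eqI)
    qed
    also have "\<dots> \<le> length qs"
    proof (rule isometric_cover_lower_bound[OF that sym_parcs, where cid = ?cid])
      show "?cid u = ?cid v" if "(u, v) \<in> parcs G" for u v using root_of_adj[OF that] .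
      show "finite ?C" "finite (pverts G)" using finite_pverts by simp_all
      fix c assume "c \<in> ?C"
      then obtain v where "v \<in> pverts G" "c = ?cid v" by blast
      then have "0 < c" using root_of_props X_pos num_in_X by blast
      have inj: "inj_on vt X" by (rule inj_on_inverseI[of _ num]) (use vt_X in blast)
      have sX: "simples c \<subseteq> X" by (auto simp: simples_def)
      have "vt ` simples c \<subseteq> {v \<in> pverts G. ?cid v = c \<and> simplicial (parcs G) v}"
      proof
        fix v assume "v \<in> vt ` simples c"
        then obtain l where l: "v = vt l" "l \<in> X" "simple l" "root_of par l = c" by (auto simp: simples_def)
        then show "v \<in> {v \<in> pverts G. ?cid v = c \<and> simplicial (parcs G) v}"
          using vt_X[OF l(2)] simple_simplicial by simp
      qed
      then have "card (vt ` simples c) \<le> card {v \<in> pverts G. ?cid v = c \<and> simplicial (parcs G) v}"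
        using finite_pverts by (intro card_mono) simp_all
      then have "card (simples c) \<le> card {v \<in> pverts G. ?cid v = c \<and> simplicial (parcs G) v}"
        using card_image[OF inj_on_subset[OF inj sX]] by simp
      then show "2 * ends_in c es \<le> card {v \<in> pverts G. ?cid v = c \<and> simplicial (parcs G) v} + 1"
        using F(2)[OF \<open>0 < c\<close>] by simp
    qed simp
    finally show ?thesis .
  qed
  have "ip (with_proj G) = length ps"
    unfolding ip_def
  proof (rule Least_equality)
    show "\<exists>qs. isometric_path_cover (with_proj G) qs \<and> length qs = length ps" using cover by blast
    fix k assume "\<exists>qs. isometric_path_cover (with_proj G) qs \<and> length qs = k"
    then show "length ps \<le> k" using lower by (auto simp: ps_def)
  qed
  then show "length ps = ip (with_proj G)" by simp
  have "isometric_path_cover (with_proj G) (map (\<lambda>v. [v]) (sorted_list_of_set (pverts G)))"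
    using finite_pverts by (auto simp: isometric_path_cover_def isometric_path_def vpath_iff)
  from lower[OF this] show "length ps \<le> card (pverts G)" by (simp add: ps_def)
qed

end

text \<open>The program tells vertices from blocks by the entry of \<open>vtx\<close>, the tree
  argument by parity. Both select the same nodes, since every odd node on a climb between members of
  \<open>X\<close> is in \<open>X\<close>.\<close>

lemma node_path_gpath:
  assumes "block_tree_graph par X G num (\<lambda>i. vtx i - 1)" and v: "\<And>i. vtx i \<noteq> 0 \<longleftrightarrow> i \<in> X"
    and e: "fst e \<in> X" "snd e \<in> X"
  shows "parent_tree.node_path par vtx e = block_tree_graph.gpath par (\<lambda>i. vtx i - 1) (fst e) (snd e)"
proof -
  interpret block_tree_graph par X G num "\<lambda>i. vtx i - 1" by fact
  have "filter (\<lambda>x. vtx x \<noteq> 0) (climb par (fst e) (snd e)) = filter odd (climb par (fst e) (snd e))"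
    using v X_odd climb_X[OF e] by (intro filter_cong) blast+
  then show ?thesis unfolding node_path_def gpath_def vertices_def by (simp only:)
qed

lemma (in parent_tree) wp_print_all:
  assumes par: "arr s 7 = par"
  defines "es \<equiv> elist (arr s 11) (arr s 12) (var s 13)"
  shows "wp print_all (\<lambda>s'. printed s' = printed s @ length es # encode_lists (map (node_path (arr s 6)) es) \<and>
    tick s' \<le> tick s + 9 * (\<Sum>e\<leftarrow>es. tdist par (fst e) (snd e)) + 21 * length es + 4) s"
  unfolding print_all_def wp_simps
proof (rule wp_While[where \<mu> = "\<lambda>s'. var s 13 - var s' 11" and I = "\<lambda>s'. frame {4, 5, 11, 12, 14, 15} {13, 14} s s' \<and> var s' 11 \<le> var s 13 \<and>
    printed s' = printed s @ length es # length es # concat (map (\<lambda>p. length p # p) (map (node_path (arr s 6)) (take (var s' 11) es))) \<and>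
    tick s' \<le> tick s + 9 * (\<Sum>e\<leftarrow>take (var s' 11) es. tdist par (fst e) (snd e)) + 21 * var s' 11 + 3"], goal_cases)
  case 1
  show ?case by (simp add: frame_def es_def elist_def)
next
  case (2 s1)
  let ?s = "s1\<lparr>tick := tick s1 + 1\<rparr>"
  have f: "frame {4, 5, 11, 12, 14, 15} {13, 14} s s1" using 2 by blast
  have fr: "arr s1 7 = par" "arr s1 6 = arr s 6" "arr s1 11 = arr s 11" "arr s1 12 = arr s 12" "var s1 13 = var s 13"
    using f par by (simp_all add: frame_def)
  have i: "var s1 11 < var s 13" using 2(2) fr by simp
  let ?e = "(arr s 11 (var s1 11), arr s 12 (var s1 11))"
  have tk: "take (Suc (var s1 11)) es = take (var s1 11) es @ [?e]"
    using i by (simp add: es_def elist_def take_map[symmetric] take_Suc_conv_app_nth)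
  show ?case
  proof (rule wp_mono[OF wp_print_path], goal_cases)
    case 1
    then show ?case using fr by simp
  next
    case (2 s2)
    then have a: "frame {4, 5, 11, 12, 14, 15} {13, 14} s1 s2" "var s2 11 = Suc (var s1 11)"
      "printed s2 = printed s1 @ length (node_path (arr s 6) ?e) # node_path (arr s 6) ?e"
      "tick s2 \<le> tick s1 + 9 * tdist par (fst ?e) (snd ?e) + 21" using fr by simp_all
    have "frame {4, 5, 11, 12, 14, 15} {13, 14} s s2" using frame_trans[OF f a(1)] .
    then show ?case using a(2-) i \<open>frame _ _ s s1 \<and> _\<close> by (simp add: tk)
  qed
next
  case (3 s1)
  then have "var s1 13 = var s 13" by (simp add: frame_def)
  then have "var s1 11 = var s 13" using 3 by simp
  moreover have "length es = var s 13" by (simp add: es_def elist_def)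
  ultimately show ?case using 3 by (simp add: encode_lists_def)
qed

section \<open>The whole program and its running time\<close>

definition program :: com where
  "program = read_graph ;; search ;; greedy ;; print_all"

lemma wf_program: "wf_com program"
  by (simp add: program_def read_graph_def read_row_def read_entry_def search_def search_from_def visit_all_def visit_def
      scan_row_def scan_entry_def skip_def greedy_def greedy_step_def take_slot_def merge_def finish_def emit_def
      print_all_def print_path_def climb_loop_def climb_step_def print_up_def print_down_def)

context bfs_program
begin

text \<open>The lists contain every arc once, and the arcs towards larger numbers as well as those
  towards smaller numbers inject into the edges.\<close>

lemma length_concat_le: "length (concat L) \<le> 2 * num_edges (with_proj G)"
proof -
  let ?edges = "{{u, v} |u v. (u, v) \<in> E}"
  have fin: "finite E" using graph_with_proj(2)[OF graph] .
  have "E = (SIGMA v:{..<n}. {w. (v, w) \<in> E})" using E_verts by auto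
  then have "card E = card (SIGMA v:{..<n}. {w. (v, w) \<in> E})" by simp
  also have "\<dots> = (\<Sum>v<n. card {w. (v, w) \<in> E})"
  proof (rule card_SigmaI)
    show "\<forall>v\<in>{..<n}. finite {w. (v, w) \<in> E}"
      using finite_subset[of _ "{..<n}"] E_verts by (metis (no_types, lifting) finite_lessThan lessThan_iff mem_Collect_eq subsetI)
  qed simp
  also have "\<dots> = (\<Sum>v<n. length (L ! v))"
  proof (rule sum.cong[OF refl])
    fix v assume "v \<in> {..<n}"
    then show "card {w. (v, w) \<in> E} = length (L ! v)" using row[of v] distinct_card[of "L ! v"] by simp
  qed
  also have "\<dots> = length (concat L)" by (rule sum_lengths)
  finally have c: "length (concat L) = card E" by simp
  have half: "card {e \<in> E. P e} \<le> card ?edges"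
    if P: "\<And>u v. P (u, v) \<Longrightarrow> \<not> P (v, u)" for P
  proof (rule card_inj_on_le[of "\<lambda>e. {fst e, snd e}"])
    show "inj_on (\<lambda>e. {fst e, snd e}) {e \<in> E. P e}"
    proof (rule inj_onI)
      fix e e' assume e: "e \<in> {e \<in> E. P e}" "e' \<in> {e \<in> E. P e}" "{fst e, snd e} = {fst e', snd e'}"
      obtain u v u' v' where p: "e = (u, v)" "e' = (u', v')" by (cases e, cases e') blast
      have "u = u' \<and> v = v' \<or> u = v' \<and> v = u'" using e(3) by (auto simp: p doubleton_eq_iff)
      then show "e = e'" using P[of u v] e(1,2) by (auto simp: p)
    qed
    show "(\<lambda>e. {fst e, snd e}) ` {e \<in> E. P e} \<subseteq> ?edges"
    proof (rule image_subsetI)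
      fix e assume "e \<in> {e \<in> E. P e}"
      then have "(fst e, snd e) \<in> E" by simp
      then show "{fst e, snd e} \<in> ?edges" by blast
    qed
    show "finite ?edges"
      by (rule finite_subset[OF _ finite_imageI[OF fin, of "\<lambda>e. {fst e, snd e}"]]) force
  qed
  have split: "E = {e \<in> E. fst e < snd e} \<union> {e \<in> E. snd e < fst e}" using E_neq by fastforce
  have "card E \<le> card {e \<in> E. fst e < snd e} + card {e \<in> E. snd e < fst e}"
    by (rule ord_eq_le_trans[OF arg_cong[where f = card, OF split] card_Un_le])
  also have "\<dots> \<le> card ?edges + card ?edges" by (intro add_mono half) auto
  finally show ?thesis using c by (simp add: num_edges_def)
qed

lemma wp_program:
  "\<exists>ps. isometric_path_cover (with_proj G) ps \<and> length ps = ip (with_proj G) \<and>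
    wp program (\<lambda>s. printed s = ip (with_proj G) # encode_lists ps \<and> tick s \<le> 200 * (n + num_edges (with_proj G))) (start (encode_lists L))"
proof -
  let ?m = "length (concat L)"
  define good where "good s ps \<longleftrightarrow> isometric_path_cover (with_proj G) ps \<and> length ps = ip (with_proj G) \<and>
    printed s = ip (with_proj G) # encode_lists ps \<and> tick s \<le> 200 * (n + num_edges (with_proj G))" for s :: state and ps
  \<comment> \<open>A nonempty graph lets the additive constants of the running time be absorbed by
    a multiple of \<open>n\<close>.\<close>
  have n0: "1 \<le> n" using block_graph verts by (cases n) (auto simp: block_graph_def)
  have "wp program (\<lambda>s. \<exists>ps. good s ps) (start (encode_lists L))"
    unfolding program_def wp_simps(5)
  proof (rule wp_read_graph)
    fix s assume s: "stored L (length L) s" "\<forall>a\<ge>5. arr s a = (\<lambda>_. 0)" "printed s = []" "tick s \<le> 6 * length L + 5 * ?m + 2"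
    have st: "stored L n s" using s(1) by (simp add: n_def)
    show "wp search (wp greedy (wp print_all (\<lambda>s. \<exists>ps. good s ps))) s"
    proof (rule wp_mono[OF wp_search[OF st s(2)]], elim conjE)
      fix s1 :: state assume s1: "frame {3, 4, 5, 6, 7, 8, 9, 10, 15} {5, 6, 7} s s1"
        "bfs_done G n (arr s1 5) (arr s1 6) (arr s1 7) (var s1 8)" "printed s1 = printed s"
        "tick s1 \<le> tick s + 10 * ?m + 16 * n + 4"
      interpret D: bfs_done G n "arr s1 5" "arr s1 6" "arr s1 7" "var s1 8" by (rule s1(2))
      let ?X = "arr s1 5 ` {..<n}" and ?N = "2 * n + 1"
      interpret T: block_tree_graph "arr s1 7" ?X G "arr s1 5" "\<lambda>i. arr s1 6 i - 1" by (rule D.block_tree_graph)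
      have vt: "arr s1 6 i \<noteq> 0 \<longleftrightarrow> i \<in> ?X" for i
      proof
        assume "arr s1 6 i \<noteq> 0"
        then have v: "arr s1 5 (arr s1 6 i - 1) = i" "i \<noteq> 0" using D.vtx by blast+
        then have "arr s1 6 i - 1 < n" using D.num[of "arr s1 6 i - 1"] by simp
        then show "i \<in> ?X" using v(1) by (metis image_eqI lessThan_iff)
      next
        assume "i \<in> ?X"
        then obtain v where v: "v < n" "i = arr s1 5 v" by blast
        then show "arr s1 6 i \<noteq> 0" using D.num[OF D.all_found[OF v(1)]] by simp
      qed
      have XN: "?X \<subseteq> {..?N}"
      proof
        fix i assume "i \<in> ?X"
        then obtain v where v: "v < n" "i = arr s1 5 v" by blast
        have "odd i" "i < 2 * n + 3" using v D.num_odd[OF v(1)] D.num_less[OF v(1)] D.card_nx by simp_all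
        then show "i \<in> {..?N}" by (cases "i = 2 * n + 2") simp_all
      qed
      have z: "\<forall>a\<ge>8. arr s1 a = (\<lambda>_. 0)" using s(2) s1(1) by (simp add: frame_def)
      have nx: "var s1 8 = ?N + 2" using D.card_nx by simp
      show "wp greedy (wp print_all (\<lambda>s. \<exists>ps. good s ps)) s1"
      proof (rule wp_mono[OF T.wp_greedy[OF nx XN _ refl vt z]], simp, elim conjE)
        fix s2 :: state assume s2: "frame {11, 12, 13, 14, 15} {8, 9, 10, 11, 12} s1 s2" "T.Gst ?N 2 2 0 0 s2" "printed s2 = printed s1"
          "tick s2 \<le> tick s1 + 21 * ?N + 3"
        have fr: "arr s2 7 = arr s1 7" "arr s2 6 = arr s1 6" using s2(1) by (simp_all add: frame_def)
        define es where "es = elist (arr s2 11) (arr s2 12) (var s2 13)"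
        define ps where "ps = map (\<lambda>e. T.gpath (fst e) (snd e)) es"
        have I: "T.Inv ?N 2 2 0 0 (arr s2 8) (arr s2 9) (arr s2 10) es" using s2(2) by (simp add: T.Gst_def es_def)
        note opt = T.greedy_optimal[OF I, folded ps_def]
        have np: "map (T.node_path (arr s2 6)) es = ps"
          unfolding ps_def
        proof (rule map_cong[OF refl])
          fix e assume "e \<in> set es"
          then have "fst e \<in> ?X" "snd e \<in> ?X" using T.inv_final(3)[OF I] by blast+
          then show "T.node_path (arr s2 6) e = T.gpath (fst e) (snd e)"
            unfolding fr by (rule node_path_gpath[OF D.block_tree_graph vt])
        qed
        have len: "length es = length ps" by (simp add: ps_def)
        have d: "(\<Sum>e\<leftarrow>es. tdist (arr s1 7) (fst e) (snd e)) \<le> 2 * ?N" by (rule T.inv_final(4)[OF I])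
        have k: "length ps \<le> n" using opt(3) by (simp add: verts)
        show "wp print_all (\<lambda>s. \<exists>ps. good s ps) s2"
        proof (rule wp_mono[OF T.wp_print_all[OF fr(1), folded es_def]], elim conjE)
          fix s3 :: state assume s3: "printed s3 = printed s2 @ length es # encode_lists (map (T.node_path (arr s2 6)) es)"
            "tick s3 \<le> tick s2 + 9 * (\<Sum>e\<leftarrow>es. tdist (arr s1 7) (fst e) (snd e)) + 21 * length es + 4"
          have "printed s3 = ip (with_proj G) # encode_lists ps"
            using s3(1) s2(3) s1(3) s(3) opt(2) len by (simp add: np)
          \<comment> \<open>The four phases add up to at most \<open>121 * n + 15 * ?m + 52\<close>
            ticks, where \<open>?m\<close> is at most twice the number of edges and \<open>n\<close>
            is positive; 200 is a round bound.\<close>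
          moreover have "tick s3 \<le> 200 * (n + num_edges (with_proj G))"
            using s3(2) s2(4) s1(4) s(4) d k len n0 length_concat_le by (simp add: n_def[symmetric])
          ultimately have "good s3 ps" using opt(1,2) by (simp add: good_def)
          then show "\<exists>ps. good s3 ps" by blast
        qed
      qed
    qed
  qed
  then obtain s' ps where s': "exec program (start (encode_lists L)) s'" "good s' ps" unfolding wp_def by blast
  then show ?thesis unfolding wp_def good_def by blast
qed

end

theorem mainTheorem3:
  shows "\<exists>(P :: instr list) (C :: nat). \<forall>(G :: nat pair_pre_digraph) (L :: nat list list).
    block_graph (with_proj G) \<and> adjacency_lists G L \<longrightarrow>
    (\<exists>ps t. isometric_path_cover (with_proj G) ps \<and> length ps = ip (with_proj G) \<and>
       ram_computes P (encode_lists L) (ip (with_proj G) # encode_lists ps) t \<and>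
       t \<le> C * (card (verts (with_proj G)) + num_edges (with_proj G)))"
proof (rule exI[of _ "compile 0 program"], rule exI[of _ "unit_cost program * 200"], intro allI impI)
  fix G :: "nat pair_pre_digraph" and L :: "nat list list"
  assume a: "block_graph (with_proj G) \<and> adjacency_lists G L"
  then interpret bfs_program G "length L" L
    by unfold_locales (simp_all add: adjacency_lists_def)
  obtain ps where ps: "isometric_path_cover (with_proj G) ps" "length ps = ip (with_proj G)"
    "wp program (\<lambda>s. printed s = ip (with_proj G) # encode_lists ps \<and> tick s \<le> 200 * (length L + num_edges (with_proj G))) (start (encode_lists L))"
    using wp_program by blast
  \<comment> \<open>A tick stands for at most \<open>unit_cost program\<close> machine steps, a
    number fixed with the program; this explains the constant
    \<open>unit_cost program * 200\<close>.\<close>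
  obtain t where "t \<le> unit_cost program * (200 * (length L + num_edges (with_proj G)))"
    "ram_computes (compile 0 program) (encode_lists L) (ip (with_proj G) # encode_lists ps) t"
    using wp_ram_computes[OF ps(3) wf_program] by blast
  then show "\<exists>ps t. isometric_path_cover (with_proj G) ps \<and> length ps = ip (with_proj G) \<and>
       ram_computes (compile 0 program) (encode_lists L) (ip (with_proj G) # encode_lists ps) t \<and>
       t \<le> unit_cost program * 200 * (card (verts (with_proj G)) + num_edges (with_proj G))"
    using ps(1,2) by (intro exI[of _ ps] exI[of _ t]) (simp add: verts mult.assoc)
qed

end
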